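(* Let $\alpha$ and $\gamma$ be weak compositions with $\alpha$ nonempty and $\gamma$ symmetric. Then $\kappa_\alpha=2^{-\mathsf{diag}(\gamma)}\kappa^{\mathsf Q}_\gamma$ if and only if there are positive integers $1\le i_1<i_2<\cdots<i_n$ (for some positive integer $n$) such that $$\alpha=\mathbf e_{i_1}+2\mathbf e_{i_2}+3\mathbf e_{i_3}+\cdots+n\mathbf e_{i_n}\quad\text{and}\quad\gamma=n(\mathbf e_{i_1}+\mathbf e_{i_2}+\cdots+\mathbf e_{i_n}).$$
   Context: Let $\mathbb P=\{1,2,3,\dots\}$. $S_\infty$ is the group of permutations of $\mathbb P$ generated by $s_i=(i\;\,i+1)$; it acts on $\mathbb Q[x_1,x_2,\dots]$ by permuting variables. Define $\pi_i f=(x_if-x_{i+1}s_if)/(x_i-x_{i+1})$; these satisfy the braid relations, so $\pi_w=\pi_{i_1}\cdots\pi_{i_l}$ is well-defined for any reduced word $i_1\cdots i_l$ of $w\in S_\infty$. A weak composition is a sequence $\alpha=(\alpha_1,\alpha_2,\dots)$ of nonnegative integers with finite sum; $\emptyset=(0,0,\dots)$ is the empty one, "nonempty" means $\ne\emptyset$, and $\mathbf e_i$ is the sequence with $1$ in position $i$ and $0$ elsewhere. Put $x^\alpha=\prod_ix_i^{\alpha_i}$. A partition is a weakly decreasing weak composition. $S_\infty$ acts by $w\alpha=(\alpha_{w^{-1}(1)},\alpha_{w^{-1}(2)},\dots)$. Let $\lambda(\alpha)$ be the partition sorting $\alpha$ and $u(\alpha)$ the minimal-length $u\in S_\infty$ with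 $\alpha=u\lambda(\alpha)$. The key polynomial is $\kappa_\alpha=\pi_{u(\alpha)}x^{\lambda(\alpha)}$. Let $\mathsf D_\mu=\{(i,j)\in\mathbb P\times\mathbb P:1\le j\le\mu_i\}$. A weak composition $\gamma$ is symmetric if $\lambda(\gamma)$ equals its transpose. For a partition $\lambda$ equal to its transpose, $\mathrm{half}_\le(\lambda)$ is the strict partition (distinct nonzero parts) with nonzero parts $\{\lambda_i-(i-1):i\in\mathbb P\}\cap\mathbb P$. For symmetric $\gamma$, $\kappa^{\mathsf Q}_\gamma=\pi_{u(\gamma)}\prod_{(i,j)\in\mathsf D_\mu}(x_i+x_{i+j-1})$ with $\mu=\mathrm{half}_\le(\lambda(\gamma))$, and $\mathsf{diag}(\gamma)=|\{(i,j)\in\mathsf D^{\mathsf{sym}}_\gamma:i=j\}|$ where $\mathsf D^{\mathsf{sym}}_\gamma=\{(u(i),u(j)):(i,j)\in\mathsf D_{\lambda(\gamma)}\}$ with $u=u(\gamma)$. *)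

theory Defs
  imports
    Complex_Main
    "HOL-Library.Poly_Mapping"
    "HOL-Combinatorics.Transposition"
begin

text \<open>
  Positions and variables are indexed by the positive integers, realised inside \<^typ>\<open>nat\<close>.
  A weak composition is a finitely supported function on \<^typ>\<open>nat\<close> vanishing at the unused
  index 0; likewise the variable with index 0 never occurs, and elements of \<open>S\<^sub>\<infinity>\<close> fix 0.
  The weak composition \<open>k e\<^sub>i\<close> is \<open>Poly_Mapping.single i k\<close>, the empty one is \<open>0\<close>.
\<close>

type_synonym composition = "nat \<Rightarrow>\<^sub>0 nat"

text \<open>Polynomials over the rationals: finitely supported functions on exponent vectors.\<close>

type_synonym polynomial = "composition \<Rightarrow>\<^sub>0 rat"

definition weak_composition :: "composition \<Rightarrow> bool" where
  "weak_composition \<alpha> \<longleftrightarrow> Poly_Mapping.lookup \<alpha> 0 = 0"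

definition monom :: "composition \<Rightarrow> polynomial" where
  "monom \<alpha> = Poly_Mapping.single \<alpha> 1"

definition x_var :: "nat \<Rightarrow> polynomial" where
  "x_var i = monom (Poly_Mapping.single i 1)"

definition scale :: "rat \<Rightarrow> polynomial \<Rightarrow> polynomial" where
  "scale c f = Poly_Mapping.single 0 c * f"


subsection \<open>The infinite symmetric group\<close>

definition adj_trans :: "nat \<Rightarrow> nat \<Rightarrow> nat" where
  "adj_trans i = transpose i (Suc i)"

definition word_perm :: "nat list \<Rightarrow> nat \<Rightarrow> nat" where
  "word_perm is = foldr (\<lambda>i w. adj_trans i \<circ> w) is id"

text \<open>The generators are involutions, so the group they generate consists of their finite products.\<close>

definition S_inf :: "(nat \<Rightarrow> nat) set" where
  "S_inf = {word_perm is | is. set is \<subseteq> {1..}}"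

definition perm_length :: "(nat \<Rightarrow> nat) \<Rightarrow> nat" where
  "perm_length w = (LEAST l. \<exists>is. set is \<subseteq> {1..} \<and> word_perm is = w \<and> length is = l)"

definition reduced_word :: "(nat \<Rightarrow> nat) \<Rightarrow> nat list \<Rightarrow> bool" where
  "reduced_word w is \<longleftrightarrow> set is \<subseteq> {1..} \<and> word_perm is = w \<and> length is = perm_length w"

text \<open>\<open>(w \<alpha>)\<^sub>i = \<alpha>\<^bsub>w\<^sup>-\<^sup>1(i)\<^esub>\<close>; the library's \<open>map_key\<close> precomposes with its (injective) argument.\<close>

definition act :: "(nat \<Rightarrow> nat) \<Rightarrow> composition \<Rightarrow> composition" where
  "act w \<alpha> = Poly_Mapping.map_key (inv w) \<alpha>"

text \<open>
  Permuting variables, \<open>x\<^sub>i \<mapsto> x\<^bsub>w(i)\<^esub>\<close>, sends the monomial \<open>x\<^sup>\<alpha>\<close> to \<open>x\<^bsup>w \<alpha>\<^esup>\<close>, so the coefficient of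
  \<open>x\<^sup>\<beta>\<close> in \<open>w f\<close> is that of \<open>x\<close> to the power \<open>w\<^sup>-\<^sup>1 \<beta>\<close> in \<open>f\<close>.
\<close>

definition act_poly :: "(nat \<Rightarrow> nat) \<Rightarrow> polynomial \<Rightarrow> polynomial" where
  "act_poly w f = Poly_Mapping.map_key (act (inv w)) f"


subsection \<open>Isobaric divided differences\<close>

text \<open>The quotient of \<open>x\<^sub>i f - x\<^bsub>i+1\<^esub> s\<^sub>i f\<close> by \<open>x\<^sub>i - x\<^bsub>i+1\<^esub>\<close>, which is exact.\<close>

definition pi_op :: "nat \<Rightarrow> polynomial \<Rightarrow> polynomial" where
  "pi_op i f = (THE g. (x_var i - x_var (Suc i)) * g = x_var i * f - x_var (Suc i) * act_poly (adj_trans i) f)"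

definition pi_word :: "nat list \<Rightarrow> polynomial \<Rightarrow> polynomial" where
  "pi_word is f = foldr pi_op is f"

text \<open>By the braid relations the choice of reduced word does not matter.\<close>

definition pi_perm :: "(nat \<Rightarrow> nat) \<Rightarrow> polynomial \<Rightarrow> polynomial" where
  "pi_perm w = pi_word (SOME is. reduced_word w is)"


subsection \<open>Key polynomials\<close>

definition is_partition :: "composition \<Rightarrow> bool" where
  "is_partition \<mu> \<longleftrightarrow> weak_composition \<mu> \<and>
     (\<forall>i j. 1 \<le> i \<and> i \<le> j \<longrightarrow> Poly_Mapping.lookup \<mu> j \<le> Poly_Mapping.lookup \<mu> i)"

definition sort_comp :: "composition \<Rightarrow> composition" where
  "sort_comp \<alpha> = (THE \<mu>. is_partition \<mu> \<and> (\<exists>w\<in>S_inf. \<alpha> = act w \<mu>))"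

definition u_perm :: "composition \<Rightarrow> nat \<Rightarrow> nat" where
  "u_perm \<alpha> = (ARG_MIN perm_length u. u \<in> S_inf \<and> \<alpha> = act u (sort_comp \<alpha>))"

definition key_poly :: "composition \<Rightarrow> polynomial" where
  "key_poly \<alpha> = pi_perm (u_perm \<alpha>) (monom (sort_comp \<alpha>))"


subsection \<open>Q-key polynomials\<close>

definition diagram :: "composition \<Rightarrow> (nat \<times> nat) set" where
  "diagram \<mu> = {(i, j). 1 \<le> i \<and> 1 \<le> j \<and> j \<le> Poly_Mapping.lookup \<mu> i}"

lift_definition conjugate :: "composition \<Rightarrow> composition" is
  "\<lambda>\<mu> j. if j = 0 then 0 else card {i. 1 \<le> i \<and> j \<le> \<mu> i}"
proof -
  fix \<mu> :: "nat \<Rightarrow> nat"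
  assume fin: "finite {i. \<mu> i \<noteq> 0}"
  have "{j. (if j = 0 then 0 else card {i. 1 \<le> i \<and> j \<le> \<mu> i}) \<noteq> 0} \<subseteq> (\<Union>i\<in>{i. \<mu> i \<noteq> 0}. {..\<mu> i})"
  proof
    fix j assume "j \<in> {j. (if j = 0 then 0 else card {i. 1 \<le> i \<and> j \<le> \<mu> i}) \<noteq> 0}"
    hence "j \<noteq> 0" "card {i. 1 \<le> i \<and> j \<le> \<mu> i} \<noteq> 0"
      by (auto split: if_splits)
    moreover from this obtain i where "j \<le> \<mu> i"
      by (metis (no_types, lifting) card.empty empty_Collect_eq)
    ultimately show "j \<in> (\<Union>i\<in>{i. \<mu> i \<noteq> 0}. {..\<mu> i})"
      by (intro UN_I[of i]) auto
  qed
  with fin show "finite {j. (if j = 0 then 0 else card {i. 1 \<le> i \<and> j \<le> \<mu> i}) \<noteq> 0}"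
    by (meson finite_UN_I finite_atMost finite_subset)
qed

definition symmetric :: "composition \<Rightarrow> bool" where
  "symmetric \<gamma> \<longleftrightarrow> weak_composition \<gamma> \<and> conjugate (sort_comp \<gamma>) = sort_comp \<gamma>"

definition strict_partition :: "composition \<Rightarrow> bool" where
  "strict_partition \<mu> \<longleftrightarrow>
     is_partition \<mu> \<and> inj_on (Poly_Mapping.lookup \<mu>) (Poly_Mapping.keys \<mu>)"

text \<open>
  The subtraction on \<^typ>\<open>nat\<close> truncates to 0 exactly when the integer difference is not positive,
  and such values are removed by the intersection.
\<close>

definition half_le :: "composition \<Rightarrow> composition" where
  "half_le \<mu> = (THE \<nu>. strict_partition \<nu> \<and>
     Poly_Mapping.lookup \<nu> ` Poly_Mapping.keys \<nu> =
       {Poly_Mapping.lookup \<mu> i - (i - 1) | i. 1 \<le> i} \<inter> {1..})"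

definition Q_key_poly :: "composition \<Rightarrow> polynomial" where
  "Q_key_poly \<gamma> = pi_perm (u_perm \<gamma>)
     (\<Prod>(i, j)\<in>diagram (half_le (sort_comp \<gamma>)). x_var i + x_var (i + j - 1))"

definition sym_diagram :: "composition \<Rightarrow> (nat \<times> nat) set" where
  "sym_diagram \<gamma> = {(u_perm \<gamma> i, u_perm \<gamma> j) | i j. (i, j) \<in> diagram (sort_comp \<gamma>)}"

definition diag :: "composition \<Rightarrow> nat" where
  "diag \<gamma> = card {(i, j). (i, j) \<in> sym_diagram \<gamma> \<and> i = j}"

end

theory Submission
  imports Defs "HOL-Combinatorics.Permutations" "HOL-Library.Infinite_Set"
begin

text \<open>
  Both polynomials arise in the same way. Start with a polynomial attached to the sorted partition, walk from the
  partition to the composition by exchanging neighbouring entries, and apply \<open>\<pi>\<^sub>k\<close> whenever the entries in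
  positions \<open>k\<close> and \<open>k + 1\<close> are exchanged. By the braid relations the result depends only on the starting
  polynomial and on the final composition (\<open>transport\<close>, \<open>transport_ascent\<close>), so that reduced words disappear
  from the argument. For \<open>\<kappa>\<^sub>\<alpha>\<close> the starting polynomial is a monomial. For \<open>\<gamma>\<close>, division by the power of two
  turns it into the product, over the boxes \<open>(i, j)\<close> of the half \<open>\<mu>\<close> of \<open>\<lambda>(\<gamma>)\<close>, of \<open>x\<^sub>i\<close> if \<open>j = 1\<close> and of
  \<open>x\<^sub>i + x\<^bsub>i+j-1\<^esub>\<close> otherwise (\<open>shifted_product\<close>).

  Suppose that \<open>\<gamma>\<close> has \<open>n\<close> entries equal to \<open>n\<close> and no other nonzero entry. Then \<open>\<mu> = (n, \<dots>, 1)\<close> is a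
  staircase and the product is \<open>x\<^sub>1\<cdots>x\<^sub>n \<Prod>\<^bsub>i<j\<^esub> (x\<^sub>i + x\<^sub>j)\<close>. This is the Schur polynomial of the staircase, that
  is, the key polynomial of \<open>(1, \<dots>, n)\<close>: in Weyl's character formula the numerator is a Vandermonde product in the
  squares of the variables (\<open>transport_staircase\<close>). Moving the entries \<open>1, \<dots>, n\<close> or \<open>n, \<dots>, n\<close> to the right past
  zeros uses the same operators in both cases, and the equality follows for all positions (\<open>key_poly_spread\<close>).

  Conversely, let the two polynomials be equal. The operators do not leave the set of exponents that are dominated by
  a given partition, and they keep the coefficient of the partition itself. Comparing the two supports shows that
  \<open>\<lambda>(\<alpha>) = \<mu>\<close>. If \<open>\<mu>\<^sub>i - \<mu>\<^bsub>i+1\<^esub> \<ge> 2\<close> for some \<open>i\<close>, then the coefficient of \<open>\<mu> - e\<^sub>i + e\<^bsub>i+1\<^esub>\<close> minus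
  the coefficient of \<open>s\<^sub>i \<mu>\<close> is not changed by any operator (\<open>transport_string_invariant\<close>), but it is 0 for the
  monomial \<open>x\<^sup>\<mu>\<close> and 1 for the shifted product. So \<open>\<mu>\<close> is a staircase, and \<open>\<lambda>(\<gamma>)\<close>, being symmetric with half \<open>\<mu>\<close>,
  is a square. The first part now gives one composition whose key polynomial is the right one, and \<open>\<alpha>\<close> equals it
  because key polynomials are distinct (\<open>key_poly_inject\<close>).
\<close>

abbreviation (input) lookup :: "('a \<Rightarrow>\<^sub>0 'b) \<Rightarrow> 'a \<Rightarrow> 'b :: zero" where
  "lookup \<equiv> Poly_Mapping.lookup"

abbreviation (input) keys :: "('a \<Rightarrow>\<^sub>0 'b :: zero) \<Rightarrow> 'a set" where
  "keys \<equiv> Poly_Mapping.keys"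

abbreviation (input) single :: "'a \<Rightarrow> 'b \<Rightarrow> 'a \<Rightarrow>\<^sub>0 'b :: zero" where
  "single \<equiv> Poly_Mapping.single"

section \<open>Permuting exponents and variables\<close>

lemma lookup_act:
  assumes "bij w"
  shows "lookup (act w \<beta>) a = lookup \<beta> (inv w a)"
  unfolding act_def using bij_imp_bij_inv[OF assms] by (simp add: map_key.rep_eq bij_is_inj)

lemma act_compose:
  assumes "bij v" "bij w"
  shows "act v (act w \<beta>) = act (v \<circ> w) \<beta>"
  using assms by (intro poly_mapping_eqI) (simp add: lookup_act bij_comp o_inv_distrib)

lemma act_id [simp]: "act id \<beta> = \<beta>"
  by (intro poly_mapping_eqI) (simp add: lookup_act)

lemma act_inverse:
  assumes "bij w"
  shows "act (inv w) (act w \<beta>) = \<beta>" "act w (act (inv w) \<beta>) = \<beta>"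
  using assms act_compose[of "inv w" w \<beta>] act_compose[of w "inv w" \<beta>]
  by (auto simp: bij_imp_bij_inv bij_is_inj bij_is_surj surj_iff[THEN iffD1])

lemma inj_act: "bij w \<Longrightarrow> inj (act w)"
  by (metis act_inverse(1) injI)

lemma act_add: "bij w \<Longrightarrow> act w (\<alpha> + \<beta>) = act w \<alpha> + act w \<beta>"
  by (intro poly_mapping_eqI) (simp add: lookup_act lookup_add)

lemma act_zero [simp]: "bij w \<Longrightarrow> act w 0 = 0"
  by (intro poly_mapping_eqI) (simp add: lookup_act)

lemma act_single: "bij w \<Longrightarrow> act w (single i k) = single (w i) k"
  by (intro poly_mapping_eqI) (auto simp: lookup_act lookup_single when_def bij_inv_eq_iff bij_is_inj)

lemma act_sum: "bij w \<Longrightarrow> act w (\<Sum>i\<in>I. f i) = (\<Sum>i\<in>I. act w (f i))"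
  by (induction I rule: infinite_finite_induct) (auto simp: act_add)

lemma lookup_act_poly:
  assumes "bij w"
  shows "lookup (act_poly w f) \<beta> = lookup f (act (inv w) \<beta>)"
  unfolding act_poly_def using inj_act[OF bij_imp_bij_inv[OF assms]] by (simp add: map_key.rep_eq)

lemma act_poly_single:
  assumes "bij w"
  shows "act_poly w (single \<beta> c) = single (act w \<beta>) c"
  by (intro poly_mapping_eqI)
    (use assms in \<open>auto simp: lookup_act_poly lookup_single when_def act_inverse\<close>)

lemma act_poly_monom: "bij w \<Longrightarrow> act_poly w (monom \<beta>) = monom (act w \<beta>)"
  by (simp add: monom_def act_poly_single)

lemma act_poly_x_var: "bij w \<Longrightarrow> act_poly w (x_var i) = x_var (w i)"
  by (simp add: x_var_def act_poly_monom act_single)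

lemma act_poly_zero [simp]: "bij w \<Longrightarrow> act_poly w 0 = 0"
  by (intro poly_mapping_eqI) (simp add: lookup_act_poly)

lemma act_poly_one [simp]: "bij w \<Longrightarrow> act_poly w 1 = 1"
  using act_poly_single[of w 0 1] by (simp flip: single_one)

lemma act_poly_add: "bij w \<Longrightarrow> act_poly w (f + g) = act_poly w f + act_poly w g"
  by (intro poly_mapping_eqI) (simp add: lookup_act_poly lookup_add)

lemma act_poly_uminus: "bij w \<Longrightarrow> act_poly w (- f) = - act_poly w f"
  by (intro poly_mapping_eqI) (simp add: lookup_act_poly)

lemma act_poly_diff: "bij w \<Longrightarrow> act_poly w (f - g) = act_poly w f - act_poly w g"
  by (intro poly_mapping_eqI) (simp add: lookup_act_poly lookup_minus)

lemma poly_expand: "(f :: polynomial) = (\<Sum>\<beta>\<in>keys f. single \<beta> (lookup f \<beta>))"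
proof (rule poly_mapping_eqI)
  fix \<gamma>
  show "lookup f \<gamma> =
    lookup (\<Sum>\<beta>\<in>keys f. single \<beta> (lookup f \<beta>)) \<gamma>"
    by (cases "\<gamma> \<in> keys f")
      (auto simp: lookup_sum lookup_single when_def in_keys_iff)
qed

lemma poly_induct [case_names zero single add]:
  fixes f :: polynomial
  assumes "P 0" and single: "\<And>\<beta> c. P (single \<beta> c)"
    and add: "\<And>f g. P f \<Longrightarrow> P g \<Longrightarrow> P (f + g)"
  shows "P f"
proof -
  have "P (\<Sum>\<beta>\<in>B. single \<beta> (lookup f \<beta>))" for B
    by (induction B rule: infinite_finite_induct) (auto intro: assms)
  then show ?thesis
    by (subst poly_expand)
qed

lemma act_poly_mult:
  assumes "bij w"
  shows "act_poly w (f * g) = act_poly w f * act_poly w g"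
proof (induction f rule: poly_induct)
  case (single \<beta> c)
  show ?case
    by (induction g rule: poly_induct)
      (use assms in \<open>auto simp: mult_single act_poly_single act_add act_poly_add distrib_left\<close>)
qed (use assms in \<open>auto simp: act_poly_add distrib_right\<close>)

lemma act_poly_prod: "bij w \<Longrightarrow> act_poly w (\<Prod>i\<in>I. f i) = (\<Prod>i\<in>I. act_poly w (f i))"
  by (induction I rule: infinite_finite_induct) (auto simp: act_poly_mult)

lemma act_poly_power: "bij w \<Longrightarrow> act_poly w (f ^ n) = act_poly w f ^ n"
  by (induction n) (auto simp: act_poly_mult)

lemma act_poly_compose:
  assumes "bij v" "bij w"
  shows "act_poly v (act_poly w f) = act_poly (v \<circ> w) f"
proof (rule poly_mapping_eqI)
  fix \<beta>
  have "act (inv w) (act (inv v) \<beta>) = act (inv (v \<circ> w)) \<beta>"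
    using assms by (simp only: act_compose bij_imp_bij_inv o_inv_distrib)
  then show "lookup (act_poly v (act_poly w f)) \<beta> = lookup (act_poly (v \<circ> w) f) \<beta>"
    using assms by (simp only: lookup_act_poly bij_comp)
qed

lemma act_poly_id [simp]: "act_poly id f = f"
  by (intro poly_mapping_eqI) (simp add: lookup_act_poly)

lemma monom_add: "monom (\<alpha> + \<beta>) = monom \<alpha> * monom \<beta>"
  by (simp add: monom_def mult_single)

lemma monom_zero [simp]: "monom 0 = 1"
  by (simp add: monom_def)

lemma monom_sum: "finite I \<Longrightarrow> monom (\<Sum>i\<in>I. f i) = (\<Prod>i\<in>I. monom (f i))"
  by (induction I rule: finite_induct) (auto simp: monom_add)

lemma x_var_power: "x_var i ^ n = monom (single i n)"
proof (induction n)
  case (Suc n)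
  then show ?case
    by (simp add: x_var_def flip: monom_add single_add)
qed simp

lemma lookup_monom: "lookup (monom \<alpha>) \<beta> = (if \<beta> = \<alpha> then 1 else 0)"
  by (auto simp: monom_def lookup_single when_def)

lemma keys_monom [simp]: "keys (monom \<alpha>) = {\<alpha>}"
  by (simp add: monom_def)

lemma keys_x_var [simp]: "keys (x_var i) = {single i 1}"
  by (simp add: x_var_def)

lemma x_var_inject [simp]: "x_var i = x_var j \<longleftrightarrow> i = j"
  by (metis keys_single keys_x_var singleton_inject zero_neq_one)

lemma lookup_monom_mult:
  "lookup (monom \<alpha> * f) (\<alpha> + \<beta>) = lookup f \<beta>"
proof (induction f rule: poly_induct)
  case (single \<gamma> c)
  then show ?case
    by (auto simp: monom_def mult_single lookup_single when_def)
qed (auto simp: lookup_add distrib_left)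

lemma lookup_monom_mult_0:
  assumes "\<not> (\<exists>\<gamma>. \<beta> = \<alpha> + \<gamma>)"
  shows "lookup (monom \<alpha> * f) \<beta> = 0"
proof (induction f rule: poly_induct)
  case (single \<gamma> c)
  then show ?case
    using assms by (auto simp: monom_def mult_single lookup_single when_def)
qed (auto simp: lookup_add distrib_left)

section \<open>Isobaric divided differences\<close>

lemma bij_adj_trans [simp]: "bij (adj_trans k)"
  by (simp add: adj_trans_def)

lemma inv_adj_trans [simp]: "inv (adj_trans k) = adj_trans k"
  by (simp add: adj_trans_def)

lemma adj_trans_simps [simp]:
  "adj_trans k k = Suc k" "adj_trans k (Suc k) = k" "adj_trans k (adj_trans k a) = a"
  "adj_trans k \<circ> adj_trans k = id"
  by (simp_all add: adj_trans_def)

lemma adj_trans_other: "a \<noteq> k \<Longrightarrow> a \<noteq> Suc k \<Longrightarrow> adj_trans k a = a"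
  by (simp add: adj_trans_def transpose_apply_other)

lemma adj_trans_cases: "adj_trans k a = (if a = k then Suc k else if a = Suc k then k else a)"
  by (simp add: adj_trans_def transpose_def)

lemma act_adj_adj [simp]: "act (adj_trans k) (act (adj_trans k) \<beta>) = \<beta>"
  by (simp add: act_compose)

lemma act_poly_adj_adj [simp]: "act_poly (adj_trans k) (act_poly (adj_trans k) f) = f"
  by (simp add: act_poly_compose)

lemma lookup_act_adj [simp]:
  "lookup (act (adj_trans k) \<beta>) a = lookup \<beta> (adj_trans k a)"
  by (simp add: lookup_act)

lemma adj_trans_commute:
  assumes "Suc i < j"
  shows "adj_trans i \<circ> adj_trans j = adj_trans j \<circ> adj_trans i"
  using assms by (auto simp: fun_eq_iff adj_trans_def transpose_def)

lemma adj_trans_braid: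
  "adj_trans i \<circ> (adj_trans (Suc i) \<circ> adj_trans i) = adj_trans (Suc i) \<circ> (adj_trans i \<circ> adj_trans (Suc i))"
  by (auto simp: fun_eq_iff adj_trans_def transpose_def)

lemma x_diff_nonzero: "i \<noteq> j \<Longrightarrow> x_var i - x_var j \<noteq> 0"
  by simp

lemma diff_dvd_power_diff: "(x - y) dvd (x ^ n - y ^ n)" for x y :: "'a :: comm_ring_1"
  unfolding power_diff_sumr2 by simp

text \<open>
  By linearity it is enough to divide for a single term. There the numerator is, up to a factor, a difference of equal
  powers of \<open>x\<^sub>k\<close> and \<open>x\<^bsub>k+1\<^esub>\<close>, because a common power of \<open>x\<^sub>k x\<^bsub>k+1\<^esub>\<close> can be split off.
\<close>

lemma pi_op_exists:
  "\<exists>g. (x_var k - x_var (Suc k)) * g = x_var k * f - x_var (Suc k) * act_poly (adj_trans k) f"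
proof (induction f rule: poly_induct)
  case zero
  then show ?case by (intro exI[of _ 0]) simp
next
  case (add f g)
  then obtain f' g' where
    "(x_var k - x_var (Suc k)) * f' = x_var k * f - x_var (Suc k) * act_poly (adj_trans k) f"
    "(x_var k - x_var (Suc k)) * g' = x_var k * g - x_var (Suc k) * act_poly (adj_trans k) g"
    by auto
  then show ?case
    by (intro exI[of _ "f' + g'"]) (simp add: algebra_simps act_poly_add)
next
  case (single \<beta> c)
  define X Y a b where "X = x_var k" and "Y = x_var (Suc k)"
    and "a = lookup \<beta> k" and "b = lookup \<beta> (Suc k)"
  define \<beta>0 where "\<beta>0 = Poly_Mapping.update k 0 (Poly_Mapping.update (Suc k) 0 \<beta>)"
  define M where "M = single \<beta>0 c"
  have \<beta>: "\<beta> = \<beta>0 + (single k a + single (Suc k) b)"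
    by (intro poly_mapping_eqI)
      (auto simp: \<beta>0_def a_def b_def lookup_add lookup_update lookup_single when_def)
  have "single \<beta> c = M * monom (single k a + single (Suc k) b)"
    by (simp add: M_def \<beta> monom_def mult_single)
  then have f: "single \<beta> c = M * (X ^ a * Y ^ b)"
    by (simp add: X_def Y_def x_var_power monom_add)
  have "act (adj_trans k) \<beta>0 = \<beta>0"
    by (intro poly_mapping_eqI) (auto simp: \<beta>0_def lookup_update adj_trans_cases)
  then have "act_poly (adj_trans k) M = M"
    by (simp add: M_def act_poly_single)
  then have sf: "act_poly (adj_trans k) (single \<beta> c) = M * (Y ^ a * X ^ b)"
    by (simp add: f act_poly_mult act_poly_power act_poly_x_var X_def Y_def)
  have "(X - Y) dvd X * (M * (X ^ a * Y ^ b)) - Y * (M * (Y ^ a * X ^ b))"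
  proof (cases "b \<le> a")
    case True
    then obtain d where a: "a = b + d" using le_Suc_ex by blast
    have "X * (M * (X ^ a * Y ^ b)) - Y * (M * (Y ^ a * X ^ b)) = M * (X * Y) ^ b * (X ^ Suc d - Y ^ Suc d)"
      by (simp add: a power_add power_mult_distrib algebra_simps)
    then show ?thesis by (metis diff_dvd_power_diff dvd_mult)
  next
    case False
    then obtain d where b: "b = Suc (a + d)" using less_iff_Suc_add not_le by metis
    have "X * (M * (X ^ a * Y ^ b)) - Y * (M * (Y ^ a * X ^ b)) = - M * (X * Y) ^ Suc a * (X ^ d - Y ^ d)"
      by (simp add: b power_add power_mult_distrib algebra_simps)
    then show ?thesis by (metis diff_dvd_power_diff dvd_mult)
  qed
  then show ?case
    unfolding sf by (auto simp: f X_def[symmetric] Y_def[symmetric] dvd_def)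
qed

lemma pi_op_unique:
  assumes "(x_var k - x_var (Suc k)) * g = x_var k * f - x_var (Suc k) * act_poly (adj_trans k) f"
  shows "pi_op k f = g"
  unfolding pi_op_def
proof (rule the_equality)
  fix h
  assume "(x_var k - x_var (Suc k)) * h = x_var k * f - x_var (Suc k) * act_poly (adj_trans k) f"
  then have "(x_var k - x_var (Suc k)) * h = (x_var k - x_var (Suc k)) * g"
    using assms by simp
  then show "h = g"
    using x_diff_nonzero[of k "Suc k"] by (simp only: mult_cancel_left) auto
qed (fact assms)

lemma pi_op_spec:
  "(x_var k - x_var (Suc k)) * pi_op k f = x_var k * f - x_var (Suc k) * act_poly (adj_trans k) f"
  using pi_op_exists[of k f] pi_op_unique by blast

lemma pi_op_mult_symmetric:
  assumes "act_poly (adj_trans k) h = h"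
  shows "pi_op k (h * f) = h * pi_op k f"
proof (rule pi_op_unique)
  have "(x_var k - x_var (Suc k)) * (h * pi_op k f) = h * ((x_var k - x_var (Suc k)) * pi_op k f)"
    by (simp add: mult_ac)
  also have "\<dots> = x_var k * (h * f) - x_var (Suc k) * act_poly (adj_trans k) (h * f)"
    unfolding pi_op_spec by (simp add: act_poly_mult assms algebra_simps)
  finally show "(x_var k - x_var (Suc k)) * (h * pi_op k f) =
    x_var k * (h * f) - x_var (Suc k) * act_poly (adj_trans k) (h * f)" .
qed

text \<open>
  Exchanging the two variables changes the sign of the numerator and of the denominator.
\<close>

lemma act_poly_pi_op: "act_poly (adj_trans k) (pi_op k f) = pi_op k f"
proof (rule pi_op_unique[symmetric])
  have "act_poly (adj_trans k) ((x_var k - x_var (Suc k)) * pi_op k f) =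
    act_poly (adj_trans k) (x_var k * f - x_var (Suc k) * act_poly (adj_trans k) f)"
    by (simp only: pi_op_spec)
  then show "(x_var k - x_var (Suc k)) * act_poly (adj_trans k) (pi_op k f) =
    x_var k * f - x_var (Suc k) * act_poly (adj_trans k) f"
    by (simp add: act_poly_mult act_poly_diff act_poly_x_var algebra_simps)
qed

lemma pi_op_commute:
  assumes "Suc i < j"
  shows "pi_op i (pi_op j f) = pi_op j (pi_op i f)"
proof -
  define s t where "s = act_poly (adj_trans i)" and "t = act_poly (adj_trans j)"
  define A B C D where "A = x_var i" and "B = x_var (Suc i)" and "C = x_var j" and "D = x_var (Suc j)"
  have st: "s (t g) = t (s g)" for g
    using adj_trans_commute[OF assms] by (simp add: s_def t_def act_poly_compose)
  have var: "s C = C" "s D = D" "t A = A" "t B = B"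
    using assms by (simp_all add: s_def t_def A_def B_def C_def D_def act_poly_x_var adj_trans_other)
  have hom: "s (g * h) = s g * s h" "s (g - h) = s g - s h"
    "t (g * h) = t g * t h" "t (g - h) = t g - t h" for g h
    by (simp_all add: s_def t_def act_poly_mult act_poly_diff)
  have i: "(A - B) * pi_op i g = A * g - B * s g" and j: "(C - D) * pi_op j g = C * g - D * t g" for g
    by (simp_all add: A_def B_def C_def D_def s_def t_def pi_op_spec)
  have sj: "(C - D) * s (pi_op j f) = C * s f - D * s (t f)"
    using arg_cong[OF j[of f], of s] by (simp add: hom var)
  have ti: "(A - B) * t (pi_op i f) = A * t f - B * t (s f)"
    using arg_cong[OF i[of f], of t] by (simp add: hom var)
  have "(A - B) * (C - D) * pi_op i (pi_op j f) = (C - D) * ((A - B) * pi_op i (pi_op j f))"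
    by (simp add: mult_ac)
  also have "\<dots> = A * ((C - D) * pi_op j f) - B * ((C - D) * s (pi_op j f))"
    unfolding i by (simp add: algebra_simps)
  also have "\<dots> = A * (C * f - D * t f) - B * (C * s f - D * s (t f))"
    by (simp only: j sj)
  also have "\<dots> = C * (A * f - B * s f) - D * (A * t f - B * t (s f))"
    by (simp add: algebra_simps st)
  also have "\<dots> = C * ((A - B) * pi_op i f) - D * ((A - B) * t (pi_op i f))"
    by (simp only: i ti)
  also have "\<dots> = (A - B) * ((C - D) * pi_op j (pi_op i f))"
    unfolding j by (simp add: algebra_simps)
  also have "\<dots> = (A - B) * (C - D) * pi_op j (pi_op i f)"
    by (simp add: mult_ac)
  finally show ?thesis
    using assms by (simp add: A_def B_def C_def D_def)
qed

lemma pi_op_braid: "pi_op i (pi_op (Suc i) (pi_op i f)) = pi_op (Suc i) (pi_op i (pi_op (Suc i) f))"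
proof -
  define s t where "s = act_poly (adj_trans i)" and "t = act_poly (adj_trans (Suc i))"
  define A B C where "A = x_var i" and "B = x_var (Suc i)" and "C = x_var (Suc (Suc i))"
  have sts: "s (t (s g)) = t (s (t g))" for g
    using adj_trans_braid[of i] by (simp add: s_def t_def act_poly_compose bij_comp)
  have var: "s A = B" "s B = A" "s C = C" "t A = A" "t B = C" "t C = B"
    by (simp_all add: s_def t_def A_def B_def C_def act_poly_x_var adj_trans_other)
  have hom: "s (g * h) = s g * s h" "s (g - h) = s g - s h"
    "t (g * h) = t g * t h" "t (g - h) = t g - t h" for g h
    by (simp_all add: s_def t_def act_poly_mult act_poly_diff)
  have i: "(A - B) * pi_op i g = A * g - B * s g" and j: "(B - C) * pi_op (Suc i) g = B * g - C * t g" for g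
    by (simp_all add: A_def B_def C_def s_def t_def pi_op_spec)
  have invar: "s (pi_op i g) = pi_op i g" "t (pi_op (Suc i) g) = pi_op (Suc i) g" for g
    by (simp_all add: s_def t_def act_poly_pi_op)
  \<comment> \<open>Clearing denominators, both sides become the same alternating combination of the six images of f.\<close>
  define R where "R = A^2 * B * f - A * B^2 * s f - A^2 * C * t f + A * C^2 * t (s f)
     + B^2 * C * s (t f) - B * C^2 * s (t (s f))"
  let ?D = "(A - B) * (A - C) * (B - C)"
  have L: "?D * pi_op i (pi_op (Suc i) (pi_op i f)) = R"
  proof -
    define p where "p = pi_op i f"
    define q where "q = pi_op (Suc i) p"
    have p: "(A - B) * p = A * f - B * s f"
      by (simp only: p_def i)
    have tp: "(A - C) * t p = A * t f - C * t (s f)"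
      using arg_cong[OF p, of t] by (simp only: hom var)
    have stp: "(B - C) * s (t p) = B * s (t f) - C * s (t (s f))"
      using arg_cong[OF tp, of s] by (simp add: hom var)
    have q: "(B - C) * q = B * p - C * t p" unfolding q_def by (rule j)
    have sq: "(A - C) * s q = A * p - C * s (t p)"
      using arg_cong[OF q, of s] invar(1)[of f] by (simp add: hom var p_def)
    have "(A - B) * pi_op i q = A * q - B * s q" by (rule i)
    then have "?D * pi_op i q = A * (A - C) * ((B - C) * q) - B * (B - C) * ((A - C) * s q)"
      by algebra
    also have "\<dots> = A * (A - C) * (B * p - C * t p) - B * (B - C) * (A * p - C * s (t p))"
      by (simp only: q sq)
    also have "\<dots> = A * B * ((A - B) * p) - A * C * ((A - C) * t p) + B * C * ((B - C) * s (t p))"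
      by algebra
    also have "\<dots> = R"
      unfolding p tp stp R_def by algebra
    finally show ?thesis by (simp add: q_def p_def)
  qed
  have "?D * pi_op (Suc i) (pi_op i (pi_op (Suc i) f)) = R"
  proof -
    define p where "p = pi_op (Suc i) f"
    define q where "q = pi_op i p"
    have p: "(B - C) * p = B * f - C * t f"
      by (simp only: p_def j)
    have sp: "(A - C) * s p = A * s f - C * s (t f)"
      using arg_cong[OF p, of s] by (simp only: hom var)
    have tsp: "(A - B) * t (s p) = A * t (s f) - B * s (t (s f))"
      using arg_cong[OF sp, of t] by (simp add: hom var sts)
    have q: "(A - B) * q = A * p - B * s p" unfolding q_def by (rule i)
    have tq: "(A - C) * t q = A * p - C * t (s p)"
      using arg_cong[OF q, of t] invar(2)[of f] by (simp add: hom var p_def)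
    have "(B - C) * pi_op (Suc i) q = B * q - C * t q" by (rule j)
    then have "?D * pi_op (Suc i) q = B * (A - C) * ((A - B) * q) - C * (A - B) * ((A - C) * t q)"
      by algebra
    also have "\<dots> = B * (A - C) * (A * p - B * s p) - C * (A - B) * (A * p - C * t (s p))"
      by (simp only: q tq)
    also have "\<dots> = A * A * ((B - C) * p) - B * B * ((A - C) * s p) + C * C * ((A - B) * t (s p))"
      by algebra
    also have "\<dots> = R"
      unfolding p sp tsp R_def by algebra
    finally show ?thesis by (simp add: q_def p_def)
  qed
  with L have "?D * pi_op i (pi_op (Suc i) (pi_op i f)) = ?D * pi_op (Suc i) (pi_op i (pi_op (Suc i) f))"
    by simp
  then show ?thesis
    by (simp add: A_def B_def C_def)
qed

section \<open>Sorting a weak composition\<close>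

abbreviation swap :: "nat \<Rightarrow> composition \<Rightarrow> composition" where
  "swap k \<equiv> act (adj_trans k)"

definition ascending_pairs :: "composition \<Rightarrow> (nat \<times> nat) set" where
  "ascending_pairs \<alpha> =
    {(a, b). 1 \<le> a \<and> a < b \<and> lookup \<alpha> a < lookup \<alpha> b}"

definition inv_count :: "composition \<Rightarrow> nat" where
  "inv_count \<alpha> = card (ascending_pairs \<alpha>)"

definition ascent :: "composition \<Rightarrow> nat \<Rightarrow> bool" where
  "ascent \<alpha> k \<longleftrightarrow> 1 \<le> k \<and> lookup \<alpha> k < lookup \<alpha> (Suc k)"

lemma finite_ascending_pairs: "finite (ascending_pairs \<alpha>)"
proof (rule finite_subset)
  show "ascending_pairs \<alpha> \<subseteq> (\<Union>b\<in>keys \<alpha>. {..<b} \<times> {b})"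
    by (auto simp: ascending_pairs_def in_keys_iff)
qed auto

lemma adj_trans_less:
  assumes "a < b" "(a, b) \<noteq> (k, Suc k)"
  shows "adj_trans k a < adj_trans k b"
  using assms by (auto simp: adj_trans_cases)

lemma adj_trans_pos: "1 \<le> k \<Longrightarrow> 1 \<le> a \<Longrightarrow> 1 \<le> adj_trans k a"
  by (auto simp: adj_trans_cases)

text \<open>
  The exchange maps the ascending pairs of \<open>swap k \<alpha>\<close> bijectively to those of \<open>\<alpha>\<close> other than the pair
  \<open>(k, k + 1)\<close>.
\<close>

lemma inv_count_ascent:
  assumes "ascent \<alpha> k"
  shows "inv_count \<alpha> = Suc (inv_count (swap k \<alpha>))"
proof -
  define F where "F = (\<lambda>(a, b). (adj_trans k a, adj_trans k b))"
  have k: "1 \<le> k" and asc: "lookup \<alpha> k < lookup \<alpha> (Suc k)"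
    using assms by (auto simp: ascent_def)
  have FF: "F (F p) = p" for p
    by (cases p) (simp add: F_def)
  have into: "F p \<in> ascending_pairs \<alpha> - {(k, Suc k)}" if "p \<in> ascending_pairs (swap k \<alpha>)" for p
  proof -
    obtain a b where p: "p = (a, b)" by force
    have ab: "1 \<le> a" "a < b" "lookup \<alpha> (adj_trans k a) < lookup \<alpha> (adj_trans k b)"
      using that by (auto simp: p ascending_pairs_def)
    then have "(a, b) \<noteq> (k, Suc k)" using asc by auto
    moreover have "(adj_trans k a, adj_trans k b) \<noteq> (k, Suc k)"
      using ab(2) by (auto simp: adj_trans_cases split: if_splits)
    ultimately show ?thesis
      using ab k adj_trans_less[of a b k] adj_trans_pos[of k a] by (simp add: p F_def ascending_pairs_def)
  qed
  have outof: "F p \<in> ascending_pairs (swap k \<alpha>)" if "p \<in> ascending_pairs \<alpha> - {(k, Suc k)}" for p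
  proof -
    obtain a b where p: "p = (a, b)" by force
    show ?thesis
      using that k adj_trans_less[of a b k] adj_trans_pos[of k a] by (simp add: p F_def ascending_pairs_def)
  qed
  have "F ` ascending_pairs (swap k \<alpha>) = ascending_pairs \<alpha> - {(k, Suc k)}"
    using into outof FF by (metis (no_types, lifting) image_eqI image_subsetI subsetI subset_antisym)
  moreover have "inj_on F (ascending_pairs (swap k \<alpha>))"
    using FF by (metis inj_onI)
  ultimately have "card (ascending_pairs (swap k \<alpha>)) = card (ascending_pairs \<alpha> - {(k, Suc k)})"
    by (metis card_image)
  moreover have "(k, Suc k) \<in> ascending_pairs \<alpha>"
    using k asc by (simp add: ascending_pairs_def)
  ultimately show ?thesis
    unfolding inv_count_def using finite_ascending_pairs by (metis card.remove)
qed

lemma swap_equal: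
  assumes "lookup \<alpha> k = lookup \<alpha> (Suc k)"
  shows "swap k \<alpha> = \<alpha>"
  by (intro poly_mapping_eqI) (use assms in \<open>auto simp: adj_trans_cases\<close>)

lemma inv_count_swap_le:
  assumes "1 \<le> k" "\<not> ascent (swap k \<alpha>) k"
  shows "inv_count (swap k \<alpha>) \<le> inv_count \<alpha>"
proof (cases "lookup \<alpha> k = lookup \<alpha> (Suc k)")
  case True
  then show ?thesis by (simp add: swap_equal)
next
  case False
  then have "ascent \<alpha> k" using assms by (auto simp: ascent_def)
  then show ?thesis by (simp add: inv_count_ascent)
qed

lemma inv_count_swap_Suc:
  assumes "1 \<le> k"
  shows "inv_count (swap k \<alpha>) \<le> Suc (inv_count \<alpha>)"
  using inv_count_ascent[of "swap k \<alpha>" k] inv_count_swap_le[OF assms, of \<alpha>] by fastforce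

lemma is_partition_iff_no_ascent:
  "is_partition \<alpha> \<longleftrightarrow> weak_composition \<alpha> \<and> (\<forall>k. \<not> ascent \<alpha> k)"
proof
  assume "is_partition \<alpha>"
  then show "weak_composition \<alpha> \<and> (\<forall>k. \<not> ascent \<alpha> k)"
    by (auto simp: is_partition_def ascent_def not_less)
next
  assume *: "weak_composition \<alpha> \<and> (\<forall>k. \<not> ascent \<alpha> k)"
  have "lookup \<alpha> j \<le> lookup \<alpha> i" if "1 \<le> i" "i \<le> j" for i j
    using that(2)
  proof (induction j rule: dec_induct)
    case (step n)
    then have "lookup \<alpha> (Suc n) \<le> lookup \<alpha> n"
      using * that(1) by (metis ascent_def le_trans not_less)
    then show ?case using step by simp
  qed simp
  with * show "is_partition \<alpha>" by (auto simp: is_partition_def)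
qed

lemma partition_no_ascent: "is_partition \<mu> \<Longrightarrow> \<not> ascent \<mu> k"
  by (simp add: is_partition_iff_no_ascent)

lemma inv_count_partition: "is_partition \<mu> \<Longrightarrow> inv_count \<mu> = 0"
proof -
  assume "is_partition \<mu>"
  then have "ascending_pairs \<mu> = {}"
    by (auto simp: ascending_pairs_def is_partition_def) (meson less_imp_le_nat not_le)
  then show ?thesis by (simp add: inv_count_def)
qed

lemma weak_composition_swap: "1 \<le> k \<Longrightarrow> weak_composition (swap k \<alpha>) = weak_composition \<alpha>"
  by (simp add: weak_composition_def adj_trans_other)

lemma word_perm_simps [simp]:
  "word_perm [] = id" "word_perm (i # is) = adj_trans i \<circ> word_perm is"
  by (simp_all add: word_perm_def)

lemma bij_word_perm [simp]: "bij (word_perm is)"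
proof (induction "is")
  case (Cons i "is")
  show ?case unfolding word_perm_simps by (rule bij_comp[OF Cons bij_adj_trans])
qed (simp only: word_perm_simps bij_id)

lemma word_perm_zero: "set is \<subseteq> {1..} \<Longrightarrow> word_perm is 0 = 0"
  by (induction "is") (auto simp: adj_trans_other)

lemma S_inf_bij: "w \<in> S_inf \<Longrightarrow> bij w" and S_inf_zero: "w \<in> S_inf \<Longrightarrow> w 0 = 0"
  by (auto simp: S_inf_def word_perm_zero)

lemma act_word_Cons: "act (word_perm (i # is)) \<mu> = swap i (act (word_perm is) \<mu>)"
  by (simp add: act_compose)

text \<open>
  Removing ascents one at a time sorts the composition, and each removal costs exactly one inversion.
\<close>

lemma sorting_word:
  assumes "weak_composition \<alpha>"
  shows "\<exists>is \<mu>. set is \<subseteq> {1..} \<and> is_partition \<mu> \<and> \<alpha> = act (word_perm is) \<mu> \<and> length is = inv_count \<alpha>"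
  using assms
proof (induction "inv_count \<alpha>" arbitrary: \<alpha> rule: less_induct)
  case less
  show ?case
  proof (cases "is_partition \<alpha>")
    case True
    then show ?thesis
      by (intro exI[of _ "[]"] exI[of _ \<alpha>]) (simp add: inv_count_partition)
  next
    case False
    then obtain k where k: "ascent \<alpha> k" using less.prems by (auto simp: is_partition_iff_no_ascent)
    then have "1 \<le> k" by (simp add: ascent_def)
    have c: "inv_count \<alpha> = Suc (inv_count (swap k \<alpha>))" by (rule inv_count_ascent[OF k])
    then obtain "is" \<mu> where *: "set is \<subseteq> {1..}" "is_partition \<mu>" "swap k \<alpha> = act (word_perm is) \<mu>"
        "length is = inv_count (swap k \<alpha>)"
      using less.hyps[of "swap k \<alpha>"] less.prems weak_composition_swap[OF \<open>1 \<le> k\<close>, of \<alpha>] by auto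
    have "\<alpha> = act (word_perm (k # is)) \<mu>"
      unfolding act_word_Cons using *(3) by (metis act_adj_adj)
    moreover have "set (k # is) \<subseteq> {1..}" "length (k # is) = inv_count \<alpha>"
      using * \<open>1 \<le> k\<close> c by auto
    ultimately show ?thesis
      using *(2) by blast
  qed
qed

lemma lookup_conjugate:
  "lookup (conjugate \<mu>) c = (if c = 0 then 0 else card {i. 1 \<le> i \<and> c \<le> lookup \<mu> i})"
  by (simp add: conjugate.rep_eq)

text \<open>
  In a partition the rows of length at least \<open>c\<close> are the first ones.
\<close>

lemma partition_conjugate_iff:
  assumes "is_partition \<mu>" "1 \<le> i" "1 \<le> c"
  shows "c \<le> lookup \<mu> i \<longleftrightarrow> i \<le> lookup (conjugate \<mu>) c"
proof -
  let ?S = "{i. 1 \<le> i \<and> c \<le> lookup \<mu> i}"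
  have fin: "finite ?S"
    by (rule finite_subset[of _ "keys \<mu>"]) (use assms(3) in \<open>auto simp: in_keys_iff\<close>)
  have down: "b \<in> ?S" if "a \<in> ?S" "1 \<le> b" "b \<le> a" for a b
    using that assms(1) le_trans[of c "lookup \<mu> a" "lookup \<mu> b"]
    by (simp add: is_partition_def)
  have "i \<in> ?S \<longleftrightarrow> i \<le> card ?S"
  proof
    assume "i \<in> ?S"
    then have "{1..i} \<subseteq> ?S" using down by (meson atLeastAtMost_iff subsetI)
    from card_mono[OF fin this] show "i \<le> card ?S" by simp
  next
    assume le: "i \<le> card ?S"
    show "i \<in> ?S"
    proof (rule ccontr)
      assume "i \<notin> ?S"
      have "?S \<subseteq> {1..<i}"
      proof
        fix a assume a: "a \<in> ?S"
        then have "\<not> i \<le> a" using down[OF a assms(2)] \<open>i \<notin> ?S\<close> by blast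
        then show "a \<in> {1..<i}" using a by simp
      qed
      from card_mono[OF _ this] show False using le assms(2) by simp
    qed
  qed
  moreover have "i \<in> ?S \<longleftrightarrow> c \<le> lookup \<mu> i" "lookup (conjugate \<mu>) c = card ?S"
    using assms(2,3) by (simp_all add: lookup_conjugate)
  ultimately show ?thesis by simp
qed

text \<open>
  The numbers of entries that are at least \<open>c\<close> form a complete invariant of an orbit. This makes the sorted
  composition unique and allows it to be recognised without giving a permutation.
\<close>

lemma conjugate_act:
  assumes w: "bij w" "w 0 = 0"
  shows "conjugate (act w \<mu>) = conjugate \<mu>"
proof (rule poly_mapping_eqI)
  fix c
  have lw: "lookup (act w \<mu>) (w i) = lookup \<mu> i" for i
    using w(1) by (simp add: lookup_act bij_is_inj)
  have pos: "1 \<le> w i \<longleftrightarrow> 1 \<le> i" for i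
    using w by (metis bij_is_inj inj_eq less_one not_le)
  have "bij_betw w {i. 1 \<le> i \<and> c \<le> lookup \<mu> i} {i. 1 \<le> i \<and> c \<le> lookup (act w \<mu>) i}"
    unfolding bij_betw_def
  proof (intro conjI set_eqI iffI)
    fix i assume i: "i \<in> {i. 1 \<le> i \<and> c \<le> lookup (act w \<mu>) i}"
    obtain j where "i = w j" using w(1) by (metis bij_pointE)
    then show "i \<in> w ` {i. 1 \<le> i \<and> c \<le> lookup \<mu> i}"
      using i lw[of j] pos[of j] by simp
  next
    fix i assume "i \<in> w ` {i. 1 \<le> i \<and> c \<le> lookup \<mu> i}"
    then obtain j where "i = w j" "1 \<le> j" "c \<le> lookup \<mu> j" by blast
    then show "i \<in> {i. 1 \<le> i \<and> c \<le> lookup (act w \<mu>) i}"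
      using lw[of j] pos[of j] by simp
  qed (use w(1) in \<open>auto intro: inj_on_subset dest: bij_is_inj\<close>)
  then show "lookup (conjugate (act w \<mu>)) c = lookup (conjugate \<mu>) c"
    unfolding lookup_conjugate by (simp add: bij_betw_same_card)
qed

lemma partition_eqI_conjugate:
  assumes \<mu>: "is_partition \<mu>" and \<nu>: "is_partition \<nu>" and eq: "conjugate \<nu> = conjugate \<mu>"
  shows "\<nu> = \<mu>"
proof -
  have same: "c \<le> lookup \<nu> i \<longleftrightarrow> c \<le> lookup \<mu> i" if "1 \<le> i" for i c
    using partition_conjugate_iff[OF \<mu> that, of c] partition_conjugate_iff[OF \<nu> that, of c] eq
    by (cases "c = 0") auto
  have "lookup \<nu> i = lookup \<mu> i" for i
  proof (cases "1 \<le> i")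
    case True
    then show ?thesis
      using same[OF True, of "lookup \<nu> i"] same[OF True, of "lookup \<mu> i"] by simp
  next
    case False
    then have "i = 0" by simp
    then show ?thesis using \<mu> \<nu> by (simp add: is_partition_def weak_composition_def)
  qed
  then show ?thesis by (rule poly_mapping_eqI)
qed

lemma sort_comp_eqI:
  assumes \<mu>: "is_partition \<mu>" and w: "w \<in> S_inf" and \<alpha>: "\<alpha> = act w \<mu>"
  shows "sort_comp \<alpha> = \<mu>"
  unfolding sort_comp_def
proof (rule the_equality)
  fix \<nu> assume "is_partition \<nu> \<and> (\<exists>w\<in>S_inf. \<alpha> = act w \<nu>)"
  then obtain v where \<nu>: "is_partition \<nu>" and v: "v \<in> S_inf" "\<alpha> = act v \<nu>" by auto
  have "conjugate \<nu> = conjugate \<alpha>"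
    using conjugate_act[OF S_inf_bij S_inf_zero, OF v(1) v(1)] v(2) by simp
  also have "\<dots> = conjugate \<mu>"
    using conjugate_act[OF S_inf_bij S_inf_zero, OF w w] \<alpha> by simp
  finally show "\<nu> = \<mu>" by (rule partition_eqI_conjugate[OF \<mu> \<nu>])
qed (use assms in blast)

lemma sort_comp_word:
  assumes "weak_composition \<alpha>"
  obtains "is" where "set is \<subseteq> {1..}" "is_partition (sort_comp \<alpha>)" "\<alpha> = act (word_perm is) (sort_comp \<alpha>)"
    "length is = inv_count \<alpha>"
proof -
  obtain "is" \<mu> where *: "set is \<subseteq> {1..}" "is_partition \<mu>" "\<alpha> = act (word_perm is) \<mu>" "length is = inv_count \<alpha>"
    using sorting_word[OF assms] by auto
  moreover have "word_perm is \<in> S_inf" unfolding S_inf_def using *(1) by blast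
  ultimately have "sort_comp \<alpha> = \<mu>" using sort_comp_eqI by blast
  then show ?thesis using * that by blast
qed

lemma sort_comp_partition: "is_partition \<mu> \<Longrightarrow> sort_comp \<mu> = \<mu>"
  by (rule sort_comp_eqI[of _ id]) (auto simp: S_inf_def intro: exI[of _ "[]"])

lemma is_partition_sort_comp: "weak_composition \<alpha> \<Longrightarrow> is_partition (sort_comp \<alpha>)"
  by (metis sort_comp_word)

lemma sort_comp_eqI_conjugate:
  assumes "weak_composition \<alpha>" "is_partition \<mu>" "conjugate \<mu> = conjugate \<alpha>"
  shows "sort_comp \<alpha> = \<mu>"
proof -
  obtain "is" where "is": "set is \<subseteq> {1..}" "is_partition (sort_comp \<alpha>)" "\<alpha> = act (word_perm is) (sort_comp \<alpha>)"
    using sort_comp_word[OF assms(1)] .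
  have "conjugate (sort_comp \<alpha>) = conjugate (act (word_perm is) (sort_comp \<alpha>))"
    by (rule conjugate_act[OF bij_word_perm word_perm_zero[OF "is"(1)], symmetric])
  also have "\<dots> = conjugate \<mu>" unfolding "is"(3)[symmetric] by (rule assms(3)[symmetric])
  finally show ?thesis by (rule partition_eqI_conjugate[OF assms(2) "is"(2)])
qed

section \<open>Applying the operators along a sorting path\<close>

text \<open>
  The least ascent is taken only to obtain a function; by \<open>transport_ascent\<close> below, any ascent gives the same
  polynomial.
\<close>

function transport :: "polynomial \<Rightarrow> composition \<Rightarrow> polynomial" where
  "transport f \<alpha> =
    (if \<exists>k. ascent \<alpha> k
     then pi_op (LEAST k. ascent \<alpha> k) (transport f (swap (LEAST k. ascent \<alpha> k) \<alpha>))
     else f)"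
  by auto
termination
proof (relation "measure (\<lambda>(f, \<alpha>). inv_count \<alpha>)")
  fix f \<alpha> assume "\<exists>k. ascent \<alpha> k"
  then have "ascent \<alpha> (LEAST k. ascent \<alpha> k)" by (rule LeastI_ex)
  from inv_count_ascent[OF this]
  show "((f, swap (LEAST k. ascent \<alpha> k) \<alpha>), f, \<alpha>) \<in> measure (\<lambda>(f, \<alpha>). inv_count \<alpha>)" by simp
qed simp

declare transport.simps [simp del]

lemma transport_partition: "is_partition \<mu> \<Longrightarrow> transport f \<mu> = f"
  by (subst transport.simps) (use partition_no_ascent in auto)

text \<open>
  Newman's diamond argument. Two ascents can be removed one after the other in either order if they are not adjacent.
  If they are adjacent, then three increasing entries are reversed along the two sides of a hexagon, and the results
  agree by the braid relation.
\<close>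

lemma transport_ascent:
  assumes "ascent \<alpha> k"
  shows "transport f \<alpha> = pi_op k (transport f (swap k \<alpha>))"
  using assms
proof (induction "inv_count \<alpha>" arbitrary: \<alpha> k rule: less_induct)
  case less
  define j where "j = (LEAST k. ascent \<alpha> k)"
  have j: "ascent \<alpha> j" and "j \<le> k"
    using less.prems by (auto simp: j_def intro: LeastI Least_le)
  have Tj: "transport f \<alpha> = pi_op j (transport f (swap j \<alpha>))"
    unfolding j_def by (subst transport.simps) (use less.prems in auto)
  have IH: "transport f \<beta> = pi_op i (transport f (swap i \<beta>))" if "inv_count \<beta> < inv_count \<alpha>" "ascent \<beta> i" for \<beta> i
    using less.hyps that by blast
  have dj: "inv_count (swap j \<alpha>) < inv_count \<alpha>" and dk: "inv_count (swap k \<alpha>) < inv_count \<alpha>"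
    using inv_count_ascent[OF j] inv_count_ascent[OF less.prems] by auto
  consider "j = k" | "Suc j < k" | "k = Suc j" using \<open>j \<le> k\<close> by linarith
  then show ?case
  proof cases
    case 1
    then show ?thesis using Tj by simp
  next
    case 2
    have "ascent (swap j \<alpha>) k" "ascent (swap k \<alpha>) j"
      using 2 j less.prems by (auto simp: ascent_def adj_trans_cases)
    moreover have "swap k (swap j \<alpha>) = swap j (swap k \<alpha>)"
      using adj_trans_commute[OF 2] by (simp add: act_compose)
    ultimately show ?thesis
      using Tj IH[OF dj] IH[OF dk] pi_op_commute[OF 2] by metis
  next
    case 3
    have asc: "ascent (swap j \<alpha>) k" "ascent (swap k (swap j \<alpha>)) j" "ascent (swap k \<alpha>) j" "ascent (swap j (swap k \<alpha>)) k"
      using 3 j less.prems by (auto simp: ascent_def adj_trans_cases)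
    have dkj: "inv_count (swap k (swap j \<alpha>)) < inv_count \<alpha>" "inv_count (swap j (swap k \<alpha>)) < inv_count \<alpha>"
      using inv_count_ascent[OF asc(1)] inv_count_ascent[OF asc(3)] dj dk by auto
    have eq: "swap j (swap k (swap j \<alpha>)) = swap k (swap j (swap k \<alpha>))"
      using adj_trans_braid[of j] by (simp add: 3 act_compose bij_comp)
    have "transport f \<alpha> = pi_op j (pi_op k (pi_op j (transport f (swap j (swap k (swap j \<alpha>))))))"
      using Tj IH[OF dj asc(1)] IH[OF dkj(1) asc(2)] by simp
    also have "\<dots> = pi_op k (pi_op j (pi_op k (transport f (swap k (swap j (swap k \<alpha>))))))"
      unfolding eq unfolding 3 by (rule pi_op_braid)
    also have "\<dots> = pi_op k (transport f (swap k \<alpha>))"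
      using IH[OF dk asc(3)] IH[OF dkj(2) asc(4)] by simp
    finally show ?thesis .
  qed
qed

lemma inv_count_act_word_le:
  assumes "is_partition \<mu>" "set is \<subseteq> {1..}"
  shows "inv_count (act (word_perm is) \<mu>) \<le> length is"
  using assms(2)
proof (induction "is")
  case Nil
  then show ?case using assms(1) by (simp only: word_perm_simps act_id inv_count_partition list.size)
next
  case (Cons i "is")
  then show ?case
    unfolding act_word_Cons using inv_count_swap_Suc[of i "act (word_perm is) \<mu>"] by simp
qed

text \<open>
  A letter raises the number of inversions by at most one. So in a word that is not longer than the number of
  inversions that it creates, every letter acts at an ascent.
\<close>

lemma pi_word_eq_transport:
  assumes "is_partition \<mu>" "set is \<subseteq> {1..}" "length is \<le> inv_count (act (word_perm is) \<mu>)"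
  shows "pi_word is f = transport f (act (word_perm is) \<mu>)"
  using assms(2,3)
proof (induction "is")
  case Nil
  show ?case
    unfolding word_perm_simps act_id transport_partition[OF assms(1)] by (simp add: pi_word_def)
next
  case (Cons i "is")
  define \<beta> where "\<beta> = act (word_perm is) \<mu>"
  have \<alpha>: "act (word_perm (i # is)) \<mu> = swap i \<beta>"
    by (simp only: \<beta>_def act_word_Cons)
  have i: "1 \<le> i" and "inv_count \<beta> \<le> length is"
    using Cons.prems inv_count_act_word_le[OF assms(1), of "is"] by (auto simp: \<beta>_def)
  then have gt: "inv_count \<beta> < inv_count (swap i \<beta>)"
    using Cons.prems(2) unfolding \<alpha> by simp
  then have asc: "ascent (swap i \<beta>) i"
    using inv_count_swap_le[OF i, of \<beta>] by fastforce
  have "length is \<le> inv_count \<beta>"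
    using Cons.prems(2) inv_count_swap_Suc[OF i, of \<beta>] unfolding \<alpha> by simp
  then have "pi_word is f = transport f \<beta>"
    using Cons by (simp add: \<beta>_def)
  then have "pi_word (i # is) f = pi_op i (transport f \<beta>)"
    by (simp add: pi_word_def)
  also have "\<dots> = transport f (swap i \<beta>)"
    using transport_ascent[OF asc] by simp
  finally show ?case unfolding \<alpha> .
qed

lemma perm_length_le: "set is \<subseteq> {1..} \<Longrightarrow> perm_length (word_perm is) \<le> length is"
  unfolding perm_length_def by (rule Least_le) auto

lemma reduced_word_exists:
  assumes "w \<in> S_inf"
  shows "\<exists>is. reduced_word w is"
proof -
  have "\<exists>l. \<exists>is. set is \<subseteq> {1..} \<and> word_perm is = w \<and> length is = l"
    using assms by (auto simp: S_inf_def)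
  from LeastI_ex[OF this] show ?thesis
    unfolding reduced_word_def perm_length_def by blast
qed

text \<open>
  The bound on the length comes from comparing the minimal permutation with the one spelled by a sorting word.
\<close>

lemma u_perm:
  assumes "weak_composition \<alpha>"
  shows "u_perm \<alpha> \<in> S_inf" "\<alpha> = act (u_perm \<alpha>) (sort_comp \<alpha>)" "perm_length (u_perm \<alpha>) \<le> inv_count \<alpha>"
proof -
  obtain "is" where *: "set is \<subseteq> {1..}" "is_partition (sort_comp \<alpha>)" "\<alpha> = act (word_perm is) (sort_comp \<alpha>)"
    "length is = inv_count \<alpha>"
    using sort_comp_word[OF assms] .
  have "word_perm is \<in> S_inf" unfolding S_inf_def using *(1) by blast
  with *(3) have P: "word_perm is \<in> S_inf \<and> \<alpha> = act (word_perm is) (sort_comp \<alpha>)" by (rule conjI[rotated])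
  note min = arg_min_nat_lemma[of "\<lambda>u. u \<in> S_inf \<and> \<alpha> = act u (sort_comp \<alpha>)", OF P, of perm_length,
    folded u_perm_def]
  show "u_perm \<alpha> \<in> S_inf" by (rule conjunct1[OF conjunct1[OF min]])
  show "\<alpha> = act (u_perm \<alpha>) (sort_comp \<alpha>)" by (rule conjunct2[OF conjunct1[OF min]])
  have "perm_length (u_perm \<alpha>) \<le> perm_length (word_perm is)"
    using conjunct2[OF min] P by (elim allE[of _ "word_perm is"] impE)
  also have "\<dots> \<le> inv_count \<alpha>"
    using perm_length_le[OF *(1)] *(4) by (simp only:)
  finally show "perm_length (u_perm \<alpha>) \<le> inv_count \<alpha>" .
qed

lemma pi_perm_u_perm:
  assumes "weak_composition \<alpha>"
  shows "pi_perm (u_perm \<alpha>) f = transport f \<alpha>"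
proof -
  define "is" where "is = (SOME is. reduced_word (u_perm \<alpha>) is)"
  have "reduced_word (u_perm \<alpha>) is"
    unfolding is_def using reduced_word_exists[OF u_perm(1)[OF assms]] by (rule someI_ex)
  then have "is": "set is \<subseteq> {1..}" "word_perm is = u_perm \<alpha>" "length is = perm_length (u_perm \<alpha>)"
    by (auto simp: reduced_word_def)
  have \<alpha>: "act (word_perm is) (sort_comp \<alpha>) = \<alpha>"
    unfolding "is"(2) by (rule u_perm(2)[OF assms, symmetric])
  have "length is \<le> inv_count (act (word_perm is) (sort_comp \<alpha>))"
    unfolding \<alpha> using "is"(3) u_perm(3)[OF assms] by simp
  then have "pi_word is f = transport f (act (word_perm is) (sort_comp \<alpha>))"
    using "is" is_partition_sort_comp[OF assms] by (intro pi_word_eq_transport)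
  then show ?thesis unfolding \<alpha> unfolding pi_perm_def is_def .
qed

lemma key_poly_transport: "weak_composition \<alpha> \<Longrightarrow> key_poly \<alpha> = transport (monom (sort_comp \<alpha>)) \<alpha>"
  by (simp add: key_poly_def pi_perm_u_perm)

lemma Q_key_poly_transport:
  "weak_composition \<gamma> \<Longrightarrow> Q_key_poly \<gamma> =
    transport (\<Prod>(i, j)\<in>diagram (half_le (sort_comp \<gamma>)). x_var i + x_var (i + j - 1)) \<gamma>"
  by (simp add: Q_key_poly_def pi_perm_u_perm)

section \<open>Coefficients of isobaric divided differences\<close>

text \<open>
  The exponents that agree with \<open>\<beta>\<close> outside the positions \<open>k\<close>, \<open>k + 1\<close> and have sum \<open>N\<close> on these two
  positions form a string, here parametrised by the entry in position \<open>k\<close>. The sum is an argument of its own, so that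
  every point of a string gives the same parametrisation.
\<close>

definition string_pt :: "nat \<Rightarrow> composition \<Rightarrow> nat \<Rightarrow> nat \<Rightarrow> composition" where
  "string_pt k \<beta> N j = Poly_Mapping.update k j (Poly_Mapping.update (Suc k) (N - j) \<beta>)"

lemma lookup_string_pt:
  "lookup (string_pt k \<beta> N j) a =
    (if a = k then j else if a = Suc k then N - j else lookup \<beta> a)"
  by (simp add: string_pt_def lookup_update)

lemma string_pt_self:
  assumes "N = lookup \<beta> k + lookup \<beta> (Suc k)"
  shows "string_pt k \<beta> N (lookup \<beta> k) = \<beta>"
    "string_pt k \<beta> N (lookup \<beta> (Suc k)) = swap k \<beta>"
  using assms by (auto intro!: poly_mapping_eqI simp: lookup_string_pt adj_trans_cases)

lemma string_pt_string_pt: "string_pt k (string_pt k \<beta> M i) N j = string_pt k \<beta> N j"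
  by (auto intro!: poly_mapping_eqI simp: lookup_string_pt)

lemma swap_string_pt: "j \<le> N \<Longrightarrow> swap k (string_pt k \<beta> N j) = string_pt k \<beta> N (N - j)"
  by (auto intro!: poly_mapping_eqI simp: lookup_string_pt adj_trans_cases)

text \<open>
  Compare the coefficients at the exponent \<open>(j + 1, N - j)\<close> in the equation that defines \<open>\<pi>\<^sub>k f\<close>.
\<close>

lemma lookup_pi_op_step:
  assumes "j < N"
  shows "lookup (pi_op k f) (string_pt k \<beta> N j) - lookup (pi_op k f) (string_pt k \<beta> N (Suc j)) =
    lookup f (string_pt k \<beta> N j) - lookup f (string_pt k \<beta> N (N - Suc j))"
proof -
  define \<delta> where "\<delta> = string_pt k \<beta> (Suc N) (Suc j)"
  have x: "\<delta> = single k 1 + string_pt k \<beta> N j"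
    by (auto intro!: poly_mapping_eqI simp: \<delta>_def lookup_string_pt lookup_add lookup_single when_def)
  have y: "\<delta> = single (Suc k) 1 + string_pt k \<beta> N (Suc j)"
    using assms by (auto intro!: poly_mapping_eqI simp: \<delta>_def lookup_string_pt lookup_add lookup_single when_def)
  have X: "lookup (x_var k * g) \<delta> = lookup g (string_pt k \<beta> N j)" for g
    unfolding x x_var_def by (rule lookup_monom_mult)
  have Y: "lookup (x_var (Suc k) * g) \<delta> = lookup g (string_pt k \<beta> N (Suc j))" for g
    unfolding y x_var_def by (rule lookup_monom_mult)
  have "lookup ((x_var k - x_var (Suc k)) * pi_op k f) \<delta> =
    lookup (x_var k * f - x_var (Suc k) * act_poly (adj_trans k) f) \<delta>"
    by (simp only: pi_op_spec)
  then show ?thesis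
    using assms unfolding left_diff_distrib lookup_minus X Y
    by (simp add: lookup_act_poly swap_string_pt Suc_leI)
qed

text \<open>
  The same comparison at the exponent \<open>(N + 1, 0)\<close>, where multiples of \<open>x\<^bsub>k+1\<^esub>\<close> have no coefficient.
\<close>

lemma lookup_pi_op_end:
  "lookup (pi_op k f) (string_pt k \<beta> N N) = lookup f (string_pt k \<beta> N N)"
proof -
  define \<delta> where "\<delta> = string_pt k \<beta> (Suc N) (Suc N)"
  have x: "\<delta> = single k 1 + string_pt k \<beta> N N"
    by (auto intro!: poly_mapping_eqI simp: \<delta>_def lookup_string_pt lookup_add lookup_single when_def)
  have X: "lookup (x_var k * g) \<delta> = lookup g (string_pt k \<beta> N N)" for g
    unfolding x x_var_def by (rule lookup_monom_mult)
  have "\<nexists>\<gamma>. \<delta> = single (Suc k) 1 + \<gamma>"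
  proof
    assume "\<exists>\<gamma>. \<delta> = single (Suc k) 1 + \<gamma>"
    then obtain \<gamma> where "\<delta> = single (Suc k) 1 + \<gamma>" by blast
    then have "lookup \<delta> (Suc k) = Suc (lookup \<gamma> (Suc k))"
      by (simp add: lookup_add)
    then show False by (simp add: \<delta>_def lookup_string_pt)
  qed
  then have Y: "lookup (x_var (Suc k) * g) \<delta> = 0" for g
    unfolding x_var_def by (rule lookup_monom_mult_0)
  have "lookup ((x_var k - x_var (Suc k)) * pi_op k f) \<delta> =
    lookup (x_var k * f - x_var (Suc k) * act_poly (adj_trans k) f) \<delta>"
    by (simp only: pi_op_spec)
  then show ?thesis
    unfolding left_diff_distrib lookup_minus X Y by simp
qed

lemma lookup_pi_op_string:
  fixes f :: polynomial and \<beta> :: composition and k :: nat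
  assumes "j \<le> N"
  defines "c \<equiv> \<lambda>i. lookup f (string_pt k \<beta> N i)"
  shows "lookup (pi_op k f) (string_pt k \<beta> N j) = (\<Sum>i=j..N. c i) - (\<Sum>i<N - j. c i)"
  using assms(1)
proof (induction rule: inc_induct)
  case base
  then show ?case by (simp add: lookup_pi_op_end c_def)
next
  case (step j)
  have "lookup (pi_op k f) (string_pt k \<beta> N j) =
      lookup (pi_op k f) (string_pt k \<beta> N (Suc j)) + c j - c (N - Suc j)"
    using lookup_pi_op_step[OF step.hyps(2), of k f \<beta>] by (simp add: c_def)
  also have "\<dots> = (c j + (\<Sum>i=Suc j..N. c i)) - ((\<Sum>i<N - Suc j. c i) + c (N - Suc j))"
    using step.IH by simp
  also have "c j + (\<Sum>i=Suc j..N. c i) = (\<Sum>i=j..N. c i)"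
    using step.hyps by (simp add: sum.atLeast_Suc_atMost)
  also have "(\<Sum>i<N - Suc j. c i) + c (N - Suc j) = (\<Sum>i<N - j. c i)"
    using step.hyps by (metis Suc_diff_Suc sum.lessThan_Suc)
  finally show ?case .
qed

text \<open>
  The part of the two sums strictly between the two entries of \<open>\<beta>\<close> cancels. What remains shows that only the points
  of the string that are at least as far from its centre as \<open>\<beta>\<close> contribute.
\<close>

lemma lookup_pi_op:
  fixes f :: polynomial and \<beta> :: composition and k :: nat
  defines "p \<equiv> lookup \<beta> k" and "q \<equiv> lookup \<beta> (Suc k)"
  defines "c \<equiv> \<lambda>i. lookup f (string_pt k \<beta> (p + q) i)"
  shows "lookup (pi_op k f) \<beta> = (\<Sum>i=max p q..p + q. c i) - (\<Sum>i<min p q. c i)"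
proof -
  have *: "lookup (pi_op k f) \<beta> = (\<Sum>i=p..p + q. c i) - (\<Sum>i<q. c i)"
    using lookup_pi_op_string[of p "p + q" k f \<beta>] string_pt_self(1)[of "p + q" \<beta> k]
    by (simp add: p_def q_def c_def)
  show ?thesis
  proof (cases "q \<le> p")
    case True
    then show ?thesis by (simp add: * max_def min_def)
  next
    case False
    have "(\<Sum>i=p..p + q. c i) = (\<Sum>i=p..<q. c i) + (\<Sum>i=q..p + q. c i)"
      using False sum.atLeastLessThan_concat[of p q "Suc (p + q)" c] by (simp add: atLeastLessThanSuc_atLeastAtMost)
    moreover have "(\<Sum>i<q. c i) = (\<Sum>i<p. c i) + (\<Sum>i=p..<q. c i)"
      using False sum.atLeastLessThan_concat[of 0 p q c] by (simp add: lessThan_atLeast0)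
    ultimately show ?thesis using False by (simp add: * max_def min_def)
  qed
qed

text \<open>
  If \<open>f\<close> vanishes on the string outside the segment from \<open>\<beta>\<close> to its mirror image, then only the end of the segment
  with the larger entry in position \<open>k\<close> contributes.
\<close>

lemma lookup_pi_op_extremal:
  fixes f :: polynomial
  assumes "\<And>i. i \<le> lookup \<beta> k + lookup \<beta> (Suc k) \<Longrightarrow>
      i < min (lookup \<beta> k) (lookup \<beta> (Suc k)) \<or>
      max (lookup \<beta> k) (lookup \<beta> (Suc k)) < i \<Longrightarrow>
      lookup f (string_pt k \<beta> (lookup \<beta> k + lookup \<beta> (Suc k)) i) = 0"
  shows "lookup (pi_op k f) \<beta> =
    lookup f (if lookup \<beta> k < lookup \<beta> (Suc k) then swap k \<beta> else \<beta>)"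
proof -
  define p q where "p = lookup \<beta> k" and "q = lookup \<beta> (Suc k)"
  define c where "c = (\<lambda>i. lookup f (string_pt k \<beta> (p + q) i))"
  have 0: "c i = 0" if "i \<le> p + q" "i < min p q \<or> max p q < i" for i
    using assms[of i] that by (simp add: c_def p_def q_def)
  have "lookup (pi_op k f) \<beta> = (\<Sum>i=max p q..p + q. c i) - (\<Sum>i<min p q. c i)"
    unfolding p_def q_def c_def by (rule lookup_pi_op)
  also have "(\<Sum>i<min p q. c i) = 0"
    using 0 by (intro sum.neutral) auto
  also have "(\<Sum>i=max p q..p + q. c i) = (\<Sum>i\<in>{max p q}. c i)"
  proof (intro sum.mono_neutral_right ballI)
    fix i assume "i \<in> {max p q..p + q} - {max p q}"
    then have "max p q < i" "i \<le> p + q" by (auto simp: max_def split: if_splits)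
    then show "c i = 0" using 0 by blast
  qed auto
  finally have "lookup (pi_op k f) \<beta> = c (max p q)" by simp
  then show ?thesis
    using string_pt_self[of "p + q" \<beta> k] by (auto simp: c_def p_def q_def max_def)
qed

section \<open>Supports\<close>

text \<open>
  These are the sets that contain, with an exponent, the whole segment between it and its mirror image on each of its
  strings. The operators do not lead out of them.
\<close>

definition string_closed :: "composition set \<Rightarrow> bool" where
  "string_closed S \<longleftrightarrow> (\<forall>\<beta>\<in>S. \<forall>k\<ge>1. \<forall>j.
     min (lookup \<beta> k) (lookup \<beta> (Suc k)) \<le> j \<and>
     j \<le> max (lookup \<beta> k) (lookup \<beta> (Suc k)) \<longrightarrow>
     string_pt k \<beta> (lookup \<beta> k + lookup \<beta> (Suc k)) j \<in> S)"

lemma keys_pi_op_subset: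
  assumes S: "string_closed S" and f: "keys f \<subseteq> S" and k: "1 \<le> k"
  shows "keys (pi_op k f) \<subseteq> S"
proof (rule ccontr)
  assume "\<not> keys (pi_op k f) \<subseteq> S"
  then obtain \<beta> where \<beta>: "\<beta> \<in> keys (pi_op k f)" "\<beta> \<notin> S" by blast
  define p q where "p = lookup \<beta> k" and "q = lookup \<beta> (Suc k)"
  define c where "c = (\<lambda>i. lookup f (string_pt k \<beta> (p + q) i))"
  have 0: "c i = 0" if "i \<le> p + q" "i < min p q \<or> max p q \<le> i" for i
  proof (rule ccontr)
    assume "c i \<noteq> 0"
    then have "string_pt k \<beta> (p + q) i \<in> S" using f by (auto simp: c_def in_keys_iff)
    moreover have "lookup (string_pt k \<beta> (p + q) i) k = i"
      "lookup (string_pt k \<beta> (p + q) i) (Suc k) = p + q - i"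
      by (simp_all add: lookup_string_pt)
    moreover have "min i (p + q - i) \<le> p" "p \<le> max i (p + q - i)"
      using that by auto
    moreover have "i + (p + q - i) = p + q" using that by simp
    ultimately have "string_pt k (string_pt k \<beta> (p + q) i) (p + q) p \<in> S"
      using S k unfolding string_closed_def by metis
    then show False
      using \<beta>(2) string_pt_self(1)[of "p + q" \<beta> k] by (simp add: string_pt_string_pt p_def q_def)
  qed
  have "lookup (pi_op k f) \<beta> = (\<Sum>i=max p q..p + q. c i) - (\<Sum>i<min p q. c i)"
    unfolding p_def q_def c_def by (rule lookup_pi_op)
  also have "(\<Sum>i<min p q. c i) = 0"
    using 0 by (intro sum.neutral) auto
  also have "(\<Sum>i=max p q..p + q. c i) = 0"
    using 0 by (intro sum.neutral) auto
  finally show False using \<beta>(1) by (simp add: in_keys_iff)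
qed

text \<open>
  Every property that holds at the sorted partition and survives one step at an ascent holds for the transported
  polynomial. This is the form in which all invariants below are proved.
\<close>

lemma transport_induct [consumes 1, case_names base step]:
  fixes P :: "composition \<Rightarrow> polynomial \<Rightarrow> bool"
  assumes "weak_composition \<alpha>"
    and base: "P (sort_comp \<alpha>) f"
    and step: "\<And>\<beta> g k. ascent \<beta> k \<Longrightarrow> weak_composition \<beta> \<Longrightarrow> sort_comp \<beta> = sort_comp \<alpha> \<Longrightarrow> 
      P (swap k \<beta>) g \<Longrightarrow> P \<beta> (pi_op k g)"
  shows "P \<alpha> (transport f \<alpha>)"
proof -
  have "P \<beta> (transport f \<beta>)" if "weak_composition \<beta>" "sort_comp \<beta> = sort_comp \<alpha>" for \<beta>
    using that
  proof (induction "inv_count \<beta>" arbitrary: \<beta> rule: less_induct)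
    case less
    show ?case
    proof (cases "is_partition \<beta>")
      case True
      then show ?thesis
        using base less.prems sort_comp_partition[of \<beta>] by (simp add: transport_partition)
    next
      case False
      then obtain k where k: "ascent \<beta> k" using less.prems by (auto simp: is_partition_iff_no_ascent)
      then have "1 \<le> k" by (simp add: ascent_def)
      have wk: "weak_composition (swap k \<beta>)"
        using less.prems(1) weak_composition_swap[OF \<open>1 \<le> k\<close>] by simp
      have "sort_comp (swap k \<beta>) = sort_comp \<beta>"
      proof -
        obtain "is" where *: "set is \<subseteq> {1..}" "is_partition (sort_comp \<beta>)" "\<beta> = act (word_perm is) (sort_comp \<beta>)"
          using sort_comp_word[OF less.prems(1)] .
        have "swap k \<beta> = act (word_perm (k # is)) (sort_comp \<beta>)"
          unfolding act_word_Cons using *(3) by (rule arg_cong)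
        moreover have "word_perm (k # is) \<in> S_inf"
          unfolding S_inf_def using *(1) \<open>1 \<le> k\<close> by (auto intro!: exI[of _ "k # is"])
        ultimately show ?thesis using sort_comp_eqI[OF *(2)] by blast
      qed
      then have "P (swap k \<beta>) (transport f (swap k \<beta>))"
        using less.hyps[of "swap k \<beta>"] less.prems inv_count_ascent[OF k] wk by simp
      from step[OF k less.prems this] show ?thesis
        using transport_ascent[OF k] by simp
    qed
  qed
  then show ?thesis using assms(1) by simp
qed

lemma keys_transport_subset:
  assumes "weak_composition \<alpha>" "string_closed S" "keys f \<subseteq> S"
  shows "keys (transport f \<alpha>) \<subseteq> S"
  using assms(1)
proof (rule transport_induct[where P = "\<lambda>_ g. keys g \<subseteq> S"])
  fix \<beta> and g :: polynomial and k
  assume "ascent \<beta> k" "keys g \<subseteq> S"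
  then show "keys (pi_op k g) \<subseteq> S"
    using keys_pi_op_subset[OF assms(2)] by (simp add: ascent_def)
qed (fact assms(3))

section \<open>A composition is determined by its key polynomial\<close>

definition sq :: "composition \<Rightarrow> nat" where
  "sq \<beta> = (\<Sum>a\<in>keys \<beta>. (lookup \<beta> a)\<^sup>2)"

lemma sq_superset:
  assumes "finite T" "keys \<beta> \<subseteq> T"
  shows "sq \<beta> = (\<Sum>a\<in>T. (lookup \<beta> a)\<^sup>2)"
  unfolding sq_def using assms by (intro sum.mono_neutral_left) (auto simp: in_keys_iff)

lemma sq_string_pt:
  "sq (string_pt k \<beta> N j) + ((lookup \<beta> k)\<^sup>2 + (lookup \<beta> (Suc k))\<^sup>2) =
    sq \<beta> + (j\<^sup>2 + (N - j)\<^sup>2)"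
proof -
  define T where "T = keys \<beta> - {k, Suc k}"
  have fin: "finite T" "k \<notin> T" "Suc k \<notin> T" by (auto simp: T_def)
  have "sq \<gamma> = (lookup \<gamma> k)\<^sup>2 + ((lookup \<gamma> (Suc k))\<^sup>2 + (\<Sum>a\<in>T. (lookup \<gamma> a)\<^sup>2))"
    if "keys \<gamma> \<subseteq> insert k (insert (Suc k) T)" for \<gamma>
    using fin by (subst sq_superset[OF _ that]) auto
  note * = this
  have "sq \<beta> = (lookup \<beta> k)\<^sup>2 + ((lookup \<beta> (Suc k))\<^sup>2 + (\<Sum>a\<in>T. (lookup \<beta> a)\<^sup>2))"
    by (rule *) (auto simp: T_def)
  moreover have "sq (string_pt k \<beta> N j) = j\<^sup>2 + ((N - j)\<^sup>2 + (\<Sum>a\<in>T. (lookup (string_pt k \<beta> N j) a)\<^sup>2))"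
    by (subst *) (auto simp: T_def in_keys_iff lookup_string_pt split: if_splits)
  moreover have "(\<Sum>a\<in>T. (lookup (string_pt k \<beta> N j) a)\<^sup>2) = (\<Sum>a\<in>T. (lookup \<beta> a)\<^sup>2)"
    by (intro sum.cong) (auto simp: T_def lookup_string_pt)
  ultimately show ?thesis by simp
qed

lemma sq_swap: "sq (swap k \<beta>) = sq \<beta>"
  using sq_string_pt[of k \<beta> "lookup \<beta> k + lookup \<beta> (Suc k)" "lookup \<beta> (Suc k)"]
  by (simp add: string_pt_self)

lemma sum_squares_inside:
  fixes p q j :: nat
  assumes "min p q \<le> j" "j \<le> max p q"
  shows "j\<^sup>2 + (p + q - j)\<^sup>2 \<le> p\<^sup>2 + q\<^sup>2"
proof -
  have "(int j - int p) * (int j - int q) \<le> 0"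
    using assms by (auto simp: mult_le_0_iff min_def max_def split: if_splits)
  then have "(int j)\<^sup>2 + (int p + int q - int j)\<^sup>2 \<le> (int p)\<^sup>2 + (int q)\<^sup>2"
    by (simp add: power2_eq_square algebra_simps)
  moreover have "int (p + q - j) = int p + int q - int j" using assms by auto
  ultimately have "int (j\<^sup>2 + (p + q - j)\<^sup>2) \<le> int (p\<^sup>2 + q\<^sup>2)" by simp
  then show ?thesis by linarith
qed

lemma sum_squares_outside:
  fixes p q j :: nat
  assumes "j < min p q \<or> max p q < j" "j \<le> p + q"
  shows "p\<^sup>2 + q\<^sup>2 < j\<^sup>2 + (p + q - j)\<^sup>2"
proof -
  have "(int j - int p) * (int j - int q) > 0"
    using assms by (auto simp: zero_less_mult_iff min_def max_def split: if_splits)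
  then have "(int p)\<^sup>2 + (int q)\<^sup>2 < (int j)\<^sup>2 + (int p + int q - int j)\<^sup>2"
    by (simp add: power2_eq_square algebra_simps)
  moreover have "int (p + q - j) = int p + int q - int j" using assms by auto
  ultimately have "int (p\<^sup>2 + q\<^sup>2) < int (j\<^sup>2 + (p + q - j)\<^sup>2)" by simp
  then show ?thesis by linarith
qed

lemma string_closed_ball: "string_closed {\<beta>. sq \<beta> \<le> R}"
  unfolding string_closed_def
proof (intro ballI allI impI)
  fix \<beta> k j
  assume "\<beta> \<in> {\<beta>. sq \<beta> \<le> R}" and j: "min (lookup \<beta> k) (lookup \<beta> (Suc k)) \<le> j \<and>
    j \<le> max (lookup \<beta> k) (lookup \<beta> (Suc k))"
  then show "string_pt k \<beta> (lookup \<beta> k + lookup \<beta> (Suc k)) j \<in> {\<beta>. sq \<beta> \<le> R}"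
    using sum_squares_inside[OF conjunct1[OF j] conjunct2[OF j]]
      sq_string_pt[of k \<beta> "lookup \<beta> k + lookup \<beta> (Suc k)" j] by simp
qed

text \<open>
  The squared norm is strictly smaller inside the segment between an exponent and its mirror image and strictly larger
  outside. Hence on the exponents of maximal norm an operator only copies coefficients from the larger to the smaller
  end of a string, and this raises the number of inversions by at most one. Among these exponents \<open>\<alpha>\<close> is therefore the
  only one with the maximal number of inversions.
\<close>

lemma key_poly_extremal:
  assumes "weak_composition \<alpha>"
  shows "keys (key_poly \<alpha>) \<subseteq> {\<beta>. sq \<beta> \<le> sq \<alpha>}"
    "lookup (key_poly \<alpha>) \<alpha> = 1"
    "\<beta> \<in> keys (key_poly \<alpha>) \<Longrightarrow> sq \<beta> = sq \<alpha> \<Longrightarrow> \<beta> = \<alpha> \<or> inv_count \<beta> < inv_count \<alpha>"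
proof -
  define P where "P = (\<lambda>\<alpha> (g :: polynomial). keys g \<subseteq> {\<beta>. sq \<beta> \<le> sq \<alpha>} \<and> lookup g \<alpha> = 1 \<and>
    (\<forall>\<beta>\<in>keys g. sq \<beta> = sq \<alpha> \<longrightarrow> \<beta> = \<alpha> \<or> inv_count \<beta> < inv_count \<alpha>))"
  have "P \<alpha> (transport (monom (sort_comp \<alpha>)) \<alpha>)"
    using assms
  proof (induction rule: transport_induct)
    case base
    then show ?case by (simp add: P_def lookup_monom)
  next
    case (step \<beta> g k)
    have k: "1 \<le> k" using step by (simp add: ascent_def)
    have g: "keys g \<subseteq> {\<gamma>. sq \<gamma> \<le> sq \<beta>}" "lookup g (swap k \<beta>) = 1"
      "\<And>\<gamma>. \<gamma> \<in> keys g \<Longrightarrow> sq \<gamma> = sq \<beta> \<Longrightarrow> \<gamma> = swap k \<beta> \<or> inv_count \<gamma> < inv_count (swap k \<beta>)"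
      using step.IH by (auto simp: P_def sq_swap)
    have top: "lookup (pi_op k g) \<gamma> =
        lookup g (if lookup \<gamma> k < lookup \<gamma> (Suc k) then swap k \<gamma> else \<gamma>)"
      if "sq \<gamma> = sq \<beta>" for \<gamma>
    proof (rule lookup_pi_op_extremal)
      fix i
      let ?N = "lookup \<gamma> k + lookup \<gamma> (Suc k)"
      assume "i \<le> ?N" "i < min (lookup \<gamma> k) (lookup \<gamma> (Suc k)) \<or>
        max (lookup \<gamma> k) (lookup \<gamma> (Suc k)) < i"
      from sum_squares_outside[OF this(2,1)] have "sq (string_pt k \<gamma> ?N i) > sq \<beta>"
        using sq_string_pt[of k \<gamma> ?N i] that by linarith
      then have "string_pt k \<gamma> ?N i \<notin> keys g" using g(1) by fastforce
      then show "lookup g (string_pt k \<gamma> ?N i) = 0" by (simp add: in_keys_iff)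
    qed
    have "\<gamma> = \<beta> \<or> inv_count \<gamma> < inv_count \<beta>"
      if \<gamma>: "\<gamma> \<in> keys (pi_op k g)" "sq \<gamma> = sq \<beta>" for \<gamma>
    proof (cases "ascent \<gamma> k")
      case True
      then have "swap k \<gamma> \<in> keys g"
        using \<gamma>(1) top[OF \<gamma>(2)] by (simp add: in_keys_iff ascent_def)
      then have "swap k \<gamma> = swap k \<beta> \<or> inv_count (swap k \<gamma>) < inv_count (swap k \<beta>)"
        using g(3) \<gamma>(2) by (simp add: sq_swap)
      then show ?thesis
        using inv_count_ascent[OF True] inv_count_ascent[OF step.hyps(1)] by (metis Suc_less_eq act_adj_adj)
    next
      case False
      then have "\<gamma> \<in> keys g"
        using \<gamma>(1) top[OF \<gamma>(2)] k by (simp add: in_keys_iff ascent_def)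
      then have "inv_count \<gamma> \<le> inv_count (swap k \<beta>)"
        using g(3) \<gamma>(2) by fastforce
      then show ?thesis using inv_count_ascent[OF step.hyps(1)] by simp
    qed
    moreover have "lookup (pi_op k g) \<beta> = 1"
      using top[of \<beta>] step.hyps(1) g(2) by (simp add: ascent_def)
    moreover have "keys (pi_op k g) \<subseteq> {\<gamma>. sq \<gamma> \<le> sq \<beta>}"
      by (rule keys_pi_op_subset[OF string_closed_ball g(1) k])
    ultimately show ?case by (simp add: P_def)
  qed
  then show "keys (key_poly \<alpha>) \<subseteq> {\<beta>. sq \<beta> \<le> sq \<alpha>}"
    "lookup (key_poly \<alpha>) \<alpha> = 1"
    "\<beta> \<in> keys (key_poly \<alpha>) \<Longrightarrow> sq \<beta> = sq \<alpha> \<Longrightarrow> \<beta> = \<alpha> \<or> inv_count \<beta> < inv_count \<alpha>"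
    using assms by (simp_all add: key_poly_transport P_def)
qed

lemma key_poly_inject:
  assumes "weak_composition \<alpha>" "weak_composition \<beta>" "key_poly \<alpha> = key_poly \<beta>"
  shows "\<alpha> = \<beta>"
proof -
  note A = key_poly_extremal[OF assms(1)] and B = key_poly_extremal[OF assms(2)]
  have \<alpha>: "\<alpha> \<in> keys (key_poly \<beta>)" and \<beta>: "\<beta> \<in> keys (key_poly \<alpha>)"
    using A(2) B(2) assms(3) by (auto simp: in_keys_iff)
  have "sq \<alpha> = sq \<beta>" using A(1) B(1) \<alpha> \<beta> by (force intro: antisym)
  then show ?thesis using A(3)[OF \<beta>] B(3)[OF \<alpha>] by auto
qed

section \<open>Supports below a partition in dominance order\<close>

text \<open>
  For partitions of the same size this is the dominance order. Sums over all finite sets of positions, and not only over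
  initial segments, make the set invariant under permutations, so that together with \<open>\<mu>\<close> it contains the lattice points
  of the permutohedron spanned by \<open>\<mu>\<close>.
\<close>

definition dominated :: "composition \<Rightarrow> composition set" where
  "dominated \<mu> = {\<beta>. \<forall>A. finite A \<longrightarrow>
     (\<Sum>a\<in>A. lookup \<beta> a) \<le> (\<Sum>a=1..card A. lookup \<mu> a)}"

lemma sum_string_pt:
  assumes "finite A"
  shows "(\<Sum>a\<in>A. lookup (string_pt k \<beta> N j) a) =
    (if k \<in> A then j else 0) + (if Suc k \<in> A then N - j else 0) +
    (\<Sum>a\<in>A - {k, Suc k}. lookup \<beta> a)"
proof -
  have "(\<Sum>a\<in>A. lookup (string_pt k \<beta> N j) a) =
      (\<Sum>a\<in>A. (if a = k then j else 0) + (if a = Suc k then N - j else 0) +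
        (if a \<in> - {k, Suc k} then lookup \<beta> a else 0))"
    by (intro sum.cong) (auto simp: lookup_string_pt)
  also have "\<dots> = (if k \<in> A then j else 0) + (if Suc k \<in> A then N - j else 0) +
    (\<Sum>a\<in>A \<inter> - {k, Suc k}. lookup \<beta> a)"
    using assms by (simp add: sum.distrib sum.delta sum.inter_restrict del: Compl_insert)
  finally show ?thesis by (simp add: Diff_eq)
qed

lemma sum_lookup_split:
  fixes \<beta> :: composition
  assumes "finite A"
  shows "(\<Sum>a\<in>A. lookup \<beta> a) =
    (if k \<in> A then lookup \<beta> k else 0) + (if Suc k \<in> A then lookup \<beta> (Suc k) else 0) +
    (\<Sum>a\<in>A - {k, Suc k}. lookup \<beta> a)"
proof -
  let ?N = "lookup \<beta> k + lookup \<beta> (Suc k)"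
  show ?thesis
    using sum_string_pt[OF assms, of k \<beta> ?N "lookup \<beta> k"] by (simp add: string_pt_self)
qed

lemma string_closed_dominated: "string_closed (dominated \<mu>)"
  unfolding string_closed_def
proof (intro ballI allI impI)
  fix \<beta> k j
  assume \<beta>: "\<beta> \<in> dominated \<mu>" and j: "min (lookup \<beta> k) (lookup \<beta> (Suc k)) \<le> j \<and>
    j \<le> max (lookup \<beta> k) (lookup \<beta> (Suc k))"
  define N where "N = lookup \<beta> k + lookup \<beta> (Suc k)"
  have "(\<Sum>a\<in>A. lookup (string_pt k \<beta> N j) a) \<le> (\<Sum>a=1..card A. lookup \<mu> a)"
    if A: "finite A" for A
  proof -
    have bound: "(\<Sum>a\<in>B. lookup \<beta> a) \<le> (\<Sum>a=1..card A. lookup \<mu> a)"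
      if "finite B" "card B = card A" for B
      using \<beta> that unfolding dominated_def by fastforce
    \<comment> \<open>If A contains exactly one of k and k + 1, then the sum over A is at most the larger of the sums of
       the original exponents over A and over its image under the transposition.\<close>
    consider "k \<in> A \<longleftrightarrow> Suc k \<in> A" | "k \<in> A" "Suc k \<notin> A" | "k \<notin> A" "Suc k \<in> A" by blast
    then show ?thesis
    proof cases
      case 1
      have "j \<le> N" using j by (auto simp: N_def)
      then have "(\<Sum>a\<in>A. lookup (string_pt k \<beta> N j) a) = (\<Sum>a\<in>A. lookup \<beta> a)"
        using 1 sum_string_pt[OF A, of k \<beta> N j] sum_lookup_split[OF A, of \<beta> k] by (simp add: N_def)
      then show ?thesis using bound[OF A] by simp
    next
      case 2
      define B where "B = insert (Suc k) (A - {k})"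
      have B: "finite B" "card B = card A" "B - {k, Suc k} = A - {k, Suc k}" "k \<notin> B" "Suc k \<in> B"
        using 2 A card_Suc_Diff1[of A k] by (auto simp: B_def)
      have "(\<Sum>a\<in>B. lookup \<beta> a) =
          lookup \<beta> (Suc k) + (\<Sum>a\<in>A - {k, Suc k}. lookup \<beta> a)"
        using sum_lookup_split[OF B(1), of \<beta> k] B(3-5) by simp
      moreover have "(\<Sum>a\<in>A. lookup \<beta> a) =
          lookup \<beta> k + (\<Sum>a\<in>A - {k, Suc k}. lookup \<beta> a)"
        using sum_lookup_split[OF A, of \<beta> k] 2 by simp
      moreover have "(\<Sum>a\<in>A. lookup (string_pt k \<beta> N j) a) =
          j + (\<Sum>a\<in>A - {k, Suc k}. lookup \<beta> a)"
        using sum_string_pt[OF A, of k \<beta> N j] 2 by simp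
      ultimately show ?thesis
        using bound[OF A refl] bound[OF B(1,2)] j by linarith
    next
      case 3
      define B where "B = insert k (A - {Suc k})"
      have B: "finite B" "card B = card A" "B - {k, Suc k} = A - {k, Suc k}" "k \<in> B" "Suc k \<notin> B"
        using 3 A card_Suc_Diff1[of A "Suc k"] by (auto simp: B_def)
      have "(\<Sum>a\<in>B. lookup \<beta> a) =
          lookup \<beta> k + (\<Sum>a\<in>A - {k, Suc k}. lookup \<beta> a)"
        using sum_lookup_split[OF B(1), of \<beta> k] B(3-5) by simp
      moreover have "(\<Sum>a\<in>A. lookup \<beta> a) =
          lookup \<beta> (Suc k) + (\<Sum>a\<in>A - {k, Suc k}. lookup \<beta> a)"
        using sum_lookup_split[OF A, of \<beta> k] 3 by simp
      moreover have "(\<Sum>a\<in>A. lookup (string_pt k \<beta> N j) a) =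
          N - j + (\<Sum>a\<in>A - {k, Suc k}. lookup \<beta> a)"
        using sum_string_pt[OF A, of k \<beta> N j] 3 by simp
      moreover have "N - j \<le> lookup \<beta> k \<or> N - j \<le> lookup \<beta> (Suc k)"
        using j unfolding N_def by linarith
      ultimately show ?thesis
        using bound[OF A refl] bound[OF B(1,2)] by linarith
    qed
  qed
  then show "string_pt k \<beta> (lookup \<beta> k + lookup \<beta> (Suc k)) j \<in> dominated \<mu>"
    by (simp add: dominated_def N_def)
qed

text \<open>
  If the first \<open>k\<close> entries of \<open>\<beta>\<close> already have the largest sum that is allowed, then \<open>\<beta>\<close> is an end of the dominated
  part of its string: a point farther out has a larger sum on \<open>{1..k}\<close> or on \<open>{1..k-1} \<union> {k+1}\<close>.
\<close>

lemma tight_prefix_outside: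
  assumes tight: "(\<Sum>a=1..k. lookup \<beta> a) = (\<Sum>a=1..k. lookup \<mu> a)"
    and k: "1 \<le> k" and "lookup \<beta> (Suc k) \<le> lookup \<beta> k"
    and i: "i \<le> lookup \<beta> k + lookup \<beta> (Suc k)"
      "i < lookup \<beta> (Suc k) \<or> lookup \<beta> k < i"
  shows "string_pt k \<beta> (lookup \<beta> k + lookup \<beta> (Suc k)) i \<notin> dominated \<mu>"
proof
  define N where "N = lookup \<beta> k + lookup \<beta> (Suc k)"
  assume "string_pt k \<beta> (lookup \<beta> k + lookup \<beta> (Suc k)) i \<in> dominated \<mu>"
  then have bound: "(\<Sum>a\<in>A. lookup (string_pt k \<beta> N i) a) \<le> (\<Sum>a=1..k. lookup \<mu> a)"
    if "finite A" "card A = k" for A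
    using that unfolding dominated_def N_def by fastforce
  define C where "C = {1..k} - {k, Suc k}"
  have split: "(\<Sum>a=1..k. lookup \<beta> a) = lookup \<beta> k + (\<Sum>a\<in>C. lookup \<beta> a)"
    using sum_lookup_split[of "{1..k}" \<beta> k] k by (simp add: C_def)
  show False
  proof (cases "lookup \<beta> k < i")
    case True
    then show False
      using bound[of "{1..k}"] sum_string_pt[of "{1..k}" k \<beta> N i] k tight split by (simp add: C_def)
  next
    case False
    then have "lookup \<beta> k < N - i" using i by (auto simp: N_def)
    moreover define A where "A = insert (Suc k) {1..<k}"
    then have A: "finite A" "card A = k" "A - {k, Suc k} = C" "k \<notin> A" "Suc k \<in> A"
      using k by (auto simp: C_def)
    ultimately show False
      using bound[OF A(1,2)] sum_string_pt[OF A(1), of k \<beta> N i] A(3-5) tight split by simp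
  qed
qed

lemma lookup_pi_op_tight:
  assumes "keys f \<subseteq> dominated \<mu>"
    and "(\<Sum>a=1..k. lookup \<beta> a) = (\<Sum>a=1..k. lookup \<mu> a)"
    and "1 \<le> k" and le: "lookup \<beta> (Suc k) \<le> lookup \<beta> k"
  shows "lookup (pi_op k f) \<beta> = lookup f \<beta>"
proof -
  have "lookup (pi_op k f) \<beta> =
    lookup f (if lookup \<beta> k < lookup \<beta> (Suc k) then swap k \<beta> else \<beta>)"
  proof (rule lookup_pi_op_extremal)
    fix i
    assume "i \<le> lookup \<beta> k + lookup \<beta> (Suc k)"
      "i < min (lookup \<beta> k) (lookup \<beta> (Suc k)) \<or>
        max (lookup \<beta> k) (lookup \<beta> (Suc k)) < i"
    then have "string_pt k \<beta> (lookup \<beta> k + lookup \<beta> (Suc k)) i \<notin> dominated \<mu>"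
      using le by (intro tight_prefix_outside[OF assms(2,3,4)]) (simp_all add: min_absorb2 max_absorb1)
    then show "lookup f (string_pt k \<beta> (lookup \<beta> k + lookup \<beta> (Suc k)) i) = 0"
      using assms(1) by (auto simp: in_keys_iff)
  qed
  then show ?thesis using le by simp
qed

lemma lookup_transport_partition:
  assumes "weak_composition \<alpha>" "is_partition \<mu>" "keys f \<subseteq> dominated \<mu>"
  shows "lookup (transport f \<alpha>) \<mu> = lookup f \<mu>"
proof -
  have "keys (transport f \<alpha>) \<subseteq> dominated \<mu> \<and>
    lookup (transport f \<alpha>) \<mu> = lookup f \<mu>"
    using assms(1)
  proof (induction rule: transport_induct)
    case (step \<beta> g k)
    then have k: "1 \<le> k" by (simp add: ascent_def)
    then show ?case
      using step lookup_pi_op_tight[of g \<mu> \<mu> k] keys_pi_op_subset[OF string_closed_dominated, of g \<mu> k] assms(2)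
      by (simp add: is_partition_def)
  qed (simp add: assms(3))
  then show ?thesis by simp
qed

text \<open>
  For \<open>\<mu>\<^sub>i \<ge> 1\<close> this is \<open>\<mu> - e\<^sub>i + e\<^bsub>i+1\<^esub>\<close>.
\<close>

definition lower :: "nat \<Rightarrow> composition \<Rightarrow> composition" where
  "lower i \<mu> = string_pt i \<mu> (lookup \<mu> i + lookup \<mu> (Suc i)) (lookup \<mu> i - 1)"

lemma lower_swap_distinct:
  assumes "lookup \<mu> (Suc i) + 2 \<le> lookup \<mu> i"
  shows "lower i \<mu> \<noteq> \<mu>" "swap i \<mu> \<noteq> \<mu>" "swap i \<mu> \<noteq> lower i \<mu>"
proof -
  have "lookup (lower i \<mu>) i = lookup \<mu> i - 1" "lookup (swap i \<mu>) i = lookup \<mu> (Suc i)"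
    by (simp_all add: lower_def lookup_string_pt)
  with assms have "lookup (lower i \<mu>) i \<noteq> lookup \<mu> i" "lookup (swap i \<mu>) i \<noteq> lookup \<mu> i"
    "lookup (swap i \<mu>) i \<noteq> lookup (lower i \<mu>) i"
    by linarith+
  then show "lower i \<mu> \<noteq> \<mu>" "swap i \<mu> \<noteq> \<mu>" "swap i \<mu> \<noteq> lower i \<mu>"
    by metis+
qed

text \<open>
  For \<open>k \<noteq> i\<close> both exponents are upper ends of the dominated part of their \<open>k\<close>-strings, and \<open>\<pi>\<^sub>k\<close> keeps
  both coefficients. They lie on the \<open>i\<close>-string from \<open>\<mu>\<close> to \<open>s\<^sub>i \<mu>\<close>. There \<open>\<pi>\<^sub>i\<close> replaces the coefficient \<open>b\<close> of \<open>s\<^sub>i \<mu>\<close> by the coefficient \<open>a\<close> of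
  \<open>\<mu>\<close>, and it adds \<open>a - b\<close> to the coefficient next to \<open>\<mu>\<close>; the difference is the same as before.
\<close>

lemma transport_string_invariant:
  assumes \<alpha>: "weak_composition \<alpha>" and \<mu>: "is_partition \<mu>" and f: "keys f \<subseteq> dominated \<mu>"
    and i: "1 \<le> i" and gap: "lookup \<mu> (Suc i) + 2 \<le> lookup \<mu> i"
  shows "lookup (transport f \<alpha>) (lower i \<mu>) - lookup (transport f \<alpha>) (swap i \<mu>) =
    lookup f (lower i \<mu>) - lookup f (swap i \<mu>)"
proof -
  define p q where "p = lookup \<mu> i" and "q = lookup \<mu> (Suc i)"
  have pq: "q + 2 \<le> p" using gap by (simp add: p_def q_def)
  have dec: "lookup \<mu> (Suc k) \<le> lookup \<mu> k" if "1 \<le> k" for k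
    using \<mu> that by (simp add: is_partition_def)
  have lw: "lookup (lower i \<mu>) a = (if a = i then p - 1 else if a = Suc i then q + 1 else lookup \<mu> a)" for a
    using pq by (simp add: lower_def lookup_string_pt p_def q_def)
  have sw: "lookup (swap i \<mu>) a = (if a = i then q else if a = Suc i then p else lookup \<mu> a)" for a
    by (simp add: adj_trans_cases p_def q_def)
  have tight: "(\<Sum>a=1..k. lookup \<beta> a) = (\<Sum>a=1..k. lookup \<mu> a)"
    if "k \<noteq> i" and \<beta>: "\<beta> = lower i \<mu> \<or> \<beta> = swap i \<mu>" for k \<beta>
  proof -
    have "lower i \<mu> = string_pt i \<mu> (p + q) (p - 1)" "swap i \<mu> = string_pt i \<mu> (p + q) q"
      using string_pt_self(2)[of "p + q" \<mu> i] by (simp_all add: lower_def p_def q_def)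
    moreover have "p - 1 \<le> p + q" "q \<le> p + q" by simp_all
    ultimately obtain x where x: "x \<le> p + q" "\<beta> = string_pt i \<mu> (p + q) x"
      using \<beta> by metis
    show ?thesis
      unfolding x(2) sum_string_pt[OF finite_atLeastAtMost] sum_lookup_split[OF finite_atLeastAtMost, where \<beta> = \<mu> and k = i]
      using x(1) that(1) i by (auto simp: p_def q_def)
  qed
  have "keys (transport f \<alpha>) \<subseteq> dominated \<mu> \<and>
    lookup (transport f \<alpha>) (lower i \<mu>) - lookup (transport f \<alpha>) (swap i \<mu>) =
    lookup f (lower i \<mu>) - lookup f (swap i \<mu>)"
    using \<alpha>
  proof (induction rule: transport_induct)
    case (step \<beta> g k)
    then have k: "1 \<le> k" by (simp add: ascent_def)
    have g: "keys g \<subseteq> dominated \<mu>" using step by simp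
    have "lookup (pi_op k g) (lower i \<mu>) - lookup (pi_op k g) (swap i \<mu>) =
      lookup g (lower i \<mu>) - lookup g (swap i \<mu>)"
    proof (cases "k = i")
      case False
      have "lookup (pi_op k g) (lower i \<mu>) = lookup g (lower i \<mu>)"
      proof (rule lookup_pi_op_tight[OF g tight[OF False] k])
        show "lookup (lower i \<mu>) (Suc k) \<le> lookup (lower i \<mu>) k"
          using False dec[OF k] dec[of "Suc i"] pq unfolding lw by (auto simp: p_def q_def)
      qed simp
      moreover have "lookup (pi_op k g) (swap i \<mu>) = lookup g (swap i \<mu>)"
      proof (rule lookup_pi_op_tight[OF g tight[OF False] k])
        show "lookup (swap i \<mu>) (Suc k) \<le> lookup (swap i \<mu>) k"
          using False dec[OF k] dec[of "Suc i"] dec[OF i] pq unfolding sw by (auto simp: p_def q_def)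
      qed simp
      ultimately show ?thesis by simp
    next
      case True
      define c where "c = (\<lambda>j. lookup g (string_pt i \<mu> (p + q) j))"
      have 0: "c j = 0" if "j \<le> p + q" "j < q \<or> p < j" for j
        using tight_prefix_outside[OF refl i dec[OF i], of j] that g
        by (auto simp: c_def p_def q_def in_keys_iff)
      have pt: "string_pt i \<mu> (p + q) p = \<mu>" "string_pt i \<mu> (p + q) q = swap i \<mu>" "string_pt i \<mu> (p + q) (p - 1) = lower i \<mu>"
        using string_pt_self[of "p + q" \<mu> i] by (simp_all add: p_def q_def lower_def)
      have s: "string_pt i (lower i \<mu>) (p + q) j = string_pt i \<mu> (p + q) j"
        "string_pt i (swap i \<mu>) (p + q) j = string_pt i \<mu> (p + q) j" for j
        by (intro poly_mapping_eqI; simp add: lookup_string_pt lw sw del: lookup_act_adj)+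
      have ends: "lookup (lower i \<mu>) i = p - 1" "lookup (lower i \<mu>) (Suc i) = q + 1"
        "lookup (swap i \<mu>) i = q" "lookup (swap i \<mu>) (Suc i) = p"
        unfolding lw sw by simp_all
      have N: "p - 1 + (q + 1) = p + q" "q + p = p + q" using pq by simp_all
      have "lookup (pi_op i g) (lower i \<mu>) = (\<Sum>j=max (p - 1) (q + 1)..p + q. c j) - (\<Sum>j<min (p - 1) (q + 1). c j)"
        using lookup_pi_op[of i g "lower i \<mu>"] unfolding ends N s c_def .
      also have "max (p - 1) (q + 1) = p - 1" using pq by simp
      also have "min (p - 1) (q + 1) = q + 1" using pq by simp
      also have "(\<Sum>j=p - 1..p + q. c j) = (\<Sum>j\<in>{p - 1, p}. c j)"
      proof (intro sum.mono_neutral_right ballI)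
        fix j assume "j \<in> {p - 1..p + q} - {p - 1, p}"
        then have "p < j" "j \<le> p + q" by auto
        then show "c j = 0" using 0 by blast
      qed (use pq in auto)
      also have "(\<Sum>j<q + 1. c j) = (\<Sum>j\<in>{q}. c j)"
        using 0 pq by (intro sum.mono_neutral_right) auto
      finally have A: "lookup (pi_op i g) (lower i \<mu>) = c (p - 1) + c p - c q"
        using pq by simp
      have "lookup (pi_op i g) (swap i \<mu>) = (\<Sum>j=max q p..p + q. c j) - (\<Sum>j<min q p. c j)"
        using lookup_pi_op[of i g "swap i \<mu>"] unfolding ends N s c_def .
      also have "max q p = p" using pq by simp
      also have "min q p = q" using pq by simp
      also have "(\<Sum>j=p..p + q. c j) = (\<Sum>j\<in>{p}. c j)"
        using 0 pq by (intro sum.mono_neutral_right) auto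
      also have "(\<Sum>j<q. c j) = 0"
        using 0 pq by (intro sum.neutral) auto
      finally have B: "lookup (pi_op i g) (swap i \<mu>) = c p" by simp
      show ?thesis
        unfolding True A B c_def pt by simp
    qed
    then show ?case
      using step keys_pi_op_subset[OF string_closed_dominated, of g \<mu> k] k by simp
  qed (simp add: f)
  then show ?thesis by simp
qed

text \<open>
  The largest element of a set of \<open>n\<close> positive integers is at least \<open>n\<close>, so that replacing it by \<open>n\<close> does not
  decrease the sum of the entries in these positions.
\<close>

lemma partition_dominated_self:
  assumes "is_partition \<mu>"
  shows "\<mu> \<in> dominated \<mu>"
proof -
  have pos: "(\<Sum>a\<in>B. lookup \<mu> a) \<le> (\<Sum>a=1..n. lookup \<mu> a)"
    if "finite B" "B \<subseteq> {1..}" "card B = n" for B n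
    using that
  proof (induction n arbitrary: B)
    case (Suc n)
    define m where "m = Max B"
    have m: "m \<in> B" "B \<subseteq> {1..m}"
      using Suc.prems by (auto simp: m_def intro!: Max_in)
    have "Suc n \<le> m" using card_mono[OF _ m(2)] Suc.prems by simp
    then have "lookup \<mu> m \<le> lookup \<mu> (Suc n)"
      using assms by (simp add: is_partition_def)
    moreover have "(\<Sum>a\<in>B - {m}. lookup \<mu> a) \<le> (\<Sum>a=1..n. lookup \<mu> a)"
      using Suc.prems m(1) by (intro Suc.IH) auto
    ultimately show ?case
      using Suc.prems(1) m(1) by (simp add: sum.remove)
  qed auto
  have "(\<Sum>a\<in>A. lookup \<mu> a) \<le> (\<Sum>a=1..card A. lookup \<mu> a)" if A: "finite A" for A
  proof -
    have "(\<Sum>a\<in>A. lookup \<mu> a) = (\<Sum>a\<in>A - {0}. lookup \<mu> a)"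
      using assms A by (intro sum.mono_neutral_right) (auto simp: is_partition_def weak_composition_def)
    also have "\<dots> \<le> (\<Sum>a=1..card (A - {0}). lookup \<mu> a)"
      using A by (intro pos) auto
    also have "\<dots> \<le> (\<Sum>a=1..card A. lookup \<mu> a)"
      using A by (intro sum_mono2) (auto intro: order_trans[OF _ card_mono])
    finally show ?thesis .
  qed
  then show ?thesis by (simp add: dominated_def)
qed

lemma dominated_antisym:
  assumes "is_partition \<mu>" "is_partition \<nu>" "\<mu> \<in> dominated \<nu>" "\<nu> \<in> dominated \<mu>"
  shows "\<mu> = \<nu>"
proof -
  have S: "(\<Sum>a=1..r. lookup \<mu> a) = (\<Sum>a=1..r. lookup \<nu> a)" for r
  proof (rule antisym)
    show "(\<Sum>a=1..r. lookup \<mu> a) \<le> (\<Sum>a=1..r. lookup \<nu> a)"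
      using assms(3) unfolding dominated_def by (auto dest!: spec[of _ "{1..r}"])
    show "(\<Sum>a=1..r. lookup \<nu> a) \<le> (\<Sum>a=1..r. lookup \<mu> a)"
      using assms(4) unfolding dominated_def by (auto dest!: spec[of _ "{1..r}"])
  qed
  show ?thesis
  proof (rule poly_mapping_eqI)
    fix a
    show "lookup \<mu> a = lookup \<nu> a"
    proof (cases a)
      case 0
      then show ?thesis using assms(1,2) by (simp add: is_partition_def weak_composition_def)
    next
      case (Suc n)
      then show ?thesis using S[of n] S[of "Suc n"] by simp
    qed
  qed
qed

section \<open>Halves of symmetric partitions and shifted products\<close>

lemma finite_diagram: "finite (diagram \<mu>)"
proof (rule finite_subset)
  show "diagram \<mu> \<subseteq> (\<Union>i\<in>keys \<mu>. {i} \<times> {1..lookup \<mu> i})"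
    by (auto simp: diagram_def in_keys_iff)
qed auto

lemma strict_partition_unique:
  assumes \<mu>: "strict_partition \<mu>" and \<nu>: "strict_partition \<nu>"
    and eq: "lookup \<mu> ` keys \<mu> = lookup \<nu> ` keys \<nu>"
  shows "\<mu> = \<nu>"
proof (rule poly_mapping_eqI)
  have le: "lookup \<mu> i \<le> lookup \<nu> i"
    if \<mu>: "strict_partition \<mu>" and \<nu>: "strict_partition \<nu>"
    and eq: "lookup \<mu> ` keys \<mu> = lookup \<nu> ` keys \<nu>"
    and "1 \<le> i" and same: "\<And>j. 1 \<le> j \<Longrightarrow> j < i \<Longrightarrow> lookup \<mu> j = lookup \<nu> j"
    for \<mu> \<nu> i
  proof (rule ccontr)
    assume "\<not> lookup \<mu> i \<le> lookup \<nu> i"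
    then have gt: "lookup \<nu> i < lookup \<mu> i" by simp
    then have i: "i \<in> keys \<mu>" by (simp add: in_keys_iff)
    then obtain j where j: "j \<in> keys \<nu>" "lookup \<mu> i = lookup \<nu> j"
      using eq by (metis imageE imageI)
    have "j \<noteq> 0"
      using j(1) \<nu> by (metis in_keys_iff is_partition_def strict_partition_def weak_composition_def)
    show False
    proof (cases "j < i")
      case True
      then have "lookup \<mu> j = lookup \<mu> i" using same j \<open>j \<noteq> 0\<close> by simp
      moreover have "j \<in> keys \<mu>" using calculation i by (simp add: in_keys_iff)
      ultimately have "j = i" using \<mu> i by (meson inj_onD strict_partition_def)
      then show False using True by simp
    next
      case False
      then have "lookup \<nu> j \<le> lookup \<nu> i"
        using \<nu> \<open>1 \<le> i\<close> by (simp add: strict_partition_def is_partition_def)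
      then show False using gt j by simp
    qed
  qed
  fix i
  show "lookup \<mu> i = lookup \<nu> i"
  proof (induction i rule: less_induct)
    case (less i)
    show ?case
    proof (cases "i = 0")
      case True
      then show ?thesis using \<mu> \<nu> by (simp add: strict_partition_def is_partition_def weak_composition_def)
    next
      case False
      then show ?thesis
        using le[OF \<mu> \<nu> eq, of i] le[OF \<nu> \<mu> eq[symmetric], of i] less by (simp add: le_antisym)
    qed
  qed
qed

text \<open>
  The numbers \<open>\<tau>\<^sub>i - (i - 1)\<close> strictly decrease as long as they are positive, so they are the rows of the half in
  their order.
\<close>

lemma half_le_partition:
  assumes "is_partition \<tau>"
  shows "strict_partition (half_le \<tau>)"
    "lookup (half_le \<tau>) i = (if i = 0 then 0 else lookup \<tau> i - (i - 1))"
proof -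
  define h where "h = (\<lambda>i. if i = 0 then 0 else lookup \<tau> i - (i - 1))"
  define \<nu> where "\<nu> = Abs_poly_mapping h"
  have "finite {i. h i \<noteq> 0}"
    by (rule finite_subset[of _ "keys \<tau>"]) (auto simp: h_def in_keys_iff split: if_splits)
  then have \<nu>: "lookup \<nu> = h" by (simp add: \<nu>_def)
  have dec: "lookup \<tau> j \<le> lookup \<tau> i" if "1 \<le> i" "i \<le> j" for i j
    using assms that by (simp add: is_partition_def)
  have less: "h j < h i" if "1 \<le> i" "i < j" "h j \<noteq> 0" for i j
    using that dec[of i j] by (auto simp: h_def)
  have part: "is_partition \<nu>"
    unfolding is_partition_def weak_composition_def \<nu>
  proof (intro conjI allI impI)
    fix i j :: nat assume "1 \<le> i \<and> i \<le> j"
    then show "h j \<le> h i" using less[of i j] by (cases "i = j"; cases "h j = 0") auto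
  qed (simp add: h_def)
  have "inj_on (lookup \<nu>) (keys \<nu>)"
  proof (rule inj_onI)
    fix i j assume "i \<in> keys \<nu>" "j \<in> keys \<nu>" "lookup \<nu> i = lookup \<nu> j"
    then have nz: "h i \<noteq> 0" "h j \<noteq> 0" and eq: "h i = h j" by (simp_all add: in_keys_iff \<nu>)
    then have "1 \<le> i" "1 \<le> j" by (auto simp: h_def split: if_splits)
    then show "i = j"
      using less[of i j] less[of j i] nz eq by (cases i j rule: linorder_cases) auto
  qed
  with part have strict: "strict_partition \<nu>" by (simp add: strict_partition_def)
  have "lookup \<nu> ` keys \<nu> = {lookup \<tau> i - (i - 1) | i. 1 \<le> i} \<inter> {1..}"
    (is "_ = ?R")
  proof (intro set_eqI iffI)
    fix v assume "v \<in> lookup \<nu> ` keys \<nu>"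
    then obtain i where i: "h i \<noteq> 0" "v = h i" by (auto simp: in_keys_iff \<nu>)
    then have "1 \<le> i" "v = lookup \<tau> i - (i - 1)" "1 \<le> v" by (auto simp: h_def split: if_splits)
    then show "v \<in> ?R" by blast
  next
    fix v assume "v \<in> ?R"
    then obtain i where i: "1 \<le> i" "v = lookup \<tau> i - (i - 1)" "1 \<le> v" by auto
    then have "h i = v" by (simp add: h_def)
    then show "v \<in> lookup \<nu> ` keys \<nu>"
      using i(3) by (intro image_eqI[of _ _ i]) (auto simp: in_keys_iff \<nu>)
  qed
  note ran = this
  have "half_le \<tau> = \<nu>"
    unfolding half_le_def
  proof (rule the_equality)
    fix \<rho> assume \<rho>: "strict_partition \<rho> \<and> lookup \<rho> ` keys \<rho> = ?R"
    have "lookup \<rho> ` keys \<rho> = lookup \<nu> ` keys \<nu>"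
      unfolding ran by (rule conjunct2[OF \<rho>])
    then show "\<rho> = \<nu>" by (rule strict_partition_unique[OF conjunct1[OF \<rho>] strict])
  qed (rule conjI[OF strict ran])
  then show "strict_partition (half_le \<tau>)"
    "lookup (half_le \<tau>) i = (if i = 0 then 0 else lookup \<tau> i - (i - 1))"
    using strict by (simp_all add: \<nu> h_def)
qed

lemma strict_partition_shift:
  assumes \<mu>: "strict_partition \<mu>" and "1 \<le> i" "i \<le> j" "0 < lookup \<mu> j"
  shows "j + lookup \<mu> j \<le> i + lookup \<mu> i"
  using assms(3,4)
proof (induction j rule: dec_induct)
  case (step m)
  have "lookup \<mu> (Suc m) \<le> lookup \<mu> m"
    using \<mu> \<open>1 \<le> i\<close> step.hyps by (simp add: strict_partition_def is_partition_def)
  moreover have "lookup \<mu> (Suc m) \<noteq> lookup \<mu> m"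
  proof
    assume "lookup \<mu> (Suc m) = lookup \<mu> m"
    moreover have "Suc m \<in> keys \<mu>" "m \<in> keys \<mu>"
      using step.prems calculation by (auto simp: in_keys_iff)
    ultimately have "Suc m = m" using \<mu> by (meson inj_onD strict_partition_def)
    then show False by simp
  qed
  ultimately have "Suc m + lookup \<mu> (Suc m) \<le> m + lookup \<mu> m" "0 < lookup \<mu> m"
    using step.prems by auto
  then show ?case using step.IH by linarith
qed simp

text \<open>
  A box in the first column would contribute \<open>x\<^sub>i + x\<^sub>i\<close>. Its factor 2 is dropped here, and these factors together
  make up the power of two in \<open>prod_diagram_eq_scale\<close>.
\<close>

definition box_factor :: "nat \<times> nat \<Rightarrow> polynomial" where
  "box_factor = (\<lambda>(i, j). if j = 1 then x_var i else x_var i + x_var (i + j - 1))"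

definition shifted_product :: "composition \<Rightarrow> polynomial" where
  "shifted_product \<mu> = (\<Prod>p\<in>diagram \<mu>. box_factor p)"

lemma transport_scale:
  assumes "weak_composition \<alpha>"
  shows "transport (scale c f) \<alpha> = scale c (transport f \<alpha>)"
proof (induction "inv_count \<alpha>" arbitrary: \<alpha> rule: less_induct)
  case less
  show ?case
  proof (cases "\<exists>k. ascent \<alpha> k")
    case True
    then obtain k where k: "ascent \<alpha> k" by blast
    have "act_poly (adj_trans k) (single 0 c) = single 0 c"
      by (simp add: act_poly_single)
    then show ?thesis
      using less[of "swap k \<alpha>"] inv_count_ascent[OF k]
      by (simp add: transport_ascent[OF k] scale_def pi_op_mult_symmetric)
  next
    case False
    then have "transport g \<alpha> = g" for g by (subst transport.simps) auto
    then show ?thesis by simp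
  qed
qed

lemma scale_scale: "scale a (scale b f) = scale (a * b) f"
  by (simp add: scale_def mult_single flip: mult.assoc)

lemma scale_one: "scale 1 f = f"
  by (simp add: scale_def)

lemma prod_diagram_eq_scale:
  "(\<Prod>(i, j)\<in>diagram \<mu>. x_var i + x_var (i + j - 1)) = scale (2 ^ card (keys \<mu> - {0})) (shifted_product \<mu>)"
proof -
  define c :: "nat \<times> nat \<Rightarrow> polynomial" where "c = (\<lambda>(i, j). if j = 1 then single 0 2 else 1)"
  have two: "x + x = single 0 2 * x" for x :: polynomial
  proof -
    have "single 0 (2 :: rat) = (2 :: polynomial)" by simp
    then show ?thesis by (simp only: mult_2)
  qed
  have "(\<Prod>(i, j)\<in>diagram \<mu>. x_var i + x_var (i + j - 1)) = (\<Prod>p\<in>diagram \<mu>. c p * box_factor p)"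
    by (intro prod.cong) (auto simp: c_def box_factor_def two)
  also have "\<dots> = (\<Prod>p\<in>diagram \<mu>. c p) * shifted_product \<mu>"
    by (simp add: prod.distrib shifted_product_def)
  also have "(\<Prod>p\<in>diagram \<mu>. c p) = (\<Prod>p\<in>(\<lambda>i. (i, 1)) ` (keys \<mu> - {0}). c p)"
    by (intro prod.mono_neutral_right finite_diagram) (auto simp: c_def diagram_def in_keys_iff)
  also have "\<dots> = (\<Prod>i\<in>keys \<mu> - {0}. single 0 2)"
    by (subst prod.reindex) (auto simp: c_def inj_on_def)
  also have "\<dots> = single 0 (2 ^ card (keys \<mu> - {0}))"
  proof -
    have "single 0 (2 :: rat) ^ m = (single 0 (2 ^ m) :: polynomial)" for m
      by (induction m) (auto simp: mult_single simp flip: single_one simp del: single_numeral)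
    then show ?thesis by (simp only: prod_constant)
  qed
  finally show ?thesis by (simp add: scale_def)
qed

text \<open>
  The diagonal box of row \<open>i\<close> belongs to the diagram if and only if \<open>\<lambda>\<^sub>i \<ge> i\<close>, that is, if row \<open>i\<close> of the half is
  nonempty; relabelling by a permutation keeps diagonal boxes diagonal.
\<close>

lemma diag_eq_card_half:
  assumes "weak_composition \<gamma>"
  shows "diag \<gamma> = card (keys (half_le (sort_comp \<gamma>)) - {0})"
proof -
  define \<tau> u where "\<tau> = sort_comp \<gamma>" and "u = u_perm \<gamma>"
  have inj: "inj u" using u_perm(1)[OF assms] S_inf_bij bij_is_inj by (auto simp: u_def)
  have "{(i, j). (i, j) \<in> sym_diagram \<gamma> \<and> i = j} =
      (\<lambda>i. (u i, u i)) ` {i. 1 \<le> i \<and> i \<le> lookup \<tau> i}"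
    using injD[OF inj] by (fastforce simp: sym_diagram_def diagram_def \<tau>_def u_def)
  moreover have "inj_on (\<lambda>i. (u i, u i)) X" for X
    using inj by (auto simp: inj_on_def)
  moreover have "{i. 1 \<le> i \<and> i \<le> lookup \<tau> i} = keys (half_le \<tau>) - {0}"
    unfolding \<tau>_def in_keys_iff half_le_partition(2)[OF is_partition_sort_comp[OF assms]]
    by (auto simp: in_keys_iff half_le_partition(2)[OF is_partition_sort_comp[OF assms]] split: if_splits)
  ultimately show ?thesis by (simp add: diag_def card_image \<tau>_def)
qed

lemma scaled_Q_key_poly:
  assumes "weak_composition \<gamma>"
  shows "scale (1 / 2 ^ diag \<gamma>) (Q_key_poly \<gamma>) = transport (shifted_product (half_le (sort_comp \<gamma>))) \<gamma>"
  unfolding Q_key_poly_transport[OF assms] prod_diagram_eq_scale transport_scale[OF assms]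
    scale_scale diag_eq_card_half[OF assms] by (simp add: scale_one)

section \<open>Monomials of shifted products\<close>

lemma keys_prod_degree_le:
  fixes f :: "'a \<Rightarrow> polynomial" and w :: "composition \<Rightarrow> nat"
  assumes "finite I" and w: "\<And>\<beta> \<gamma>. w (\<beta> + \<gamma>) = w \<beta> + w \<gamma>" and "w 0 = 0"
    and "\<And>p \<beta>. p \<in> I \<Longrightarrow> \<beta> \<in> keys (f p) \<Longrightarrow> w \<beta> \<le> d p"
    and "\<beta> \<in> keys (\<Prod>p\<in>I. f p)"
  shows "w \<beta> \<le> (\<Sum>p\<in>I. d p)"
  using assms(1,4,5)
proof (induction I arbitrary: \<beta> rule: finite_induct)
  case empty
  then show ?case using \<open>w 0 = 0\<close> by simp
next
  case (insert p I)
  then have "\<beta> \<in> keys (f p * (\<Prod>p\<in>I. f p))" by simp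
  then obtain \<delta> \<epsilon> where "\<beta> = \<delta> + \<epsilon>" "\<delta> \<in> keys (f p)" "\<epsilon> \<in> keys (\<Prod>p\<in>I. f p)"
    using keys_mult by blast
  then show ?case using insert by (simp add: w add_mono)
qed

text \<open>
  Below the \<open>m\<close>-th element of the complement there are only elements of \<open>A\<close> and the \<open>m\<close> earlier elements.
\<close>

lemma enumerate_complement_le:
  fixes A :: "nat set"
  assumes "finite A"
  shows "Infinite_Set.enumerate (- A) m \<le> m + card A"
proof -
  have inf: "infinite (- A)" using assms by simp
  have "{..<Infinite_Set.enumerate (- A) m} \<subseteq> A \<union> Infinite_Set.enumerate (- A) ` {..<m}"
  proof
    fix b assume b: "b \<in> {..<Infinite_Set.enumerate (- A) m}"
    show "b \<in> A \<union> Infinite_Set.enumerate (- A) ` {..<m}"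
    proof (cases "b \<in> A")
      case False
      then obtain m' where "Infinite_Set.enumerate (- A) m' = b" using enumerate_Ex[of "- A" b] inf by auto
      then show ?thesis using b inf by (auto simp: strict_mono_less[OF strict_mono_enumerate[OF inf]])
    qed simp
  qed
  then have "card {..<Infinite_Set.enumerate (- A) m} \<le> card (A \<union> Infinite_Set.enumerate (- A) ` {..<m})"
    using assms by (intro card_mono) auto
  also have "\<dots> \<le> card A + card (Infinite_Set.enumerate (- A) ` {..<m})" by (rule card_Un_le)
  also have "\<dots> \<le> card A + m" using card_image_le[of "{..<m}" "Infinite_Set.enumerate (- A)"] by simp
  finally show ?thesis by simp
qed

lemma card_boxes_touching_le:
  assumes \<mu>: "strict_partition \<mu>" and A: "finite A"
  shows "card {(i, j) \<in> diagram \<mu>. i \<in> A \<or> i + j - 1 \<in> A} \<le> (\<Sum>a=1..card A. lookup \<mu> a)"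
proof -
  define r e where "r = card A" and "e = Infinite_Set.enumerate (- A)"
  have inf: "infinite (- A)" using A by simp
  have mono: "strict_mono e" unfolding e_def by (rule strict_mono_enumerate[OF inf])
  have e: "e m \<notin> A" "e m \<le> m + r" for m
    using enumerate_in_set[OF inf, of m] enumerate_complement_le[OF A] by (auto simp: e_def r_def)
  define T where "T = {(i, j) \<in> diagram \<mu>. i \<in> A \<or> i + j - 1 \<in> A}"
  define R where "R = {(i, j) \<in> diagram \<mu>. i \<le> r}"
  define F where "F = (\<lambda>(i, j). (e (i - r), e (i + j - 1 - r) - e (i - r) + 1))"
  \<comment> \<open>Listing the complement of A in increasing order embeds the boxes of the shifted diagram below row r into
     the boxes that do not touch A, because the shifted diagram is closed under decreasing coordinates.\<close>
  have F: "F p \<in> diagram \<mu> - T" if "p \<in> diagram \<mu> - R" for p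
  proof -
    obtain i j where p: "p = (i, j)" by force
    have ij: "1 \<le> i" "1 \<le> j" "j \<le> lookup \<mu> i" "r < i"
      using that by (auto simp: p R_def diagram_def)
    define i' k' where "i' = e (i - r)" and "k' = e (i + j - 1 - r)"
    have i': "1 \<le> i'" "i' \<le> i"
      using strict_monoD[OF mono, of 0 "i - r"] e(2)[of "i - r"] ij by (auto simp: i'_def)
    have k': "i' \<le> k'" "k' \<le> i + j - 1"
      using strict_mono_less_eq[OF mono] e(2)[of "i + j - 1 - r"] ij by (auto simp: i'_def k'_def)
    have "i + lookup \<mu> i \<le> i' + lookup \<mu> i'"
      using strict_partition_shift[OF \<mu> i'] ij by simp
    then have "k' - i' + 1 \<le> lookup \<mu> i'" using k' ij by linarith
    moreover have "F p = (i', k' - i' + 1)" by (simp add: F_def p i'_def k'_def)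
    moreover have "i' \<notin> A" "i' + (k' - i' + 1) - 1 \<notin> A"
      using e(1) k'(1) by (auto simp: i'_def k'_def)
    ultimately show ?thesis using i' by (auto simp: T_def diagram_def)
  qed
  have "inj_on F (diagram \<mu> - R)"
  proof (rule inj_onI)
    fix p q assume p: "p \<in> diagram \<mu> - R" and q: "q \<in> diagram \<mu> - R" and eq: "F p = F q"
    obtain i j k l where pq: "p = (i, j)" "q = (k, l)" by force
    have ij: "1 \<le> j" "r < i" "1 \<le> l" "r < k"
      using p q by (auto simp: pq R_def diagram_def)
    have "e (i - r) = e (k - r)" using eq by (simp add: F_def pq)
    then have "i = k" using ij strict_mono_eq[OF mono] by fastforce
    have "e (i - r) \<le> e (i + j - 1 - r)" "e (i - r) \<le> e (i + l - 1 - r)"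
      using ij strict_mono_less_eq[OF mono] by auto
    moreover have "e (i + j - 1 - r) - e (i - r) = e (i + l - 1 - r) - e (i - r)"
      using eq \<open>i = k\<close> by (simp add: F_def pq)
    ultimately have "e (i + j - 1 - r) = e (i + l - 1 - r)" by linarith
    then have "i + j - 1 - r = i + l - 1 - r" using strict_mono_eq[OF mono] by blast
    then show "p = q" using ij \<open>i = k\<close> by (simp add: pq)
  qed
  then have "card (diagram \<mu> - R) \<le> card (diagram \<mu> - T)"
    using F finite_diagram by (intro card_inj_on_le[of F]) auto
  moreover have "R \<subseteq> diagram \<mu>" "T \<subseteq> diagram \<mu>" by (auto simp: R_def T_def)
  moreover have "finite R" "finite T" "card R \<le> card (diagram \<mu>)" "card T \<le> card (diagram \<mu>)"
    using calculation finite_diagram by (auto intro: finite_subset card_mono)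
  ultimately have "card T \<le> card R" by (simp add: card_Diff_subset)
  also have "R = Sigma {1..r} (\<lambda>i. {1..lookup \<mu> i})"
    by (auto simp: R_def diagram_def)
  also have "card \<dots> = (\<Sum>a=1..r. lookup \<mu> a)" by (simp add: card_SigmaI)
  finally show ?thesis by (simp add: T_def r_def)
qed

lemma keys_box_factor:
  "\<beta> \<in> keys (box_factor (i, j)) \<Longrightarrow>
    \<beta> = single i 1 \<or> (j \<noteq> 1 \<and> \<beta> = single (i + j - 1) 1)"
  using keys_add[of "x_var i" "x_var (i + j - 1)"] by (auto simp: box_factor_def split: if_splits)

text \<open>
  A monomial of the product picks one of the two variables of each box, so its exponents in the positions of \<open>A\<close> add up
  to at most the number of boxes that touch \<open>A\<close>.
\<close>

lemma keys_shifted_product_dominated: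
  assumes \<mu>: "strict_partition \<mu>"
  shows "keys (shifted_product \<mu>) \<subseteq> dominated \<mu>"
proof
  fix \<beta> assume \<beta>: "\<beta> \<in> keys (shifted_product \<mu>)"
  have "(\<Sum>a\<in>A. lookup \<beta> a) \<le> (\<Sum>a=1..card A. lookup \<mu> a)" if A: "finite A" for A
  proof -
    define d :: "nat \<times> nat \<Rightarrow> nat" where "d = (\<lambda>(i, j). if i \<in> A \<or> i + j - 1 \<in> A then 1 else 0)"
    have "(\<Sum>a\<in>A. lookup \<beta> a) \<le> (\<Sum>p\<in>diagram \<mu>. d p)"
    proof (rule keys_prod_degree_le[where f = box_factor])
      fix p \<gamma> assume "\<gamma> \<in> keys (box_factor p)"
      moreover obtain i j where p: "p = (i, j)" by force
      ultimately have "\<gamma> = single i 1 \<or> \<gamma> = single (i + j - 1) 1"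
        using keys_box_factor by blast
      then show "(\<Sum>a\<in>A. lookup \<gamma> a) \<le> d p"
        using A by (auto simp: p d_def lookup_single when_def)
    qed (use \<beta> in \<open>auto simp: finite_diagram lookup_add sum.distrib shifted_product_def\<close>)
    also have "\<dots> = card {(i, j) \<in> diagram \<mu>. i \<in> A \<or> i + j - 1 \<in> A}"
    proof -
      have "(\<Sum>p\<in>diagram \<mu>. d p) = (\<Sum>p\<in>{(i, j) \<in> diagram \<mu>. i \<in> A \<or> i + j - 1 \<in> A}. 1)"
        by (intro sum.mono_neutral_cong_right finite_diagram) (auto simp: d_def split: if_splits)
      then show ?thesis by simp
    qed
    also have "\<dots> \<le> (\<Sum>a=1..card A. lookup \<mu> a)"
      by (rule card_boxes_touching_le[OF \<mu> A])
    finally show ?thesis .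
  qed
  then show "\<beta> \<in> dominated \<mu>" by (simp add: dominated_def)
qed

definition weight :: "(nat \<Rightarrow> nat) \<Rightarrow> composition \<Rightarrow> nat" where
  "weight w \<beta> = (\<Sum>a\<in>keys \<beta>. w a * lookup \<beta> a)"

lemma weight_superset:
  assumes "finite T" "keys \<beta> \<subseteq> T"
  shows "weight w \<beta> = (\<Sum>a\<in>T. w a * lookup \<beta> a)"
  unfolding weight_def using assms by (intro sum.mono_neutral_left) (auto simp: in_keys_iff)

lemma weight_add: "weight w (\<beta> + \<gamma>) = weight w \<beta> + weight w \<gamma>"
proof -
  let ?T = "keys \<beta> \<union> keys \<gamma>"
  have "weight w (\<beta> + \<gamma>) = (\<Sum>a\<in>?T. w a * lookup (\<beta> + \<gamma>) a)"
    by (rule weight_superset) (auto dest: subsetD[OF keys_add])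
  then show ?thesis
    by (simp add: lookup_add distrib_left sum.distrib weight_superset[of ?T])
qed

lemma weight_single [simp]: "weight w (single i k) = w i * k"
  by (simp add: weight_def)

text \<open>
  The polynomial \<open>g\<close> is the component of \<open>f\<close> of weight \<open>d\<close>, and \<open>f\<close> has no component of smaller weight. Such leading
  terms are multiplicative, which allows single coefficients of long products to be read off.
\<close>

definition lowest_part :: "(nat \<Rightarrow> nat) \<Rightarrow> nat \<Rightarrow> polynomial \<Rightarrow> polynomial \<Rightarrow> bool" where
  "lowest_part w d f g \<longleftrightarrow> (\<forall>\<beta>\<in>keys g. weight w \<beta> = d) \<and> (\<forall>\<beta>\<in>keys (f - g). d < weight w \<beta>)"

lemma lowest_part_mult:
  assumes "lowest_part w d f f0" "lowest_part w e g g0"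
  shows "lowest_part w (d + e) (f * g) (f0 * g0)"
  unfolding lowest_part_def
proof (intro conjI ballI)
  fix \<beta> assume "\<beta> \<in> keys (f0 * g0)"
  then show "weight w \<beta> = d + e"
    using subsetD[OF keys_mult[of f0 g0]] assms unfolding lowest_part_def
    by (smt (verit, best) mem_Collect_eq weight_add)
next
  fix \<beta> assume "\<beta> \<in> keys (f * g - f0 * g0)"
  also have "f * g - f0 * g0 = (f0 * (g - g0) + (f - f0) * g0) + (f - f0) * (g - g0)"
    by (simp add: algebra_simps)
  finally have "\<beta> \<in> keys (f0 * (g - g0)) \<or> \<beta> \<in> keys ((f - f0) * g0) \<or>
      \<beta> \<in> keys ((f - f0) * (g - g0))"
    using subsetD[OF keys_add[of "f0 * (g - g0) + (f - f0) * g0" "(f - f0) * (g - g0)"], of \<beta>]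
      subsetD[OF keys_add[of "f0 * (g - g0)" "(f - f0) * g0"], of \<beta>] by auto
  then obtain h h' where h: "\<beta> \<in> keys (h * h')"
    "(h, h') = (f0, g - g0) \<or> (h, h') = (f - f0, g0) \<or> (h, h') = (f - f0, g - g0)" by blast
  obtain \<delta> \<epsilon> where "\<beta> = \<delta> + \<epsilon>" "\<delta> \<in> keys h" "\<epsilon> \<in> keys h'"
    using subsetD[OF keys_mult h(1)] by blast
  moreover from this h(2) assms have "weight w \<delta> + weight w \<epsilon> > d + e"
    unfolding lowest_part_def by (smt (verit) Pair_inject add_le_less_mono add_less_le_mono add_strict_mono order.refl)
  ultimately show "d + e < weight w \<beta>" by (simp add: weight_add)
qed

lemma lowest_part_prod:
  assumes "finite I" "\<And>p. p \<in> I \<Longrightarrow> lowest_part w (d p) (f p) (g p)"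
  shows "lowest_part w (\<Sum>p\<in>I. d p) (\<Prod>p\<in>I. f p) (\<Prod>p\<in>I. g p)"
  using assms
proof (induction I rule: finite_induct)
  case empty
  then show ?case by (simp add: lowest_part_def weight_def)
qed (simp add: lowest_part_mult)

lemma lookup_lowest_part:
  assumes "lowest_part w d f g" "weight w \<beta> = d"
  shows "lookup f \<beta> = lookup g \<beta>"
proof -
  have "\<beta> \<notin> keys (f - g)" using assms by (auto simp: lowest_part_def)
  then show ?thesis by (simp add: in_keys_iff lookup_minus)
qed

lemma lowest_part_x_var_add:
  assumes "w i < w k"
  shows "lowest_part w (w i) (x_var i + x_var k) (x_var i)"
  using assms by (simp add: lowest_part_def)

lemma prod_diagram_rows:
  assumes "weak_composition \<mu>"
  shows "(\<Prod>(i, j)\<in>diagram \<mu>. x_var i) = monom \<mu>" "(\<Sum>(i, j)\<in>diagram \<mu>. w i) = weight w \<mu>"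
proof -
  have D: "diagram \<mu> = Sigma (keys \<mu>) (\<lambda>i. {1..lookup \<mu> i})"
    using assms by (auto simp: diagram_def in_keys_iff weak_composition_def Suc_le_eq intro: gr0I)
  have "(\<Prod>(i, j)\<in>diagram \<mu>. x_var i) = (\<Prod>i\<in>keys \<mu>. x_var i ^ lookup \<mu> i)"
    unfolding D by (subst prod.Sigma[symmetric]) auto
  also have "\<dots> = monom (\<Sum>i\<in>keys \<mu>. single i (lookup \<mu> i))"
    by (simp add: x_var_power monom_sum)
  also have "(\<Sum>i\<in>keys \<mu>. single i (lookup \<mu> i)) = \<mu>"
    by (rule poly_mapping_eqI) (auto simp: lookup_sum lookup_single when_def in_keys_iff)
  finally show "(\<Prod>(i, j)\<in>diagram \<mu>. x_var i) = monom \<mu>" .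
  show "(\<Sum>(i, j)\<in>diagram \<mu>. w i) = weight w \<mu>"
    unfolding D by (subst sum.Sigma[symmetric]) (auto simp: weight_def mult.commute)
qed

text \<open>
  In every factor the variable of the row has the smaller index, and the product of these variables is \<open>x\<^sup>\<mu>\<close>.
\<close>

lemma lookup_shifted_product_self:
  assumes "weak_composition \<mu>"
  shows "lookup (shifted_product \<mu>) \<mu> = 1"
proof -
  have "lowest_part id (\<Sum>(i, j)\<in>diagram \<mu>. id i) (shifted_product \<mu>) (\<Prod>(i, j)\<in>diagram \<mu>. x_var i)"
    unfolding shifted_product_def
  proof (rule lowest_part_prod[OF finite_diagram])
    fix p assume "p \<in> diagram \<mu>"
    moreover obtain a b where p: "p = (a, b)" by force
    ultimately have ab: "1 \<le> a" "1 \<le> b" by (auto simp: diagram_def)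
    show "lowest_part id (case p of (i, j) \<Rightarrow> id i) (box_factor p) (case p of (i, j) \<Rightarrow> x_var i)"
    proof (cases "b = 1")
      case True
      then show ?thesis by (simp add: p box_factor_def lowest_part_def)
    next
      case False
      then have "id a < id (a + b - 1)" using ab by simp
      from lowest_part_x_var_add[of id, OF this] show ?thesis using False by (simp add: p box_factor_def)
    qed
  qed
  then have "lowest_part id (weight id \<mu>) (shifted_product \<mu>) (monom \<mu>)"
    unfolding prod_diagram_rows(1)[OF assms] prod_diagram_rows(2)[OF assms, of id] .
  then have "lookup (shifted_product \<mu>) \<mu> = lookup (monom \<mu>) \<mu>"
    by (rule lookup_lowest_part) (rule refl)
  then show ?thesis by (simp only: lookup_monom simp_thms if_True)
qed

lemma lookup_shifted_product_gap:
  assumes \<mu>: "weak_composition \<mu>" and i: "1 \<le> i" and gap: "lookup \<mu> (Suc i) + 2 \<le> lookup \<mu> i"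
  shows "lookup (shifted_product \<mu>) (lower i \<mu>) = 1"
    "lookup (shifted_product \<mu>) (swap i \<mu>) = 0"
proof -
  \<comment> \<open>This weight identifies the variables i and i + 1, so that outside the first column the only box
     whose two variables have the same weight is the second box of row i.\<close>
  define w where "w = (\<lambda>a. if a \<le> i then a else a - 1)"
  define g :: "nat \<times> nat \<Rightarrow> polynomial" where "g = (\<lambda>(a, b). if (a, b) = (i, 2) then x_var i + x_var (Suc i) else x_var a)"
  have box: "(i, 2) \<in> diagram \<mu>" using i gap by (simp add: diagram_def)
  have "lowest_part w (\<Sum>(a, b)\<in>diagram \<mu>. w a) (shifted_product \<mu>) (\<Prod>p\<in>diagram \<mu>. g p)"
    unfolding shifted_product_def
  proof (rule lowest_part_prod[OF finite_diagram])
    fix p assume "p \<in> diagram \<mu>"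
    moreover obtain a b where p: "p = (a, b)" by force
    ultimately have ab: "1 \<le> a" "1 \<le> b" by (auto simp: diagram_def)
    consider "b = 1" | "(a, b) = (i, 2)" | "b \<noteq> 1" "(a, b) \<noteq> (i, 2)" by blast
    then show "lowest_part w (case p of (a, b) \<Rightarrow> w a) (box_factor p) (g p)"
    proof cases
      case 1
      then have "box_factor p = x_var a" "g p = x_var a" by (simp_all add: p g_def box_factor_def)
      then show ?thesis by (simp add: p lowest_part_def)
    next
      case 2
      then have "box_factor p = g p" by (simp add: p g_def box_factor_def numeral_2_eq_2)
      moreover have "weight w \<beta> = w i" if "\<beta> \<in> keys (box_factor (i, 2))" for \<beta>
        using keys_box_factor[OF that] by (elim disjE) (simp_all add: w_def)
      ultimately show ?thesis using 2 by (simp add: p lowest_part_def)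
    next
      case 3
      then have "w a < w (a + b - 1)" using ab by (simp add: w_def) linarith
      moreover have "box_factor p = x_var a + x_var (a + b - 1)" "g p = x_var a"
        using 3 by (simp_all only: p g_def box_factor_def prod.case if_False)
      ultimately show ?thesis using lowest_part_x_var_add[of w] by (simp add: p)
    qed
  qed
  then have low: "lowest_part w (weight w \<mu>) (shifted_product \<mu>) (\<Prod>p\<in>diagram \<mu>. g p)"
    unfolding prod_diagram_rows(2)[OF \<mu>, of w] .
  define R where "R = (\<Prod>(a, b)\<in>diagram \<mu> - {(i, 2)}. x_var a)"
  have xR: "x_var i * R = monom \<mu>"
    using prod_diagram_rows(1)[OF \<mu>] box finite_diagram by (simp add: R_def prod.remove)
  have lw: "\<mu> + single (Suc i) 1 = single i 1 + lower i \<mu>"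
    using gap by (intro poly_mapping_eqI) (auto simp: lower_def lookup_string_pt lookup_add lookup_single when_def)
  have "x_var i * (x_var (Suc i) * R) = monom \<mu> * x_var (Suc i)"
    unfolding xR[symmetric] by (simp only: mult_ac)
  also have "\<dots> = x_var i * monom (lower i \<mu>)"
    unfolding x_var_def monom_add[symmetric] lw ..
  finally have "x_var i * (x_var (Suc i) * R) = x_var i * monom (lower i \<mu>)" .
  moreover have "x_var i \<noteq> 0"
  proof
    assume "x_var i = 0"
    then have "keys (x_var i) = {}" by simp
    then show False by simp
  qed
  ultimately have xR': "x_var (Suc i) * R = monom (lower i \<mu>)" by simp
  have "(\<Prod>p\<in>diagram \<mu>. g p) = g (i, 2) * (\<Prod>p\<in>diagram \<mu> - {(i, 2)}. g p)"
    using box finite_diagram by (rule prod.remove[rotated])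
  also have "(\<Prod>p\<in>diagram \<mu> - {(i, 2)}. g p) = R"
    unfolding R_def by (intro prod.cong) (auto simp: g_def split: if_splits)
  finally have prod: "(\<Prod>p\<in>diagram \<mu>. g p) = monom \<mu> + monom (lower i \<mu>)"
    using xR xR' by (simp add: g_def distrib_right)
  have "weight w \<mu> + weight w (single (Suc i) 1) = weight w (single i 1) + weight w (lower i \<mu>)"
    using arg_cong[OF lw, of "weight w"] by (simp only: weight_add)
  then have wl: "weight w (lower i \<mu>) = weight w \<mu>" unfolding weight_single by (simp add: w_def)
  note ne = lower_swap_distinct[OF gap]
  show "lookup (shifted_product \<mu>) (lower i \<mu>) = 1"
    using lookup_lowest_part[OF low wl] ne by (simp add: prod lookup_add lookup_monom)
  have ws: "weight w (swap i \<mu>) = weight w \<mu>"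
  proof -
    define m where "m = lookup \<mu> i - lookup \<mu> (Suc i)"
    have "\<mu> + single (Suc i) m = swap i \<mu> + single i m"
    proof (rule poly_mapping_eqI)
      fix a
      consider "a = i" | "a = Suc i" | "a \<noteq> i" "a \<noteq> Suc i" by blast
      then show "lookup (\<mu> + single (Suc i) m) a =
        lookup (swap i \<mu> + single i m) a"
        using gap by cases (simp_all add: m_def lookup_add lookup_single adj_trans_other)
    qed
    then have "weight w \<mu> + w (Suc i) * m = weight w (swap i \<mu>) + w i * m"
      by (metis weight_add weight_single)
    moreover have "w (Suc i) = w i" by (simp add: w_def)
    ultimately show ?thesis by simp
  qed
  show "lookup (shifted_product \<mu>) (swap i \<mu>) = 0"
  proof -
    have "lookup (shifted_product \<mu>) (swap i \<mu>) =
        lookup (monom \<mu>) (swap i \<mu>) + lookup (monom (lower i \<mu>)) (swap i \<mu>)"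
      by (simp only: lookup_lowest_part[OF low ws] prod lookup_add)
    then show ?thesis by (simp only: lookup_monom ne if_False add_0)
  qed
qed

section \<open>Antisymmetrization\<close>

definition antisymmetrize :: "nat \<Rightarrow> polynomial \<Rightarrow> polynomial" where
  "antisymmetrize n f = (\<Sum>w | w permutes {1..n}. of_int (sign w) * act_poly w f)"

lemma finite_perms: "finite {w. w permutes {1..n :: nat}}"
  by (simp add: finite_permutations)

lemma act_poly_of_int: "bij w \<Longrightarrow> act_poly w (of_int c) = of_int c"
  by (simp add: act_poly_single flip: single_of_int single_zero)

lemma antisymmetrize_add: "antisymmetrize n (f + g) = antisymmetrize n f + antisymmetrize n g"
proof -
  have "antisymmetrize n (f + g) = (\<Sum>w | w permutes {1..n}. of_int (sign w) * act_poly w f + of_int (sign w) * act_poly w g)"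
    unfolding antisymmetrize_def
    by (intro sum.cong refl) (simp add: act_poly_add[OF permutes_bij] distrib_left)
  then show ?thesis by (simp only: sum.distrib antisymmetrize_def)
qed

lemma antisymmetrize_mult_invariant:
  assumes "\<And>w. w permutes {1..n} \<Longrightarrow> act_poly w g = g"
  shows "antisymmetrize n (f * g) = antisymmetrize n f * g"
proof -
  have "antisymmetrize n (f * g) = (\<Sum>w | w permutes {1..n}. (of_int (sign w) * act_poly w f) * g)"
    unfolding antisymmetrize_def
    by (intro sum.cong refl) (simp add: act_poly_mult[OF permutes_bij] assms mult.assoc)
  then show ?thesis by (simp only: sum_distrib_right antisymmetrize_def)
qed

lemma antisymmetrize_act_poly:
  assumes v: "v permutes {1..n}"
  shows "antisymmetrize n f = of_int (sign v) * antisymmetrize n (act_poly v f)"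
proof -
  have "antisymmetrize n f = (\<Sum>w | w permutes {1..n}. of_int (sign (w \<circ> v)) * act_poly (w \<circ> v) f)"
    unfolding antisymmetrize_def by (rule sum_permutations_compose_right[OF v])
  also have "\<dots> = (\<Sum>w | w permutes {1..n}. of_int (sign v) * (of_int (sign w) * act_poly w (act_poly v f)))"
  proof (rule sum.cong[OF refl])
    fix w assume "w \<in> {w. w permutes {1..n}}"
    then have w: "w permutes {1..n}" by simp
    have "permutation w" "permutation v" using v w by (auto intro: permutes_imp_permutation[of "{1..n}"])
    then have "sign (w \<circ> v) = sign w * sign v" by (rule sign_compose)
    moreover have "act_poly (w \<circ> v) f = act_poly w (act_poly v f)"
      by (rule act_poly_compose[OF permutes_bij[OF w] permutes_bij[OF v], symmetric])
    ultimately show "of_int (sign (w \<circ> v)) * act_poly (w \<circ> v) f =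
        of_int (sign v) * (of_int (sign w) * act_poly w (act_poly v f))"
      by (simp only: of_int_mult mult_ac)
  qed
  also have "\<dots> = of_int (sign v) * antisymmetrize n (act_poly v f)"
    by (simp only: sum_distrib_left antisymmetrize_def)
  finally show ?thesis .
qed

lemma eq_uminus_imp_zero: "x = - x \<Longrightarrow> x = 0" for x :: polynomial
proof -
  assume "x = - x"
  then have "2 * x = 0" by (metis add.right_inverse mult_2)
  then show ?thesis by simp
qed

lemma adj_trans_permutes: "1 \<le> k \<Longrightarrow> k < n \<Longrightarrow> adj_trans k permutes {1..n}"
  unfolding adj_trans_def by (rule permutes_swap_id) auto

lemma sign_adj_trans: "sign (adj_trans k) = - 1"
  by (simp add: adj_trans_def sign_swap_id)

text \<open>
  Precomposition with the transposition both fixes and negates the alternating sum.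
\<close>

lemma antisymmetrize_symmetric_eq_0:
  assumes "1 \<le> k" "k < n" "act_poly (adj_trans k) h = h"
  shows "antisymmetrize n h = 0"
proof (rule eq_uminus_imp_zero)
  show "antisymmetrize n h = - antisymmetrize n h"
    using antisymmetrize_act_poly[OF adj_trans_permutes[OF assms(1,2)], of h] assms(3) by (simp add: sign_adj_trans)
qed

text \<open>
  The difference of the two arguments, divided by \<open>m\<close>, is \<open>x\<^sub>k x\<^bsub>k+1\<^esub>\<close> times a divided difference of \<open>f\<close>. It is
  symmetric in \<open>x\<^sub>k\<close> and \<open>x\<^bsub>k+1\<^esub>\<close> and is killed by the alternating sum.
\<close>

lemma antisymmetrize_pi_op:
  assumes k: "1 \<le> k" "k < n" and m: "act_poly (adj_trans k) m = m"
  shows "antisymmetrize n (m * x_var k * pi_op k f) = antisymmetrize n (m * x_var k * f)"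
proof -
  define h where "h = x_var k * (pi_op k f - f)"
  define s where "s = act_poly (adj_trans k)"
  have "(x_var k - x_var (Suc k)) * (pi_op k f - f) = x_var (Suc k) * (f - s f)"
    unfolding right_diff_distrib pi_op_spec s_def by (simp add: algebra_simps)
  then have D: "(x_var k - x_var (Suc k)) * h = x_var k * x_var (Suc k) * (f - s f)"
    unfolding h_def by (metis mult.assoc mult.left_commute)
  have "s ((x_var k - x_var (Suc k)) * h) = s (x_var k * x_var (Suc k) * (f - s f))" by (simp only: D)
  then have "(x_var (Suc k) - x_var k) * s h = x_var (Suc k) * x_var k * (s f - f)"
    by (simp add: s_def act_poly_mult act_poly_diff act_poly_x_var)
  then have "(x_var k - x_var (Suc k)) * s h = (x_var k - x_var (Suc k)) * h"
    unfolding D by algebra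
  then have "s h = h" by simp
  then have "act_poly (adj_trans k) (m * h) = m * h" using m by (simp add: act_poly_mult s_def)
  then have "antisymmetrize n (m * h) = 0" by (rule antisymmetrize_symmetric_eq_0[OF k])
  moreover have "m * x_var k * pi_op k f = m * x_var k * f + m * h"
    unfolding h_def by (simp add: algebra_simps)
  ultimately show ?thesis by (simp add: antisymmetrize_add)
qed

text \<open>
  The exponent \<open>(c(n-1), \<dots>, c, 0)\<close>, which is \<open>c\<close> times the Weyl vector.
\<close>

definition rho :: "nat \<Rightarrow> nat \<Rightarrow> composition" where
  "rho c n = (\<Sum>i=1..n. single i (c * (n - i)))"

lemma lookup_sum_single:
  "finite I \<Longrightarrow> lookup (\<Sum>i\<in>I. single i (f i)) a = (if a \<in> I then f a else 0)"
  by (simp add: lookup_sum lookup_single when_def)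

lemma lookup_rho: "lookup (rho c n) a = (if a \<in> {1..n} then c * (n - a) else 0)"
  unfolding rho_def by (rule lookup_sum_single) simp

text \<open>
  The monomial of the Weyl vector is \<open>x\<^sub>k\<close> times a monomial that is symmetric in \<open>x\<^sub>k\<close> and \<open>x\<^bsub>k+1\<^esub>\<close>. So every operator on
  the path can be removed under the alternating sum.
\<close>

lemma antisymmetrize_transport:
  assumes \<alpha>: "weak_composition \<alpha>" and keys: "keys \<alpha> \<subseteq> {1..n}"
  shows "antisymmetrize n (monom (rho 1 n) * transport f \<alpha>) = antisymmetrize n (monom (rho 1 n) * f)"
proof -
  have "keys \<alpha> \<subseteq> {1..n} \<longrightarrow> 
    antisymmetrize n (monom (rho 1 n) * transport f \<alpha>) = antisymmetrize n (monom (rho 1 n) * f)"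
    using \<alpha>
  proof (induction rule: transport_induct)
    case (step \<beta> g k)
    show ?case
    proof
      assume \<beta>: "keys \<beta> \<subseteq> {1..n}"
      have "Suc k \<in> keys \<beta>" using step.hyps(1) by (simp add: ascent_def in_keys_iff)
      then have k: "1 \<le> k" "k < n" using \<beta> step.hyps(1) by (auto simp: ascent_def)
      have "keys (swap k \<beta>) \<subseteq> {1..n}"
      proof
        fix a assume "a \<in> keys (swap k \<beta>)"
        then have "adj_trans k a \<in> keys \<beta>" by (simp add: in_keys_iff)
        then have "adj_trans k a \<in> {1..n}" using \<beta> by (rule rev_subsetD)
        then show "a \<in> {1..n}" using k by (auto simp: adj_trans_cases split: if_splits)
      qed
      then have IH: "antisymmetrize n (monom (rho 1 n) * g) = antisymmetrize n (monom (rho 1 n) * f)" using step.IH by simp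
      define m where "m = monom (Poly_Mapping.update k (n - Suc k) (rho 1 n))"
      have "rho 1 n = Poly_Mapping.update k (n - Suc k) (rho 1 n) + single k 1"
        using k by (intro poly_mapping_eqI) (auto simp: lookup_rho lookup_update lookup_add lookup_single when_def)
      then have m: "monom (rho 1 n) = m * x_var k" unfolding m_def x_var_def by (metis monom_add)
      have "swap k (Poly_Mapping.update k (n - Suc k) (rho 1 n)) = Poly_Mapping.update k (n - Suc k) (rho 1 n)"
        using k by (intro swap_equal) (simp add: lookup_rho lookup_update)
      then have "act_poly (adj_trans k) m = m" by (simp add: m_def act_poly_monom)
      from antisymmetrize_pi_op[OF k this, of g]
      show "antisymmetrize n (monom (rho 1 n) * pi_op k g) = antisymmetrize n (monom (rho 1 n) * f)"
        using IH unfolding m by (simp only:)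
    qed
  qed simp
  then show ?thesis using keys by simp
qed

section \<open>Symmetric and antisymmetric polynomials\<close>

text \<open>
  A transposition is a product of an odd number of adjacent ones. The factor \<open>e\<close> covers symmetric and antisymmetric
  polynomials at the same time.
\<close>

lemma act_poly_transpose:
  assumes e: "e = 1 \<or> e = (- 1 :: polynomial)"
    and g: "\<And>k. 1 \<le> k \<Longrightarrow> k < n \<Longrightarrow> act_poly (adj_trans k) g = e * g"
    and "1 \<le> a" "a < b" "b \<le> n"
  shows "act_poly (transpose a b) g = e * g"
proof -
  have ac: "act_poly (adj_trans k) (e * h) = e * act_poly (adj_trans k) h" for k h
    using e by (auto simp: act_poly_uminus)
  have "Suc a \<le> b" using assms by simp
  then show ?thesis using \<open>b \<le> n\<close>
  proof (induction b rule: dec_induct)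
    case base
    then show ?case using g[of a] \<open>1 \<le> a\<close> by (simp add: adj_trans_def)
  next
    case (step b)
    have b: "1 \<le> b" "b < n" using step by auto
    have t: "bij (transpose a b)" by simp
    have "transpose a (Suc b) = adj_trans b \<circ> (transpose a b \<circ> adj_trans b)"
      using step.hyps by (auto simp: fun_eq_iff adj_trans_def transpose_def)
    then have "act_poly (transpose a (Suc b)) g = act_poly (adj_trans b) (act_poly (transpose a b) (act_poly (adj_trans b) g))"
      by (simp only: act_poly_compose bij_adj_trans t bij_comp)
    also have "\<dots> = act_poly (adj_trans b) (act_poly (transpose a b) (e * g))" by (simp only: g[OF b])
    also have "act_poly (transpose a b) (e * g) = e * (e * g)"
      using step e by (auto simp: act_poly_uminus[OF t])
    also have "act_poly (adj_trans b) (e * (e * g)) = e * (e * (e * g))" by (simp only: ac g[OF b])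
    also have "\<dots> = e * g" using e by auto
    finally show ?case .
  qed
qed

lemma act_poly_permutes_symmetric:
  assumes g: "\<And>k. 1 \<le> k \<Longrightarrow> k < n \<Longrightarrow> act_poly (adj_trans k) g = g" and w: "w permutes {1..n}"
  shows "act_poly w g = g"
  using w finite_atLeastAtMost
proof (induction rule: permutes_induct)
  case (swap a b p)
  have t: "act_poly (transpose a b) g = g" if "a < b" "a \<in> {1..n}" "b \<in> {1..n}" for a b
    using act_poly_transpose[of 1 n g a b] g that by simp
  have "act_poly (transpose a b) g = g"
  proof (cases "a < b")
    case False
    then show ?thesis using t[of b a] swap.hyps by (simp add: transpose_commute)
  qed (use t swap.hyps in simp)
  moreover have "act_poly (transpose a b \<circ> p) g = act_poly (transpose a b) (act_poly p g)"
    by (rule act_poly_compose[symmetric]) (simp_all add: permutes_bij[OF swap.hyps(4)])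
  ultimately show ?case by (simp only: swap.IH)
qed (rule act_poly_id)

lemma act_poly_permutes_antisymmetric:
  assumes g: "\<And>k. 1 \<le> k \<Longrightarrow> k < n \<Longrightarrow> act_poly (adj_trans k) g = - g" and w: "w permutes {1..n}"
  shows "act_poly w g = of_int (sign w) * g"
  using w finite_atLeastAtMost
proof (induction rule: permutes_induct)
  case (swap a b p)
  have t: "act_poly (transpose a b) g = - g" if "a < b" "a \<in> {1..n}" "b \<in> {1..n}" for a b
    using act_poly_transpose[of "-1" n g a b] g that by simp
  have ab: "act_poly (transpose a b) g = - g"
  proof (cases "a < b")
    case False
    then show ?thesis using t[of b a] swap.hyps by (simp add: transpose_commute)
  qed (use t swap.hyps in simp)
  have "act_poly (transpose a b \<circ> p) g = act_poly (transpose a b) (act_poly p g)"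
    by (rule act_poly_compose[symmetric]) (simp_all add: permutes_bij[OF swap.hyps(4)])
  also have "\<dots> = of_int (sign p) * - g"
    by (simp only: swap.IH act_poly_mult act_poly_of_int bij_transpose ab)
  also have "of_int (sign p) * - g = of_int (sign (transpose a b \<circ> p)) * g"
  proof -
    have "sign (transpose a b \<circ> p) = sign (transpose a b) * sign p"
      by (rule sign_compose)
        (auto intro: permutes_imp_permutation[OF _ swap.hyps(4)] permutation_swap_id)
    then show ?thesis using swap.hyps(3) by (simp add: sign_swap_id)
  qed
  finally show ?case .
qed (simp only: act_poly_id sign_id of_int_1 mult_1)

section \<open>The Vandermonde product\<close>

definition pairs :: "nat \<Rightarrow> (nat \<times> nat) set" where
  "pairs n = {(i, j). 1 \<le> i \<and> i < j \<and> j \<le> n}"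

definition vandermonde :: "nat \<Rightarrow> nat \<Rightarrow> polynomial" where
  "vandermonde c n = (\<Prod>(i, j)\<in>pairs n. x_var i ^ c - x_var j ^ c)"

lemma finite_pairs: "finite (pairs n)"
  by (rule finite_subset[of _ "{1..n} \<times> {1..n}"]) (auto simp: pairs_def)

text \<open>
  The adjacent transposition negates one factor and permutes the others.
\<close>

lemma act_poly_vandermonde:
  assumes k: "1 \<le> k" "k < n"
  shows "act_poly (adj_trans k) (vandermonde c n) = - vandermonde c n"
proof -
  define F where "F = (\<lambda>(a, b). (adj_trans k a, adj_trans k b))"
  define f where "f = (\<lambda>(i, j). x_var i ^ c - x_var j ^ c)"
  define Q where "Q = pairs n - {(k, Suc k)}"
  have mem: "(k, Suc k) \<in> pairs n" using k by (simp add: pairs_def)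
  have V: "vandermonde c n = f (k, Suc k) * (\<Prod>p\<in>Q. f p)"
    unfolding vandermonde_def f_def[symmetric] Q_def by (rule prod.remove[OF finite_pairs mem])
  have actf: "act_poly (adj_trans k) (f p) = f (F p)" for p
    by (cases p) (simp add: f_def F_def act_poly_diff act_poly_power act_poly_x_var)
  have FF: "F (F p) = p" for p by (cases p) (simp add: F_def)
  have FQ: "F p \<in> Q" if "p \<in> Q" for p
  proof -
    obtain a b where p: "p = (a, b)" by force
    have ab: "1 \<le> a" "a < b" "b \<le> n" "(a, b) \<noteq> (k, Suc k)" using that by (auto simp: p Q_def pairs_def)
    have "adj_trans k b \<le> n" using ab k by (auto simp: adj_trans_cases)
    moreover have "(adj_trans k a, adj_trans k b) \<noteq> (k, Suc k)"
      using ab(2) by (auto simp: adj_trans_cases split: if_splits)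
    ultimately show ?thesis
      using ab adj_trans_less[OF ab(2,4)] adj_trans_pos[OF k(1) ab(1)] by (simp add: p F_def Q_def pairs_def)
  qed
  have "(\<Prod>p\<in>Q. f (F p)) = (\<Prod>p\<in>Q. f p)"
    by (rule prod.reindex_bij_witness[of _ F F]) (simp_all add: FF FQ)
  moreover have "f (F (k, Suc k)) = - f (k, Suc k)" by (simp add: f_def F_def)
  ultimately show ?thesis by (simp add: V act_poly_mult act_poly_prod actf)
qed

lemma lowest_part_vandermonde:
  assumes "1 \<le> c"
  shows "lowest_part id (weight id (rho c n)) (vandermonde c n) (monom (rho c n))"
proof -
  have "lowest_part id (\<Sum>p\<in>pairs n. c * fst p) (vandermonde c n) (\<Prod>p\<in>pairs n. x_var (fst p) ^ c)"
    unfolding vandermonde_def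
  proof (rule lowest_part_prod[OF finite_pairs])
    fix p assume "p \<in> pairs n"
    then obtain i j where p: "p = (i, j)" "i < j" by (auto simp: pairs_def)
    have "keys (- (x_var j ^ c)) = {single j c}"
      unfolding x_var_power keys_minus by simp
    then show "lowest_part id (c * fst p) (case p of (i, j) \<Rightarrow> x_var i ^ c - x_var j ^ c) (x_var (fst p) ^ c)"
      unfolding lowest_part_def using p assms by (simp add: x_var_power)
  qed
  moreover have prod: "(\<Prod>p\<in>pairs n. x_var (fst p) ^ c) = monom (rho c n)"
  proof -
    have "pairs n = Sigma {1..n} (\<lambda>i. {Suc i..n})" by (auto simp: pairs_def)
    then have "(\<Prod>p\<in>pairs n. x_var (fst p) ^ c) = (\<Prod>(i, j)\<in>Sigma {1..n} (\<lambda>i. {Suc i..n}). x_var i ^ c)"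
      by (simp only: case_prod_unfold)
    also have "\<dots> = (\<Prod>i=1..n. \<Prod>j=Suc i..n. x_var i ^ c)"
      by (rule prod.Sigma[symmetric]) auto
    also have "\<dots> = (\<Prod>i=1..n. monom (single i (c * (n - i))))"
      by (intro prod.cong refl) (simp add: power_mult flip: x_var_power)
    finally show ?thesis by (simp add: rho_def monom_sum)
  qed
  moreover have "(\<Sum>p\<in>pairs n. c * fst p) = weight id (rho c n)"
  proof -
    have "rho c n \<in> keys (\<Prod>p\<in>pairs n. x_var (fst p) ^ c)" unfolding prod by simp
    then show ?thesis using calculation(1) by (simp add: lowest_part_def)
  qed
  ultimately show ?thesis by simp
qed

lemma lookup_vandermonde_rho: "1 \<le> c \<Longrightarrow> lookup (vandermonde c n) (rho c n) = 1"
  using lookup_lowest_part[OF lowest_part_vandermonde refl] by (simp add: lookup_monom)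

lemma keys_prod_closed:
  fixes f :: "'a \<Rightarrow> polynomial"
  assumes "finite I" "0 \<in> S" "\<And>\<beta> \<gamma>. \<beta> \<in> S \<Longrightarrow> \<gamma> \<in> S \<Longrightarrow> \<beta> + \<gamma> \<in> S"
    "\<And>p. p \<in> I \<Longrightarrow> keys (f p) \<subseteq> S"
  shows "keys (\<Prod>p\<in>I. f p) \<subseteq> S"
  using assms(1,4)
proof (induction I rule: finite_induct)
  case (insert p I)
  show ?case
  proof
    fix \<beta> assume "\<beta> \<in> keys (\<Prod>p\<in>insert p I. f p)"
    then have "\<beta> \<in> keys (f p * (\<Prod>p\<in>I. f p))" using insert by simp
    from subsetD[OF keys_mult this] obtain \<delta> \<epsilon> where
      "\<beta> = \<delta> + \<epsilon>" "\<delta> \<in> keys (f p)" "\<epsilon> \<in> keys (\<Prod>p\<in>I. f p)" by blast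
    then show "\<beta> \<in> S" using insert assms(3) by blast
  qed
qed (simp add: assms(2))

lemma keys_x_power_diff:
  "keys (x_var i ^ c - x_var j ^ c) \<subseteq> {single i c, single j c}"
  using keys_diff[of "x_var i ^ c" "x_var j ^ c"] by (auto simp: x_var_power)

lemma keys_vandermonde:
  assumes c: "1 \<le> c" and \<beta>: "\<beta> \<in> keys (vandermonde c n)"
  shows "keys \<beta> \<subseteq> {1..n}" "c dvd lookup \<beta> a"
    "weight (\<lambda>_. 1) \<beta> = weight (\<lambda>_. 1) (rho c n)"
proof -
  define S where "S = {\<beta>. keys \<beta> \<subseteq> {1..n} \<and> (\<forall>a. c dvd lookup \<beta> a)}"
  have single: "single i c \<in> S" if "1 \<le> i" "i \<le> n" for i
    using that c by (simp add: S_def lookup_single when_def)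
  have "keys (vandermonde c n) \<subseteq> S"
    unfolding vandermonde_def
  proof (rule keys_prod_closed[OF finite_pairs])
    show "0 \<in> S" by (simp add: S_def)
  next
    fix \<beta> \<gamma> assume S: "\<beta> \<in> S" "\<gamma> \<in> S"
    then have "keys (\<beta> + \<gamma>) \<subseteq> {1..n}"
      using keys_add[of \<beta> \<gamma>] unfolding S_def by blast
    then show "\<beta> + \<gamma> \<in> S" using S by (simp add: S_def lookup_add)
  next
    fix p assume "p \<in> pairs n"
    then obtain i j where p: "p = (i, j)" "1 \<le> i" "i < j" "j \<le> n" by (auto simp: pairs_def)
    then have "{single i c, single j c} \<subseteq> S"
      using single[of i] single[of j] by simp
    then show "keys (case p of (i, j) \<Rightarrow> x_var i ^ c - x_var j ^ c) \<subseteq> S"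
      unfolding p(1) prod.case by (rule subset_trans[OF keys_x_power_diff])
  qed
  then have "\<beta> \<in> S" using \<beta> by (rule subsetD)
  then show "keys \<beta> \<subseteq> {1..n}" "c dvd lookup \<beta> a" by (simp_all add: S_def)
  \<comment> \<open>For the constant weight 1 this is homogeneity in the total degree.\<close>
  have "lowest_part (\<lambda>_. 1) (\<Sum>p\<in>pairs n. c) (vandermonde c n) (vandermonde c n)"
    unfolding vandermonde_def
  proof (rule lowest_part_prod[OF finite_pairs])
    fix p :: "nat \<times> nat"
    obtain i j where p: "p = (i, j)" by force
    have "weight (\<lambda>_. 1) \<gamma> = c" if "\<gamma> \<in> keys (x_var i ^ c - x_var j ^ c)" for \<gamma>
      using subsetD[OF keys_x_power_diff that] by (elim insertE emptyE) simp_all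
    then show "lowest_part (\<lambda>_. 1) c (case p of (i, j) \<Rightarrow> x_var i ^ c - x_var j ^ c) (case p of (i, j) \<Rightarrow> x_var i ^ c - x_var j ^ c)"
      by (simp add: p lowest_part_def)
  qed
  then have "weight (\<lambda>_. 1) \<gamma> = (\<Sum>p\<in>pairs n. c)" if "\<gamma> \<in> keys (vandermonde c n)" for \<gamma>
    using that by (simp add: lowest_part_def)
  moreover have "rho c n \<in> keys (vandermonde c n)"
    using lookup_vandermonde_rho[OF c] by (simp add: in_keys_iff)
  ultimately show "weight (\<lambda>_. 1) \<beta> = weight (\<lambda>_. 1) (rho c n)" using \<beta> by simp
qed

lemma sum_ge_sum_lessThan:
  fixes S :: "nat set"
  assumes "finite S"
  shows "(\<Sum>k<card S. k) \<le> \<Sum>S" "\<Sum>S = (\<Sum>k<card S. k) \<Longrightarrow> S = {..<card S}"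
proof -
  have *: "(\<Sum>k<n. k) \<le> \<Sum>S \<and> (\<Sum>S = (\<Sum>k<n. k) \<longrightarrow> S = {..<n})" if "finite S" "card S = n" for n and S :: "nat set"
    using that
  proof (induction n arbitrary: S)
    case (Suc n)
    define m where "m = Max S"
    have "S \<noteq> {}" using Suc.prems by auto
    then have m: "m \<in> S" "S \<subseteq> {..m}"
      using Suc.prems(1) by (simp_all add: m_def subset_iff)
    have "n \<le> m" using card_mono[OF _ m(2)] Suc.prems by simp
    have "finite (S - {m})" "card (S - {m}) = n" using Suc.prems m(1) by simp_all
    note IH = Suc.IH[OF this]
    have S: "\<Sum>S = m + \<Sum>(S - {m})" using Suc.prems(1) m(1) by (rule sum.remove)
    show ?case
    proof (intro conjI impI)
      show "(\<Sum>k<Suc n. k) \<le> \<Sum>S" using IH S \<open>n \<le> m\<close> by simp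
      assume "\<Sum>S = (\<Sum>k<Suc n. k)"
      then have "m + \<Sum>(S - {m}) = n + (\<Sum>k<n. k)" using S by simp
      then have "m = n" "\<Sum>(S - {m}) = (\<Sum>k<n. k)" using conjunct1[OF IH] \<open>n \<le> m\<close> by linarith+
      then have "S - {n} = {..<n}" "n \<in> S" using IH m(1) by simp_all
      then show "S = {..<Suc n}" by (metis insert_Diff lessThan_Suc)
    qed
  qed simp
  show "(\<Sum>k<card S. k) \<le> \<Sum>S" "\<Sum>S = (\<Sum>k<card S. k) \<Longrightarrow> S = {..<card S}"
    using *[OF assms refl] by simp_all
qed

lemma lookup_antisymmetric:
  assumes g: "\<And>k. 1 \<le> k \<Longrightarrow> k < n \<Longrightarrow> act_poly (adj_trans k) g = - g" and w: "w permutes {1..n}"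
  shows "lookup g (act w \<beta>) = of_int (sign w) * lookup g \<beta>"
proof -
  have "lookup g \<beta> = lookup (act_poly w g) (act w \<beta>)"
    using permutes_bij[OF w] by (simp add: lookup_act_poly act_inverse)
  also have "act_poly w g = of_int (sign w) * g" by (rule act_poly_permutes_antisymmetric[OF g w])
  finally show ?thesis by (cases w rule: sign_cases) simp_all
qed

lemma lookup_antisymmetrize_monom:
  assumes inj: "inj_on (lookup \<mu>) {1..n}"
  shows "v permutes {1..n} \<Longrightarrow> lookup (antisymmetrize n (monom \<mu>)) (act v \<mu>) = of_int (sign v)"
    "\<nexists>v. v permutes {1..n} \<and> \<beta> = act v \<mu> \<Longrightarrow> lookup (antisymmetrize n (monom \<mu>)) \<beta> = 0"
proof -
  have sgn: "lookup (of_int (sign w) * h) \<gamma> = of_int (sign w) * lookup h \<gamma>"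
    for w and h :: polynomial and \<gamma>
    by (cases w rule: sign_cases) simp_all
  have lk: "lookup (antisymmetrize n (monom \<mu>)) \<gamma> =
      (\<Sum>w | w permutes {1..n}. if \<gamma> = act w \<mu> then of_int (sign w) else 0)" for \<gamma>
    unfolding antisymmetrize_def lookup_sum
    by (intro sum.cong refl) (simp add: sgn act_poly_monom[OF permutes_bij] lookup_monom)
  show "lookup (antisymmetrize n (monom \<mu>)) (act v \<mu>) = of_int (sign v)" if v: "v permutes {1..n}"
  proof -
    have eq: "act v \<mu> = act w \<mu> \<longleftrightarrow> w = v" if w: "w permutes {1..n}" for w
    proof
      assume *: "act v \<mu> = act w \<mu>"
      have "inv v a = inv w a" for a
      proof (cases "a \<in> {1..n}")
        case True
        then have "inv v a \<in> {1..n}" "inv w a \<in> {1..n}"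
          using permutes_in_image[OF permutes_inv[OF v]] permutes_in_image[OF permutes_inv[OF w]] by blast+
        moreover have "lookup \<mu> (inv v a) = lookup \<mu> (inv w a)"
          using arg_cong[OF *, of "\<lambda>\<beta>. lookup \<beta> a"] by (simp add: lookup_act permutes_bij[OF v] permutes_bij[OF w])
        ultimately show ?thesis using inj by (meson inj_onD)
      next
        case False
        then show ?thesis
          using permutes_not_in[OF permutes_inv[OF v]] permutes_not_in[OF permutes_inv[OF w]] by metis
      qed
      then have "inv v = inv w" by blast
      then show "w = v" using permutes_inv_inv[OF v] permutes_inv_inv[OF w] by metis
    qed simp
    have "lookup (antisymmetrize n (monom \<mu>)) (act v \<mu>) = 
        (\<Sum>w | w permutes {1..n}. if w = v then of_int (sign w) else 0)"
      unfolding lk by (intro sum.cong refl) (simp only: mem_Collect_eq eq)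
    then show ?thesis using v finite_perms[of n] by (simp add: sum.delta)
  qed
  show "lookup (antisymmetrize n (monom \<mu>)) \<beta> = 0" if "\<nexists>v. v permutes {1..n} \<and> \<beta> = act v \<mu>"
    unfolding lk using that by (intro sum.neutral) auto
qed

text \<open>
  The Vandermonde determinant formula in the variables \<open>x\<^sub>i\<^sup>c\<close>. Both sides are antisymmetric and have coefficient 1 at the
  exponent \<open>rho c n\<close>. In an antisymmetric polynomial an exponent with two equal entries has coefficient 0. If the exponent
  occurs in the product and its entries are distinct, then the entries divided by \<open>c\<close> are \<open>n\<close> distinct numbers with the
  sum of \<open>0, \<dots>, n - 1\<close>. So the exponent is a rearrangement of \<open>rho c n\<close>.
\<close>

lemma antisymmetrize_rho:
  assumes c: "1 \<le> c"
  shows "antisymmetrize n (monom (rho c n)) = vandermonde c n"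
proof (rule poly_mapping_eqI)
  fix \<beta>
  have inj: "inj_on (lookup (rho c n)) {1..n}"
    using c by (auto simp: inj_on_def lookup_rho)
  have anti: "lookup (vandermonde c n) (act w \<gamma>) = of_int (sign w) * lookup (vandermonde c n) \<gamma>"
    if "w permutes {1..n}" for w \<gamma>
    by (rule lookup_antisymmetric[OF act_poly_vandermonde that])
  show "lookup (antisymmetrize n (monom (rho c n))) \<beta> = lookup (vandermonde c n) \<beta>"
  proof (cases "\<exists>v. v permutes {1..n} \<and> \<beta> = act v (rho c n)")
    case True
    then obtain v where v: "v permutes {1..n}" "\<beta> = act v (rho c n)" by blast
    then show ?thesis
      using lookup_antisymmetrize_monom(1)[OF inj v(1)] anti[OF v(1), of "rho c n"] lookup_vandermonde_rho[OF c] by simp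
  next
    case False
    have "lookup (vandermonde c n) \<beta> = 0"
    proof (rule ccontr)
      assume nz: "lookup (vandermonde c n) \<beta> \<noteq> 0"
      then have "\<beta> \<in> keys (vandermonde c n)" by (simp add: in_keys_iff)
      note \<beta> = keys_vandermonde[OF c this]
      define q where "q = (\<lambda>a. lookup \<beta> a div c)"
      have q: "lookup \<beta> a = c * q a" for a using \<beta>(2)[of a] by (simp add: q_def)
      have "inj_on q {1..n}"
      proof (rule inj_onI, rule ccontr)
        fix a b assume ab: "a \<in> {1..n}" "b \<in> {1..n}" "q a = q b" "a \<noteq> b"
        have t: "transpose a b permutes {1..n}" using ab by (intro permutes_swap_id)
        have "act (transpose a b) \<beta> = \<beta>"
        proof (rule poly_mapping_eqI)
          fix x
          have "q (transpose a b x) = q x" using ab(3) by (simp add: transpose_def)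
          then show "lookup (act (transpose a b) \<beta>) x = lookup \<beta> x"
            by (simp add: lookup_act q)
        qed
        then have "lookup (vandermonde c n) \<beta> = - lookup (vandermonde c n) \<beta>"
          using anti[OF t, of \<beta>] ab(4) by (simp add: sign_swap_id)
        then show False using nz by simp
      qed
      have "(\<Sum>a=1..n. c * q a) = (\<Sum>a=1..n. c * (n - a))"
      proof -
        have "weight (\<lambda>_. 1) \<beta> = (\<Sum>a=1..n. c * q a)"
          using weight_superset[OF _ \<beta>(1), of "\<lambda>_. 1"] by (simp add: q)
        moreover have "weight (\<lambda>_. 1) (rho c n) = (\<Sum>a=1..n. c * (n - a))"
          by (subst weight_superset[of "{1..n}"]) (auto simp: in_keys_iff lookup_rho split: if_splits)
        ultimately show ?thesis using \<beta>(3) by simp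
      qed
      then have "(\<Sum>a=1..n. q a) = (\<Sum>a=1..n. n - a)" using c by (simp flip: sum_distrib_left)
      also have "\<dots> = (\<Sum>k<n. k)"
        by (rule sum.reindex_bij_witness[of _ "\<lambda>k. n - k" "\<lambda>a. n - a"]) auto
      finally have "\<Sum>(q ` {1..n}) = (\<Sum>k<card (q ` {1..n}). k)"
        using \<open>inj_on q {1..n}\<close> by (simp add: sum.reindex card_image)
      then have "q ` {1..n} = {..<card (q ` {1..n})}" by (intro sum_ge_sum_lessThan(2)) auto
      then have img: "q ` {1..n} = {..<n}" using \<open>inj_on q {1..n}\<close> by (simp add: card_image)
      \<comment> \<open>In rho c n the entry c * q a stands in position n - q a.\<close>
      define v where "v = (\<lambda>a. if a \<in> {1..n} then n - q a else a)"
      have qn: "q a < n" if "a \<in> {1..n}" for a using img that by blast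
      have "inj_on v {1..n}"
      proof (rule inj_onI)
        fix a b assume ab: "a \<in> {1..n}" "b \<in> {1..n}" "v a = v b"
        then have "q a = q b" using qn[OF ab(1)] qn[OF ab(2)] by (simp add: v_def)
        then show "a = b" using \<open>inj_on q {1..n}\<close> ab by (meson inj_onD)
      qed
      moreover have "v ` {1..n} \<subseteq> {1..n}"
      proof (rule image_subsetI)
        fix a assume "a \<in> {1..n}"
        then show "v a \<in> {1..n}" using qn[of a] by (simp add: v_def)
      qed
      ultimately have "bij_betw v {1..n} {1..n}" by (simp add: bij_betw_def endo_inj_surj)
      then have v: "v permutes {1..n}" by (rule bij_imp_permutes) (auto simp: v_def)
      have "\<beta> = act (inv v) (rho c n)"
      proof (rule poly_mapping_eqI)
        fix a
        have "lookup (act (inv v) (rho c n)) a = lookup (rho c n) (v a)"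
          by (simp only: lookup_act[OF permutes_bij[OF permutes_inv[OF v]]] permutes_inv_inv[OF v])
        also have "\<dots> = lookup \<beta> a"
        proof (cases "a \<in> {1..n}")
          case True
          then have "v a = n - q a" by (simp add: v_def)
          moreover have "n - q a \<in> {1..n}" "n - (n - q a) = q a" using qn[OF True] by auto
          ultimately show ?thesis by (simp only: lookup_rho q if_True)
        next
          case False
          then have "lookup \<beta> a = 0" using \<beta>(1) by (auto simp: in_keys_iff)
          moreover have "v a = a" using False unfolding v_def by (rule if_not_P)
          ultimately show ?thesis using False by (simp only: lookup_rho if_False)
        qed
        finally show "lookup \<beta> a = lookup (act (inv v) (rho c n)) a" by simp
      qed
      then show False using False permutes_inv[OF v] by blast
    qed
    then show ?thesis using lookup_antisymmetrize_monom(2)[OF inj False] by simp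
  qed
qed

section \<open>The key polynomial of an initial staircase\<close>

definition staircase :: "nat \<Rightarrow> composition" where
  "staircase n = (\<Sum>i=1..n. single i (Suc n - i))"

lemma lookup_staircase: "lookup (staircase n) a = (if a \<in> {1..n} then Suc n - a else 0)"
  unfolding staircase_def by (rule lookup_sum_single) simp

lemma shifted_product_staircase:
  "shifted_product (staircase n) = (\<Prod>i=1..n. x_var i) * (\<Prod>(i, j)\<in>pairs n. x_var i + x_var j)"
proof -
  define C D where "C = (\<lambda>i. (i, 1 :: nat)) ` {1..n}" and "D = (\<lambda>(i, j). (i, Suc j - i)) ` pairs n"
  have diag: "diagram (staircase n) = C \<union> D"
  proof (intro set_eqI iffI)
    fix p assume "p \<in> diagram (staircase n)"
    then obtain i j where p: "p = (i, j)" "1 \<le> i" "i \<le> n" "1 \<le> j" "j \<le> Suc n - i"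
      by (auto simp: diagram_def lookup_staircase split: if_splits)
    show "p \<in> C \<union> D"
    proof (cases "j = 1")
      case False
      then show ?thesis
        using p by (intro UnI2) (auto simp: D_def pairs_def intro!: image_eqI[of _ _ "(i, i + j - 1)"])
    qed (use p in \<open>auto simp: C_def\<close>)
  qed (auto simp: C_def D_def pairs_def diagram_def lookup_staircase)
  have "inj_on (\<lambda>(i, j). (i, Suc j - i)) (pairs n)"
    by (auto simp: inj_on_def pairs_def)
  then have "(\<Prod>p\<in>D. box_factor p) = (\<Prod>(i, j)\<in>pairs n. box_factor (i, Suc j - i))"
    unfolding D_def by (simp add: prod.reindex case_prod_unfold comp_def)
  also have "\<dots> = (\<Prod>(i, j)\<in>pairs n. x_var i + x_var j)"
    by (intro prod.cong) (auto simp: pairs_def box_factor_def)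
  finally have D: "(\<Prod>p\<in>D. box_factor p) = (\<Prod>(i, j)\<in>pairs n. x_var i + x_var j)" .
  have C: "(\<Prod>p\<in>C. box_factor p) = (\<Prod>i=1..n. x_var i)"
    unfolding C_def by (subst prod.reindex) (auto simp: inj_on_def box_factor_def)
  have "C \<inter> D = {}" by (auto simp: C_def D_def pairs_def)
  moreover have "finite C" "finite D" by (simp_all add: C_def D_def finite_pairs)
  ultimately show ?thesis
    by (simp add: shifted_product_def diag prod.union_disjoint C D)
qed

text \<open>
  Weyl's character formula for the staircase. The left-hand side \<open>g\<close> is symmetric, so \<open>g\<close> times the Vandermonde product is
  the alternating sum of \<open>x\<^sup>\<rho> g\<close>, and therefore of \<open>x\<^sup>\<rho>\<close> times the staircase monomial. That monomial is
  \<open>x\<^sup>\<rho> x\<^sub>1\<cdots>x\<^sub>n\<close>. The alternating sum of \<open>x\<^bsup>2\<rho>\<^esup>\<close> is \<open>\<Prod>\<^bsub>i<j\<^esub> (x\<^sub>i\<^sup>2 - x\<^sub>j\<^sup>2)\<close>, and the Vandermonde product cancels.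
\<close>

lemma transport_staircase:
  "transport (monom (staircase n)) (\<Sum>k=1..n. single k k) = shifted_product (staircase n)"
proof -
  define \<alpha> :: composition where "\<alpha> = (\<Sum>k=1..n. single k k)"
  define g where "g = transport (monom (staircase n)) \<alpha>"
  define E where "E = (\<Prod>i=1..n. x_var i)"
  have \<alpha>: "lookup \<alpha> a = (if a \<in> {1..n} then a else 0)" for a
    unfolding \<alpha>_def by (rule lookup_sum_single) simp
  then have wk: "weak_composition \<alpha>" and keys: "keys \<alpha> \<subseteq> {1..n}"
    by (auto simp: weak_composition_def in_keys_iff split: if_splits)
  have "act_poly (adj_trans k) g = g" if "1 \<le> k" "k < n" for k
  proof -
    have "ascent \<alpha> k" using that by (simp add: ascent_def \<alpha>)
    then show ?thesis unfolding g_def by (simp add: transport_ascent act_poly_pi_op)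
  qed
  then have sym: "act_poly w g = g" if "w permutes {1..n}" for w
    using act_poly_permutes_symmetric that by blast
  have E: "act_poly w E = E" if w: "w permutes {1..n}" for w
  proof -
    have "act_poly w E = (\<Prod>i=1..n. x_var (w i))"
      unfolding E_def using permutes_bij[OF w] by (simp add: act_poly_prod act_poly_x_var)
    also have "\<dots> = E" unfolding E_def using prod.permute[OF w, of x_var] by (simp add: comp_def)
    finally show ?thesis .
  qed
  have "rho 1 n + staircase n = rho 2 n + (\<Sum>i=1..n. single i 1)"
    by (intro poly_mapping_eqI) (auto simp: lookup_add lookup_rho lookup_staircase lookup_sum_single)
  then have "monom (rho 1 n) * monom (staircase n) = monom (rho 2 n) * monom (\<Sum>i=1..n. single i 1)"
    by (simp only: monom_add[symmetric])
  then have split: "monom (rho 1 n) * monom (staircase n) = monom (rho 2 n) * E"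
    by (simp add: E_def x_var_def monom_sum)
  have "vandermonde 1 n * g = antisymmetrize n (monom (rho 1 n)) * g" by (simp add: antisymmetrize_rho)
  also have "\<dots> = antisymmetrize n (monom (rho 1 n) * g)" by (rule antisymmetrize_mult_invariant[OF sym, symmetric])
  also have "\<dots> = antisymmetrize n (monom (rho 1 n) * monom (staircase n))"
    unfolding g_def by (rule antisymmetrize_transport[OF wk keys])
  also have "\<dots> = antisymmetrize n (monom (rho 2 n)) * E"
    unfolding split by (rule antisymmetrize_mult_invariant[OF E])
  also have "antisymmetrize n (monom (rho 2 n)) = vandermonde 2 n" by (simp add: antisymmetrize_rho)
  also have "vandermonde 2 n = vandermonde 1 n * (\<Prod>(i, j)\<in>pairs n. x_var i + x_var j)"
    unfolding vandermonde_def prod.distrib[symmetric]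
    by (intro prod.cong) (auto simp: power2_eq_square algebra_simps)
  finally have "vandermonde 1 n * g = vandermonde 1 n * shifted_product (staircase n)"
    unfolding shifted_product_staircase E_def by (simp only: mult_ac)
  moreover have "vandermonde 1 n \<noteq> 0"
    using lookup_vandermonde_rho[of 1 n] by (metis lookup_zero order_refl zero_neq_one)
  ultimately show ?thesis by (simp add: g_def \<alpha>_def)
qed

section \<open>Spreading a composition over increasing positions\<close>

definition spread :: "nat \<Rightarrow> (nat \<Rightarrow> nat) \<Rightarrow> (nat \<Rightarrow> nat) \<Rightarrow> composition" where
  "spread n i f = (\<Sum>k=1..n. single (i k) (f k))"

lemma lookup_spread:
  assumes "inj_on i {1..n}"
  shows "k \<in> {1..n} \<Longrightarrow> lookup (spread n i f) (i k) = f k"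
    "a \<notin> i ` {1..n} \<Longrightarrow> lookup (spread n i f) a = 0"
proof -
  assume k: "k \<in> {1..n}"
  have "lookup (spread n i f) (i k) = (\<Sum>l=1..n. if l = k then f l else 0)"
    unfolding spread_def lookup_sum
  proof (rule sum.cong[OF refl])
    fix l assume "l \<in> {1..n}"
    then have "i l = i k \<longleftrightarrow> l = k" using assms k by (auto dest: inj_onD)
    then show "lookup (single (i l) (f l)) (i k) = (if l = k then f l else 0)"
      by (simp add: lookup_single when_def)
  qed
  then show "lookup (spread n i f) (i k) = f k" using k by simp
next
  assume "a \<notin> i ` {1..n}"
  then show "lookup (spread n i f) a = 0"
    unfolding spread_def lookup_sum by (intro sum.neutral) (auto simp: lookup_single when_def)
qed

lemma act_spread: "bij w \<Longrightarrow> act w (spread n i f) = spread n (w \<circ> i) f"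
  by (simp add: spread_def act_sum act_single)

text \<open>
  The right-hand side does not depend on the positions, so spread compositions with the same entries have the same sorted
  composition.
\<close>

lemma conjugate_spread:
  assumes inj: "inj_on i {1..n}" and pos: "\<And>k. k \<in> {1..n} \<Longrightarrow> 1 \<le> i k"
  shows "lookup (conjugate (spread n i f)) c = (if c = 0 then 0 else card {k\<in>{1..n}. c \<le> f k})"
proof (cases "c = 0")
  case False
  have "{a. 1 \<le> a \<and> c \<le> lookup (spread n i f) a} = i ` {k\<in>{1..n}. c \<le> f k}"
  proof (intro set_eqI iffI)
    fix a assume a: "a \<in> {a. 1 \<le> a \<and> c \<le> lookup (spread n i f) a}"
    then have "a \<in> i ` {1..n}" using lookup_spread(2)[OF inj, of a f] False by fastforce
    then obtain k where k: "k \<in> {1..n}" "a = i k" by blast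
    then show "a \<in> i ` {k\<in>{1..n}. c \<le> f k}" using a lookup_spread(1)[OF inj k(1), of f] by simp
  next
    fix a assume "a \<in> i ` {k\<in>{1..n}. c \<le> f k}"
    then obtain k where k: "k \<in> {1..n}" "a = i k" "c \<le> f k" by blast
    then show "a \<in> {a. 1 \<le> a \<and> c \<le> lookup (spread n i f) a}"
      using lookup_spread(1)[OF inj k(1), of f] pos[OF k(1)] by simp
  qed
  moreover have "inj_on i {k\<in>{1..n}. c \<le> f k}" using inj by (rule inj_on_subset) blast
  ultimately show ?thesis using False by (simp add: lookup_conjugate card_image)
qed (simp add: lookup_conjugate)

lemma weak_composition_spread:
  assumes "\<And>k. k \<in> {1..n} \<Longrightarrow> 1 \<le> i k"
  shows "weak_composition (spread n i f)"
  unfolding weak_composition_def spread_def lookup_sum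
  using assms by (intro sum.neutral) (force simp: lookup_single when_def)

definition rectangle :: "nat \<Rightarrow> composition" where
  "rectangle n = spread n id (\<lambda>_. n)"

lemma lookup_rectangle: "lookup (rectangle n) a = (if a \<in> {1..n} then n else 0)"
  using lookup_spread[of id n] by (auto simp: rectangle_def)

lemma is_partition_rectangle: "is_partition (rectangle n)"
  by (auto simp: is_partition_def weak_composition_def lookup_rectangle)

lemma staircase_eq_spread: "staircase n = spread n (\<lambda>k. Suc n - k) id"
  unfolding staircase_def spread_def
  by (rule sum.reindex_bij_witness[of _ "\<lambda>k. Suc n - k" "\<lambda>k. Suc n - k"]) auto

lemma sort_comp_spread:
  assumes inj: "inj_on i {1..n}" and pos: "\<And>k. k \<in> {1..n} \<Longrightarrow> 1 \<le> i k"
  shows "sort_comp (spread n i id) = staircase n" "sort_comp (spread n i (\<lambda>_. n)) = rectangle n"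
proof -
  have inj': "inj_on (\<lambda>k. Suc n - k) {1..n}" by (auto simp: inj_on_def)
  show "sort_comp (spread n i id) = staircase n"
  proof (rule sort_comp_eqI_conjugate[OF weak_composition_spread[OF pos]])
    show "is_partition (staircase n)"
      by (auto simp: is_partition_def weak_composition_def lookup_staircase)
    show "conjugate (staircase n) = conjugate (spread n i id)"
    proof (rule poly_mapping_eqI)
      fix c
      have "lookup (conjugate (staircase n)) c = (if c = 0 then 0 else card {k\<in>{1..n}. c \<le> id k})"
        unfolding staircase_eq_spread by (rule conjugate_spread[OF inj']) auto
      also have "\<dots> = lookup (conjugate (spread n i id)) c"
        by (rule conjugate_spread[OF inj pos, symmetric])
      finally show "lookup (conjugate (staircase n)) c = lookup (conjugate (spread n i id)) c" .
    qed
  qed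
  show "sort_comp (spread n i (\<lambda>_. n)) = rectangle n"
  proof (rule sort_comp_eqI_conjugate[OF weak_composition_spread[OF pos]])
    show "is_partition (rectangle n)" by (rule is_partition_rectangle)
    show "conjugate (rectangle n) = conjugate (spread n i (\<lambda>_. n))"
    proof (rule poly_mapping_eqI)
      fix c
      have "lookup (conjugate (rectangle n)) c = (if c = 0 then 0 else card {k\<in>{1..n}. c \<le> n})"
        unfolding rectangle_def by (rule conjugate_spread) auto
      also have "\<dots> = lookup (conjugate (spread n i (\<lambda>_. n))) c"
        by (rule conjugate_spread[OF inj pos, symmetric])
      finally show "lookup (conjugate (rectangle n)) c = lookup (conjugate (spread n i (\<lambda>_. n))) c" .
    qed
  qed
qed

lemma half_le_rectangle: "half_le (rectangle n) = staircase n"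
proof (rule poly_mapping_eqI)
  fix a
  show "lookup (half_le (rectangle n)) a = lookup (staircase n) a"
    by (auto simp: half_le_partition(2)[OF is_partition_rectangle] lookup_rectangle lookup_staircase)
qed

text \<open>
  If no entry can move to the left into an empty position, then the positions are \<open>1, \<dots>, n\<close>.
\<close>

lemma initial_if_not_movable:
  fixes i :: "nat \<Rightarrow> nat"
  assumes mono: "strict_mono_on {1..n} i" and pos: "\<And>k. k \<in> {1..n} \<Longrightarrow> 1 \<le> i k"
    and stuck: "\<And>k. k \<in> {1..n} \<Longrightarrow> 2 \<le> i k \<Longrightarrow> i k - 1 \<in> i ` {1..n}"
  shows "k \<in> {1..n} \<Longrightarrow> i k = k"
proof (induction k rule: less_induct)
  case (less k)
  have ge: "k \<le> i k"
  proof (cases "k = 1")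
    case False
    then have "k - 1 \<in> {1..n}" "k - 1 < k" using less.prems by auto
    then have "i (k - 1) = k - 1" "i (k - 1) < i k"
      using less strict_mono_onD[OF mono] by blast+
    then show ?thesis by simp
  qed (use pos less.prems in simp)
  show ?case
  proof (rule ccontr)
    assume "i k \<noteq> k"
    then have gt: "k < i k" using ge by simp
    then have "i k - 1 \<in> i ` {1..n}" using stuck[OF less.prems] less.prems by simp
    then obtain m where m: "m \<in> {1..n}" "i k - 1 = i m" by blast
    have "\<not> k \<le> m"
    proof
      assume "k \<le> m"
      then have "i k \<le> i m"
        using strict_mono_onD[OF mono less.prems m(1)] by (cases "k = m") auto
      then show False using m(2) gt by simp
    qed
    then have "i m = m" "m < k" using less.IH m(1) by simp_all
    then show False using m(2) gt by simp
  qed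
qed

text \<open>
  Induction on the sum of the positions. Moving an entry to the left into an empty position removes an ascent of both
  compositions, so both sides lose the same operator. Once the positions are \<open>1, \<dots>, n\<close>, the square is a partition and
  the outer transport does nothing.
\<close>

lemma transport_spread:
  assumes "1 \<le> n" "strict_mono_on {1..n} i" "\<And>k. k \<in> {1..n} \<Longrightarrow> 1 \<le> i k"
  shows "transport (transport f (spread n id id)) (spread n i (\<lambda>_. n)) = transport f (spread n i id)"
  using assms(2,3)
proof (induction "\<Sum>k=1..n. i k" arbitrary: i rule: less_induct)
  case less
  note mono = less.prems(1) and pos = less.prems(2)
  have inj: "inj_on i {1..n}" by (rule strict_mono_on_imp_inj_on[OF mono])
  show ?case
  proof (cases "\<exists>k\<in>{1..n}. 2 \<le> i k \<and> i k - 1 \<notin> i ` {1..n}")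
    case True
    then obtain k j where k: "k \<in> {1..n}" "i k = Suc j" "1 \<le> j" "j \<notin> i ` {1..n}"
      by (metis One_nat_def Suc_1 Suc_le_D Suc_le_mono diff_Suc_1)
    define i' where "i' = adj_trans j \<circ> i"
    have i': "i' l = (if l = k then j else i l)" if "l \<in> {1..n}" for l
    proof (cases "l = k")
      case False
      then have "i l \<noteq> Suc j" "i l \<noteq> j" using that k inj by (metis inj_onD, blast)
      then show ?thesis using False by (simp add: i'_def adj_trans_other)
    qed (simp add: i'_def k)
    have "(\<Sum>l=1..n. i' l) < (\<Sum>l=1..n. i l)"
    proof (rule sum_strict_mono_ex1)
      show "\<forall>l\<in>{1..n}. i' l \<le> i l" using i' k by simp
      show "\<exists>l\<in>{1..n}. i' l < i l" using i' k by (intro bexI[of _ k]) simp_all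
    qed simp
    moreover have "strict_mono_on {1..n} i'"
    proof (rule strict_mono_onI)
      fix a b assume ab: "a \<in> {1..n}" "b \<in> {1..n}" "a < b"
      then have lt: "i a < i b" using strict_mono_onD[OF mono] by blast
      have "i a \<noteq> j" using ab(1) k(4) by blast
      then show "i' a < i' b"
        using lt ab k(2) unfolding i'[OF ab(1)] i'[OF ab(2)] by (cases "a = k"; cases "b = k") simp_all
    qed
    moreover have "1 \<le> i' l" if "l \<in> {1..n}" for l using i'[OF that] pos[OF that] k(3) by simp
    ultimately have IH: "transport (transport f (spread n id id)) (spread n i' (\<lambda>_. n)) = transport f (spread n i' id)"
      by (rule less.hyps)
    have swap: "swap j (spread n i h) = spread n i' h" for h by (simp add: act_spread i'_def)
    have asc: "ascent (spread n i h) j" if "0 < h k" for h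
      using that k lookup_spread(1)[OF inj k(1), of h] lookup_spread(2)[OF inj k(4), of h] by (simp add: ascent_def)
    have "transport (transport f (spread n id id)) (spread n i (\<lambda>_. n)) =
        pi_op j (transport (transport f (spread n id id)) (spread n i' (\<lambda>_. n)))"
    proof -
      have "0 < n" using assms(1) by simp
      from transport_ascent[OF asc[of "\<lambda>_. n", OF this], of "transport f (spread n id id)"] show ?thesis unfolding swap .
    qed
    also have "\<dots> = transport f (spread n i id)"
    proof -
      have "0 < id k" using k(1) by simp
      from transport_ascent[OF asc[of id, OF this], of f] show ?thesis unfolding IH swap ..
    qed
    finally show ?thesis .
  next
    case False
    have "i k = k" if "k \<in> {1..n}" for k
      by (rule initial_if_not_movable[OF mono pos _ that]) (use False in blast)+
    then have eq: "spread n i h = spread n id h" for h unfolding spread_def by (intro sum.cong) auto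
    show ?thesis
      unfolding eq rectangle_def[symmetric] by (rule transport_partition[OF is_partition_rectangle])
  qed
qed

lemma key_poly_spread:
  assumes "1 \<le> n" "strict_mono_on {1..n} i" "\<And>k. k \<in> {1..n} \<Longrightarrow> 1 \<le> i k"
  shows "key_poly (spread n i id) =
    scale (1 / 2 ^ diag (spread n i (\<lambda>_. n))) (Q_key_poly (spread n i (\<lambda>_. n)))"
proof -
  have inj: "inj_on i {1..n}" by (rule strict_mono_on_imp_inj_on[OF assms(2)])
  note weak = weak_composition_spread[OF assms(3)]
  have "key_poly (spread n i id) = transport (monom (staircase n)) (spread n i id)"
    by (simp only: key_poly_transport[OF weak] sort_comp_spread[OF inj assms(3)])
  also have "\<dots> = transport (transport (monom (staircase n)) (spread n id id)) (spread n i (\<lambda>_. n))"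
    by (rule transport_spread[OF assms, symmetric])
  also have "transport (monom (staircase n)) (spread n id id) = shifted_product (staircase n)"
    using transport_staircase by (simp add: spread_def)
  also have "transport (shifted_product (staircase n)) (spread n i (\<lambda>_. n)) =
      scale (1 / 2 ^ diag (spread n i (\<lambda>_. n))) (Q_key_poly (spread n i (\<lambda>_. n)))"
    by (simp only: scaled_Q_key_poly[OF weak] sort_comp_spread[OF inj assms(3)] half_le_rectangle)
  finally show ?thesis .
qed

section \<open>Coincidences force a rectangle\<close>

text \<open>
  Each of the two partitions is an exponent of the common polynomial, hence is dominated by the other one. This gives
  \<open>\<lambda>(\<alpha>) = \<mu>\<close>, and a drop of at least 2 is excluded by the invariant difference of two coefficients. Together with
  strictness, consecutive nonzero rows differ by exactly 1, and the last one is 1.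
\<close>

lemma key_poly_eq_transport_imp_staircase:
  assumes \<alpha>: "weak_composition \<alpha>" "\<alpha> \<noteq> 0" and \<gamma>: "weak_composition \<gamma>" and \<mu>: "strict_partition \<mu>"
    and eq: "key_poly \<alpha> = transport (shifted_product \<mu>) \<gamma>"
  shows "\<exists>n\<ge>1. \<mu> = staircase n"
proof -
  define \<nu> where "\<nu> = sort_comp \<alpha>"
  have part: "is_partition \<mu>" "is_partition \<nu>"
    using \<mu> is_partition_sort_comp[OF \<alpha>(1)] by (simp_all add: strict_partition_def \<nu>_def)
  have weak: "weak_composition \<mu>" using part(1) by (simp add: is_partition_def)
  have key: "key_poly \<alpha> = transport (monom \<nu>) \<alpha>" unfolding \<nu>_def by (rule key_poly_transport[OF \<alpha>(1)])
  have dom: "keys (shifted_product \<mu>) \<subseteq> dominated \<mu>" by (rule keys_shifted_product_dominated[OF \<mu>])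
  have dom': "keys (monom \<nu>) \<subseteq> dominated \<nu>" using partition_dominated_self[OF part(2)] by simp
  have "lookup (key_poly \<alpha>) \<mu> = 1"
    unfolding eq lookup_transport_partition[OF \<gamma> part(1) dom] by (rule lookup_shifted_product_self[OF weak])
  then have "\<mu> \<in> keys (key_poly \<alpha>)" by (simp add: in_keys_iff)
  then have 1: "\<mu> \<in> dominated \<nu>"
    unfolding key using keys_transport_subset[OF \<alpha>(1) string_closed_dominated dom'] by (rule rev_subsetD)
  have "lookup (key_poly \<alpha>) \<nu> = 1"
    unfolding key lookup_transport_partition[OF \<alpha>(1) part(2) dom'] by (simp add: lookup_monom)
  then have "\<nu> \<in> keys (key_poly \<alpha>)" by (simp add: in_keys_iff)
  then have 2: "\<nu> \<in> dominated \<mu>"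
    unfolding eq using keys_transport_subset[OF \<gamma> string_closed_dominated dom] by (rule rev_subsetD)
  have \<nu>: "\<nu> = \<mu>" by (rule dominated_antisym[OF part(2,1) 2 1])
  have no_gap: "lookup \<mu> i \<le> Suc (lookup \<mu> (Suc i))" if i: "1 \<le> i" for i
  proof (rule ccontr)
    assume "\<not> ?thesis"
    then have gap: "lookup \<mu> (Suc i) + 2 \<le> lookup \<mu> i" by simp
    note inv = transport_string_invariant[OF _ part(1) _ i gap]
    note ne = lower_swap_distinct[OF gap]
    have "lookup (key_poly \<alpha>) (lower i \<mu>) - lookup (key_poly \<alpha>) (swap i \<mu>) = 1"
      unfolding eq inv[OF \<gamma> dom] lookup_shifted_product_gap[OF weak i gap] by simp
    moreover have "lookup (key_poly \<alpha>) (lower i \<mu>) - lookup (key_poly \<alpha>) (swap i \<mu>) = 0"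
      unfolding key \<nu> inv[OF \<alpha>(1) dom'[unfolded \<nu>]] lookup_monom by (simp only: ne if_False diff_self)
    ultimately show False by simp
  qed
  have step: "lookup \<mu> (Suc i) = lookup \<mu> i - 1" if i: "1 \<le> i" for i
  proof (cases "lookup \<mu> (Suc i) = 0")
    case True
    then show ?thesis using no_gap[OF i] by simp
  next
    case False
    then show ?thesis using no_gap[OF i] strict_partition_shift[OF \<mu> i, of "Suc i"] by simp
  qed
  define n where "n = lookup \<mu> 1"
  have lk: "lookup \<mu> (Suc i) = n - i" for i
    by (induction i) (simp_all add: n_def step)
  have "\<mu> = staircase n"
  proof (rule poly_mapping_eqI)
    fix a
    show "lookup \<mu> a = lookup (staircase n) a"
    proof (cases a)
      case 0
      then show ?thesis using weak by (simp add: weak_composition_def lookup_staircase)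
    next
      case (Suc i)
      then show ?thesis by (simp add: lk lookup_staircase)
    qed
  qed
  moreover have "n \<noteq> 0"
  proof
    assume "n = 0"
    then have "sort_comp \<alpha> = 0"
      using \<open>\<mu> = staircase n\<close> \<nu> by (simp add: \<nu>_def staircase_def)
    then have "act (u_perm \<alpha>) (sort_comp \<alpha>) = 0"
      using S_inf_bij[OF u_perm(1)[OF \<alpha>(1)]] by simp
    then show False using u_perm(2)[OF \<alpha>(1)] \<alpha>(2) by metis
  qed
  ultimately show ?thesis by (metis One_nat_def Suc_leI neq0_conv)
qed

text \<open>
  The half determines the first \<open>n\<close> rows. A further nonempty row would, by symmetry, make the first row longer than
  \<open>n\<close>.
\<close>

lemma half_le_eq_staircase_imp_rectangle:
  assumes part: "is_partition \<tau>" and sym: "conjugate \<tau> = \<tau>" and half: "half_le \<tau> = staircase n" and n: "1 \<le> n"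
  shows "\<tau> = rectangle n"
proof (rule poly_mapping_eqI)
  have h: "lookup \<tau> a - (a - 1) = (if a \<le> n then Suc n - a else 0)" if "1 \<le> a" for a
    using half_le_partition(2)[OF part, of a] that by (simp add: half lookup_staircase)
  have in_rows: "lookup \<tau> a = n" if "1 \<le> a" "a \<le> n" for a
    using h[OF that(1)] that by simp
  have "lookup \<tau> (Suc n) = 0"
  proof (rule ccontr)
    assume "lookup \<tau> (Suc n) \<noteq> 0"
    then have "Suc n \<le> lookup (conjugate \<tau>) 1"
      using partition_conjugate_iff[OF part, of "Suc n" 1] by simp
    then show False using in_rows[of 1] n by (simp add: sym)
  qed
  then have below: "lookup \<tau> a = 0" if "n < a" for a
    using part that unfolding is_partition_def by (metis Suc_leI le_add1 le_zero_eq plus_1_eq_Suc)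
  fix a
  show "lookup \<tau> a = lookup (rectangle n) a"
    using in_rows below part
    by (cases "a = 0") (auto simp: lookup_rectangle is_partition_def weak_composition_def not_le)
qed

text \<open>
  The positions of the entries \<open>n\<close> are the images of \<open>1, \<dots>, n\<close> under the sorting permutation; they only have to be
  listed in increasing order.
\<close>

lemma spread_of_rectangle:
  assumes \<gamma>: "weak_composition \<gamma>" and sort: "sort_comp \<gamma> = rectangle n"
  obtains i where "strict_mono_on {1..n} i" "\<And>k. k \<in> {1..n} \<Longrightarrow> 1 \<le> i k" "\<gamma> = spread n i (\<lambda>_. n)"
proof -
  define u where "u = u_perm \<gamma>"
  have u: "bij u" "u 0 = 0" using u_perm(1)[OF \<gamma>] S_inf_bij S_inf_zero by (simp_all add: u_def)
  define I where "I = u ` {1..n}"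
  have inj: "inj_on u {1..n}" using bij_is_inj[OF u(1)] by (rule inj_on_subset) simp
  have I: "finite I" "card I = n" using card_image[OF inj] by (simp_all add: I_def)
  have "0 \<notin> I"
  proof
    assume "0 \<in> I"
    then obtain k where "k \<in> {1..n}" "u k = u 0" using u(2) by (auto simp: I_def)
    then have "k = 0" using bij_is_inj[OF u(1)] by (simp only: inj_eq)
    then show False using \<open>k \<in> {1..n}\<close> by simp
  qed
  have "\<gamma> = act u (rectangle n)" using u_perm(2)[OF \<gamma>] unfolding sort u_def .
  also have "\<dots> = spread n u (\<lambda>_. n)" by (simp add: rectangle_def act_spread[OF u(1)])
  also have "\<dots> = (\<Sum>a\<in>I. single a n)"
    unfolding spread_def I_def using sum.reindex[OF inj, of "\<lambda>a. single a n"]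
    by (simp only: comp_def)
  finally have \<gamma>I: "\<gamma> = (\<Sum>a\<in>I. single a n)" .
  obtain h where h: "bij_betw h {..<card I} I" "strict_mono_on {..<card I} h"
    by (rule ex_bij_betw_strict_mono_card[OF I(1)])
  define i where "i = (\<lambda>k. h (k - 1))"
  have "bij_betw (\<lambda>k. k - 1) {1..n} {..<n}"
    by (rule bij_betw_byWitness[of _ Suc]) auto
  then have i: "bij_betw i {1..n} I"
    using bij_betw_trans[of "\<lambda>k. k - 1" "{1..n}" "{..<n}" h I] h(1) I(2) by (simp add: i_def comp_def)
  show ?thesis
  proof (rule that)
    show "strict_mono_on {1..n} i"
    proof (rule strict_mono_onI)
      fix a b assume "a \<in> {1..n}" "b \<in> {1..n}" "a < b"
      then have "a - 1 \<in> {..<card I}" "b - 1 \<in> {..<card I}" "a - 1 < b - 1" using I(2) by auto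
      then show "i a < i b" unfolding i_def by (rule strict_mono_onD[OF h(2)])
    qed
    show "1 \<le> i k" if "k \<in> {1..n}" for k
      using bij_betwE[OF i] that \<open>0 \<notin> I\<close> by (metis less_one not_le)
    show "\<gamma> = spread n i (\<lambda>_. n)"
      unfolding \<gamma>I spread_def by (rule sum.reindex_bij_betw[OF i, symmetric])
  qed
qed

theorem proposition2p46:
  fixes \<alpha> \<gamma> :: composition
  assumes "weak_composition \<alpha>" and "\<alpha> \<noteq> 0" and "symmetric \<gamma>"
  shows "key_poly \<alpha> = scale (1 / 2 ^ diag \<gamma>) (Q_key_poly \<gamma>) \<longleftrightarrow>
    (\<exists>(n::nat) (i::nat \<Rightarrow> nat). n \<ge> 1 \<and> 1 \<le> i 1 \<and> strict_mono_on {1..n} i \<and>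
       \<alpha> = (\<Sum>k = 1..n. Poly_Mapping.single (i k) k) \<and>
       \<gamma> = (\<Sum>k = 1..n. Poly_Mapping.single (i k) n))"
proof
  have \<gamma>: "weak_composition \<gamma>" and sym: "conjugate (sort_comp \<gamma>) = sort_comp \<gamma>"
    using assms(3) by (simp_all add: symmetric_def)
  note part = is_partition_sort_comp[OF \<gamma>]
  assume eq: "key_poly \<alpha> = scale (1 / 2 ^ diag \<gamma>) (Q_key_poly \<gamma>)"
  then have "key_poly \<alpha> = transport (shifted_product (half_le (sort_comp \<gamma>))) \<gamma>"
    by (simp only: scaled_Q_key_poly[OF \<gamma>])
  from key_poly_eq_transport_imp_staircase[OF assms(1,2) \<gamma> half_le_partition(1)[OF part] this]
  obtain n where n: "1 \<le> n" "half_le (sort_comp \<gamma>) = staircase n" by blast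
  have "sort_comp \<gamma> = rectangle n"
    by (rule half_le_eq_staircase_imp_rectangle[OF part sym n(2,1)])
  from spread_of_rectangle[OF \<gamma> this] obtain i where
    i: "strict_mono_on {1..n} i" "\<And>k. k \<in> {1..n} \<Longrightarrow> 1 \<le> i k" "\<gamma> = spread n i (\<lambda>_. n)" by blast
  have key: "key_poly \<alpha> = key_poly (spread n i id)"
    unfolding eq unfolding i(3) by (rule key_poly_spread[OF n(1) i(1,2), symmetric])
  have "\<alpha> = spread n i id"
    by (rule key_poly_inject[OF assms(1) weak_composition_spread[OF i(2)] key])
  moreover have "1 \<le> i 1" using i(2) n(1) by simp
  ultimately show "\<exists>(n::nat) (i::nat \<Rightarrow> nat). n \<ge> 1 \<and> 1 \<le> i 1 \<and> strict_mono_on {1..n} i \<and>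
       \<alpha> = (\<Sum>k = 1..n. single (i k) k) \<and>
       \<gamma> = (\<Sum>k = 1..n. single (i k) n)"
    using n(1) i(1,3) unfolding spread_def id_apply by blast
next
  assume "\<exists>(n::nat) (i::nat \<Rightarrow> nat). n \<ge> 1 \<and> 1 \<le> i 1 \<and> strict_mono_on {1..n} i \<and>
       \<alpha> = (\<Sum>k = 1..n. single (i k) k) \<and>
       \<gamma> = (\<Sum>k = 1..n. single (i k) n)"
  then obtain n i where n: "1 \<le> n" and i: "1 \<le> i 1" "strict_mono_on {1..n} i"
    and \<alpha>: "\<alpha> = spread n i id" and \<gamma>: "\<gamma> = spread n i (\<lambda>_. n)"
    unfolding spread_def id_apply by blast
  have "1 \<le> i k" if k: "k \<in> {1..n}" for k
  proof (cases "k = 1")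
    case False
    then have "i 1 < i k" using k n by (intro strict_mono_onD[OF i(2)]) auto
    then show ?thesis by simp
  qed (use i in simp)
  then show "key_poly \<alpha> = scale (1 / 2 ^ diag \<gamma>) (Q_key_poly \<gamma>)"
    unfolding \<alpha> \<gamma> by (rule key_poly_spread[OF n i(2)])
qed

end
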